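(* Let $\mathcal{T}$ be a triangulation of $P_n$ in which each triangle contains the vertex $0$. (1) If $\mathcal{C}$ is a category with cofibrations, then the $2$-Segal map $f_{\mathcal{T}}\colon S_n\mathcal{C}\to\operatorname{holim}_{I\in\mathcal{T}}S_I\mathcal{C}$ of the simplicial category $S_\bullet\mathcal{C}$ is an equivalence of categories. (2) If $\mathcal{C}$ is a Waldhausen category, then the $2$-Segal map $f_{\mathcal{T}}\colon wS_n\mathcal{C}\to\operatorname{holim}_{I\in\mathcal{T}}wS_I\mathcal{C}$ of the simplicial category $wS_\bullet\mathcal{C}$ is an equivalence of categories.
   Context: A category with cofibrations is a (small) category $\mathcal{C}$ with a zero object $0$ and a distinguished class of morphisms, the cofibrations (written $\rightarrowtail$), such that: for every object $A$ the map $0\to A$ is a cofibration; every isomorphism is a cofibration; cofibrations are closed under composition; the pushout of a cofibration along any morphism exists and is a cofibration. A cofibration sequence $A\rightarrowtail B\twoheadrightarrow D$ is a cofibration followed by its cokernel, i.e. $D$ is a pushout of $0\leftarrow A\rightarrowtail B$. A Waldhausen category is a category with cofibrations together with a class $w$ of morphisms (weak equivalences) containing all isomorphisms, closed under composition, and such that for every commutative diagram from $B\leftarrowtail A\to C$ to $B'\leftarrowtail A'\to C'$ whose three vertical maps are in $w$, the induced map $B\cup_A C\to B'\cup_{A'}C'$ is in $w$. For a finite nonempty totally ordered set $I$ (e.g. $[n]=\{0<1<\dots<n\}$), $\mathrm{Ar}(I)$ is the poset of pairs $(i,j)$, $i\le j$ in $I$, with $(i,j)\le(i',j')$ iff $i\le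 i'$ and $j\le j'$. $S_I\mathcal{C}$ is the full subcategory of functors $A\colon \mathrm{Ar}(I)\to\mathcal{C}$, $(i,j)\mapsto A_{i,j}$, with $A_{j,j}=0$ for all $j$ and $A_{i,j}\rightarrowtail A_{i,k}\twoheadrightarrow A_{j,k}$ a cofibration sequence for all $i<j<k$; $S_n\mathcal{C}=S_{[n]}\mathcal{C}$. $wS_I\mathcal{C}$ is the subcategory of $S_I\mathcal{C}$ with all objects and with morphisms the natural transformations that are componentwise in $w$. Precomposition gives simplicial categories $S_\bullet\mathcal{C}$ and $wS_\bullet\mathcal{C}$. $P_n$ is the regular $(n+1)$-gon with vertices labeled cyclically $0,1,\dots,n$. A triangulation $\mathcal{T}$ of $P_n$ is a subdivision into triangles with vertices among those of $P_n$; a diagonal is an edge of a triangle that is not an edge of $P_n$. Regard $\mathcal{T}$ as the poset (under inclusion) of vertex sets of its triangles and diagonals. The restriction functors $X_n\to X_I$ for $I\subseteq[n]$ (where $X_I\cong X_{|I|-1}$) induce the $2$-Segal map $f_{\mathcal{T}}\colon X_n\to\operatorname{holim}_{I\in\mathcal{T}}X_I$ of a simplicial category $X$; the target is the iterated homotopy fiber product of the $X_T$ ($T$ a triangle) over the $X_e$ ($e$ a diagonal). Homotopy limits of categories are taken in the canonical model structure on small categories (weak equivalences: equivalences of categories; cofibrations: functors injective on objects; fibrations: isofibrations). *)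

theory Defs
  imports "HOL-Analysis.Analysis"
begin

section \<open>Small categories\<close>

record ('o, 'm) cat =
  Obj :: "'o set"
  Arr :: "'m set"
  Dom :: "'m \<Rightarrow> 'o"
  Cod :: "'m \<Rightarrow> 'o"
  Idt :: "'o \<Rightarrow> 'm"
  Comp :: "'m \<Rightarrow> 'm \<Rightarrow> 'm" (infixl "\<cdot>\<index>" 70)

text \<open>Composition is written in applicative order: in \<open>g \<cdot> f\<close> the arrow \<open>f\<close> comes first.\<close>

definition hom :: "('o, 'm, 'x) cat_scheme \<Rightarrow> 'o \<Rightarrow> 'o \<Rightarrow> 'm set" where
  "hom C a b = {f \<in> Arr C. Dom C f = a \<and> Cod C f = b}"

locale category =
  fixes C :: "('o, 'm, 'x) cat_scheme" (structure)
  assumes dom_obj: "f \<in> Arr C \<Longrightarrow> Dom C f \<in> Obj C"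
    and cod_obj: "f \<in> Arr C \<Longrightarrow> Cod C f \<in> Obj C"
    and idt_hom: "a \<in> Obj C \<Longrightarrow> Idt C a \<in> hom C a a"
    and comp_hom: "\<lbrakk>f \<in> hom C a b; g \<in> hom C b c\<rbrakk> \<Longrightarrow> g \<cdot> f \<in> hom C a c"
    and comp_idt_left: "f \<in> Arr C \<Longrightarrow> Idt C (Cod C f) \<cdot> f = f"
    and comp_idt_right: "f \<in> Arr C \<Longrightarrow> f \<cdot> Idt C (Dom C f) = f"
    and comp_assoc: "\<lbrakk>f \<in> hom C a b; g \<in> hom C b c; h \<in> hom C c d\<rbrakk>
      \<Longrightarrow> h \<cdot> (g \<cdot> f) = (h \<cdot> g) \<cdot> f"

definition is_iso :: "('o, 'm, 'x) cat_scheme \<Rightarrow> 'm \<Rightarrow> bool" where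
  "is_iso C f \<longleftrightarrow> f \<in> Arr C \<and>
     (\<exists>g \<in> hom C (Cod C f) (Dom C f).
        g \<cdot>\<^bsub>C\<^esub> f = Idt C (Dom C f) \<and> f \<cdot>\<^bsub>C\<^esub> g = Idt C (Cod C f))"

definition is_zero_object :: "('o, 'm, 'x) cat_scheme \<Rightarrow> 'o \<Rightarrow> bool" where
  "is_zero_object C z \<longleftrightarrow> z \<in> Obj C \<and>
     (\<forall>a \<in> Obj C. (\<exists>!f. f \<in> hom C z a) \<and> (\<exists>!f. f \<in> hom C a z))"

text \<open>\<open>is_pushout C f g p q\<close>: the span \<open>f : a \<rightarrow> b\<close>, \<open>g : a \<rightarrow> c\<close> has the
  pushout cocone \<open>p : b \<rightarrow> d\<close>, \<open>q : c \<rightarrow> d\<close>.\<close>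

definition is_pushout ::
  "('o, 'm, 'x) cat_scheme \<Rightarrow> 'm \<Rightarrow> 'm \<Rightarrow> 'm \<Rightarrow> 'm \<Rightarrow> bool" where
  "is_pushout C f g p q \<longleftrightarrow>
     f \<in> Arr C \<and> g \<in> Arr C \<and> p \<in> Arr C \<and> q \<in> Arr C \<and>
     Dom C f = Dom C g \<and> Dom C p = Cod C f \<and> Dom C q = Cod C g \<and> Cod C p = Cod C q \<and>
     p \<cdot>\<^bsub>C\<^esub> f = q \<cdot>\<^bsub>C\<^esub> g \<and>
     (\<forall>x \<in> Obj C. \<forall>u \<in> hom C (Cod C f) x. \<forall>v \<in> hom C (Cod C g) x.
        u \<cdot>\<^bsub>C\<^esub> f = v \<cdot>\<^bsub>C\<^esub> g \<longrightarrow>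
        (\<exists>!h. h \<in> hom C (Cod C p) x \<and> h \<cdot>\<^bsub>C\<^esub> p = u \<and> h \<cdot>\<^bsub>C\<^esub> q = v))"


section \<open>Functors and equivalences\<close>

record ('o, 'm, 'p, 'q) ftor =
  fobj :: "'o \<Rightarrow> 'p"
  farr :: "'m \<Rightarrow> 'q"

definition is_functor ::
  "('o, 'm, 'x) cat_scheme \<Rightarrow> ('p, 'q, 'y) cat_scheme \<Rightarrow> ('o, 'm, 'p, 'q) ftor \<Rightarrow> bool" where
  "is_functor C D F \<longleftrightarrow>
     (\<forall>a \<in> Obj C. fobj F a \<in> Obj D) \<and>
     (\<forall>f \<in> Arr C. farr F f \<in> hom D (fobj F (Dom C f)) (fobj F (Cod C f))) \<and>
     (\<forall>a \<in> Obj C. farr F (Idt C a) = Idt D (fobj F a)) \<and>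
     (\<forall>f \<in> Arr C. \<forall>g \<in> Arr C. Dom C g = Cod C f \<longrightarrow>
        farr F (g \<cdot>\<^bsub>C\<^esub> f) = farr F g \<cdot>\<^bsub>D\<^esub> farr F f)"

definition id_ftor :: "('o, 'm, 'o, 'm) ftor" where
  "id_ftor = \<lparr>fobj = (\<lambda>a. a), farr = (\<lambda>f. f)\<rparr>"

definition comp_ftor ::
  "('p, 'q, 'r, 's) ftor \<Rightarrow> ('o, 'm, 'p, 'q) ftor \<Rightarrow> ('o, 'm, 'r, 's) ftor" where
  "comp_ftor G F = \<lparr>fobj = fobj G \<circ> fobj F, farr = farr G \<circ> farr F\<rparr>"

definition is_nat_trans ::
  "('o, 'm, 'x) cat_scheme \<Rightarrow> ('p, 'q, 'y) cat_scheme \<Rightarrow>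
   ('o, 'm, 'p, 'q) ftor \<Rightarrow> ('o, 'm, 'p, 'q) ftor \<Rightarrow> ('o \<Rightarrow> 'q) \<Rightarrow> bool" where
  "is_nat_trans C D F G \<eta> \<longleftrightarrow>
     (\<forall>a \<in> Obj C. \<eta> a \<in> hom D (fobj F a) (fobj G a)) \<and>
     (\<forall>f \<in> Arr C. \<eta> (Cod C f) \<cdot>\<^bsub>D\<^esub> farr F f = farr G f \<cdot>\<^bsub>D\<^esub> \<eta> (Dom C f))"

definition is_nat_iso ::
  "('o, 'm, 'x) cat_scheme \<Rightarrow> ('p, 'q, 'y) cat_scheme \<Rightarrow>
   ('o, 'm, 'p, 'q) ftor \<Rightarrow> ('o, 'm, 'p, 'q) ftor \<Rightarrow> ('o \<Rightarrow> 'q) \<Rightarrow> bool" where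
  "is_nat_iso C D F G \<eta> \<longleftrightarrow> is_nat_trans C D F G \<eta> \<and> (\<forall>a \<in> Obj C. is_iso D (\<eta> a))"

definition is_equivalence ::
  "('o, 'm, 'x) cat_scheme \<Rightarrow> ('p, 'q, 'y) cat_scheme \<Rightarrow> ('o, 'm, 'p, 'q) ftor \<Rightarrow> bool" where
  "is_equivalence C D F \<longleftrightarrow>
     category C \<and> category D \<and> is_functor C D F \<and>
     (\<exists>G \<eta> \<epsilon>. is_functor D C G \<and>
        is_nat_iso C C id_ftor (comp_ftor G F) \<eta> \<and>
        is_nat_iso D D (comp_ftor F G) id_ftor \<epsilon>)"

text \<open>Objects of a functor category are functors that are \<open>undefined\<close> off their source category,
  so that equality of objects is equality of functors; likewise for the components of the
  natural transformations.\<close>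

record ('f, 'c) nat_trans =
  nsrc :: 'f
  ntgt :: 'f
  ncomp :: 'c

definition functor_cat ::
  "('o, 'm, 'x) cat_scheme \<Rightarrow> ('p, 'q, 'y) cat_scheme \<Rightarrow>
   (('o, 'm, 'p, 'q) ftor, (('o, 'm, 'p, 'q) ftor, 'o \<Rightarrow> 'q) nat_trans) cat" where
  "functor_cat C D =
    (let Fun = {F. is_functor C D F \<and> fobj F \<in> extensional (Obj C) \<and> farr F \<in> extensional (Arr C)}
     in \<lparr>Obj = Fun,
         Arr = {t. nsrc t \<in> Fun \<and> ntgt t \<in> Fun \<and> ncomp t \<in> extensional (Obj C) \<and>
                   is_nat_trans C D (nsrc t) (ntgt t) (ncomp t)},
         Dom = nsrc,
         Cod = ntgt,
         Idt = (\<lambda>F. \<lparr>nsrc = F, ntgt = F, ncomp = (\<lambda>a\<in>Obj C. Idt D (fobj F a))\<rparr>),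
         Comp = (\<lambda>t s. \<lparr>nsrc = nsrc s, ntgt = ntgt t,
                         ncomp = (\<lambda>a\<in>Obj C. ncomp t a \<cdot>\<^bsub>D\<^esub> ncomp s a)\<rparr>)\<rparr>)"

definition full_subcat :: "('o, 'm) cat \<Rightarrow> 'o set \<Rightarrow> ('o, 'm) cat" where
  "full_subcat C U = C\<lparr>Obj := U, Arr := {f \<in> Arr C. Dom C f \<in> U \<and> Cod C f \<in> U}\<rparr>"


section \<open>Categories with cofibrations and Waldhausen categories\<close>

text \<open>The zero object is part of the structure, so that \<open>A\<^sub>j\<^sub>j = 0\<close> below is an equality of objects.\<close>

record ('o, 'm) cof_cat = "('o, 'm) cat" +
  zero :: 'o
  cof :: "'m set"

locale category_with_cofibrations = category C
  for C :: "('o, 'm, 'x) cof_cat_scheme" (structure) +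
  assumes zero: "is_zero_object C (zero C)"
    and cof_arr: "cof C \<subseteq> Arr C"
    and cof_zero: "\<lbrakk>a \<in> Obj C; f \<in> hom C (zero C) a\<rbrakk> \<Longrightarrow> f \<in> cof C"
    and cof_iso: "is_iso C f \<Longrightarrow> f \<in> cof C"
    and cof_comp: "\<lbrakk>f \<in> cof C; g \<in> cof C; Dom C g = Cod C f\<rbrakk> \<Longrightarrow> g \<cdot> f \<in> cof C"
    and cof_pushout_exists:
      "\<lbrakk>f \<in> cof C; g \<in> Arr C; Dom C g = Dom C f\<rbrakk> \<Longrightarrow> \<exists>p q. is_pushout C f g p q"
    and cof_pushout: "\<lbrakk>f \<in> cof C; is_pushout C f g p q\<rbrakk> \<Longrightarrow> q \<in> cof C"

definition cofibration_sequence ::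
  "('o, 'm, 'x) cof_cat_scheme \<Rightarrow> 'm \<Rightarrow> 'm \<Rightarrow> bool" where
  "cofibration_sequence C f g \<longleftrightarrow> f \<in> cof C \<and>
     (\<exists>s \<in> hom C (Dom C f) (zero C). \<exists>t \<in> hom C (zero C) (Cod C g). is_pushout C f s g t)"

record ('o, 'm) wald_cat = "('o, 'm) cof_cat" +
  weq :: "'m set"

text \<open>In the gluing axiom \<open>i\<close>, \<open>f\<close> and \<open>i'\<close>, \<open>f'\<close> are the two spans, \<open>\<alpha>\<close>, \<open>\<beta>\<close>, \<open>\<gamma>\<close> the vertical maps,
  and \<open>u\<close> is the induced map between (arbitrary choices of) the pushouts.\<close>

locale waldhausen_category = category_with_cofibrations C
  for C :: "('o, 'm, 'x) wald_cat_scheme" (structure) +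
  assumes weq_arr: "weq C \<subseteq> Arr C"
    and weq_iso: "is_iso C f \<Longrightarrow> f \<in> weq C"
    and weq_comp: "\<lbrakk>f \<in> weq C; g \<in> weq C; Dom C g = Cod C f\<rbrakk> \<Longrightarrow> g \<cdot> f \<in> weq C"
    and weq_gluing:
      "\<lbrakk>i \<in> cof C; i' \<in> cof C; is_pushout C i f p q; is_pushout C i' f' p' q';
        \<alpha> \<in> weq C; \<beta> \<in> weq C; \<gamma> \<in> weq C;
        \<alpha> \<in> hom C (Dom C i) (Dom C i');
        \<beta> \<in> hom C (Cod C i) (Cod C i');
        \<gamma> \<in> hom C (Cod C f) (Cod C f');
        \<beta> \<cdot> i = i' \<cdot> \<alpha>; \<gamma> \<cdot> f = f' \<cdot> \<alpha>;
        u \<in> hom C (Cod C p) (Cod C p'); u \<cdot> p = p' \<cdot> \<beta>; u \<cdot> q = q' \<cdot> \<gamma>\<rbrakk>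
       \<Longrightarrow> u \<in> weq C"


section \<open>The Waldhausen S-construction\<close>

text \<open>The poset \<open>Ar(I)\<close> as a category: the arrow from \<open>a\<close> to \<open>b\<close> is the pair \<open>(a, b)\<close>.\<close>

definition ar_set :: "'i::linorder set \<Rightarrow> ('i \<times> 'i) set" where
  "ar_set I = {(i, j). i \<in> I \<and> j \<in> I \<and> i \<le> j}"

definition ar_cat :: "'i::linorder set \<Rightarrow> ('i \<times> 'i, ('i \<times> 'i) \<times> ('i \<times> 'i)) cat" where
  "ar_cat I =
     \<lparr>Obj = ar_set I,
      Arr = {(a, b). a \<in> ar_set I \<and> b \<in> ar_set I \<and> fst a \<le> fst b \<and> snd a \<le> snd b},
      Dom = fst,
      Cod = snd,
      Idt = (\<lambda>a. (a, a)),
      Comp = (\<lambda>g f. (fst f, snd g))\<rparr>"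

type_synonym ('i, 'o, 'm) S_obj = "('i \<times> 'i, ('i \<times> 'i) \<times> ('i \<times> 'i), 'o, 'm) ftor"
type_synonym ('i, 'o, 'm) S_arr = "(('i, 'o, 'm) S_obj, 'i \<times> 'i \<Rightarrow> 'm) nat_trans"

definition S_objects ::
  "('o, 'm, 'x) cof_cat_scheme \<Rightarrow> 'i::linorder set \<Rightarrow> ('i, 'o, 'm) S_obj set" where
  "S_objects C I = {A \<in> Obj (functor_cat (ar_cat I) C).
     (\<forall>j \<in> I. fobj A (j, j) = zero C) \<and>
     (\<forall>i \<in> I. \<forall>j \<in> I. \<forall>k \<in> I. i < j \<and> j < k \<longrightarrow>
        cofibration_sequence C (farr A ((i, j), (i, k))) (farr A ((i, k), (j, k))))}"

definition S_cat ::
  "('o, 'm, 'x) cof_cat_scheme \<Rightarrow> 'i::linorder set \<Rightarrow>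
   (('i, 'o, 'm) S_obj, ('i, 'o, 'm) S_arr) cat" where
  "S_cat C I = full_subcat (functor_cat (ar_cat I) C) (S_objects C I)"

definition wS_cat ::
  "('o, 'm, 'x) wald_cat_scheme \<Rightarrow> 'i::linorder set \<Rightarrow>
   (('i, 'o, 'm) S_obj, ('i, 'o, 'm) S_arr) cat" where
  "wS_cat C I = (S_cat C I)
     \<lparr>Arr := {t \<in> Arr (S_cat C I). \<forall>a \<in> ar_set I. ncomp t a \<in> weq C}\<rparr>"

text \<open>\<open>S_map \<phi> J\<close> is the simplicial operator \<open>S\<^sub>I \<rightarrow> S\<^sub>J\<close> (and \<open>wS\<^sub>I \<rightarrow> wS\<^sub>J\<close>) given by precomposition
  with a monotone map \<open>\<phi> : J \<rightarrow> I\<close>; the formula does not depend on \<open>I\<close>.\<close>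

definition S_map_obj ::
  "('j::linorder \<Rightarrow> 'i::linorder) \<Rightarrow> 'j set \<Rightarrow> ('i, 'o, 'm) S_obj \<Rightarrow> ('j, 'o, 'm) S_obj" where
  "S_map_obj \<phi> J A =
     \<lparr>fobj = (\<lambda>a\<in>Obj (ar_cat J). fobj A (map_prod \<phi> \<phi> a)),
      farr = (\<lambda>f\<in>Arr (ar_cat J). farr A (map_prod (map_prod \<phi> \<phi>) (map_prod \<phi> \<phi>) f))\<rparr>"

definition S_map ::
  "('j::linorder \<Rightarrow> 'i::linorder) \<Rightarrow> 'j set \<Rightarrow>
   (('i, 'o, 'm) S_obj, ('i, 'o, 'm) S_arr, ('j, 'o, 'm) S_obj, ('j, 'o, 'm) S_arr) ftor" where
  "S_map \<phi> J =
     \<lparr>fobj = S_map_obj \<phi> J,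
      farr = (\<lambda>t. \<lparr>nsrc = S_map_obj \<phi> J (nsrc t), ntgt = S_map_obj \<phi> J (ntgt t),
                   ncomp = (\<lambda>a\<in>ar_set J. ncomp t (map_prod \<phi> \<phi> a))\<rparr>)\<rparr>"

definition S_restr ::
  "'i::linorder set \<Rightarrow> 'i set \<Rightarrow>
   (('i, 'o, 'm) S_obj, ('i, 'o, 'm) S_arr, ('i, 'o, 'm) S_obj, ('i, 'o, 'm) S_arr) ftor" where
  "S_restr I J = S_map (\<lambda>i. i) J"


section \<open>Homotopy limits of categories\<close>

text \<open>
  Let \<open>P\<close> be a set of sets, ordered by inclusion, \<open>X I\<close> a category for \<open>I \<in> P\<close>, and
  \<open>r I J : X I \<rightarrow> X J\<close> strictly functorial restriction functors for \<open>J \<subseteq> I\<close>.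
  A homotopy limit is defined up to equivalence only; we fix the standard model for the canonical
  model structure on small categories, the pseudo-limit. Its objects are families of objects
  \<open>x I\<close> of \<open>X I\<close> with coherent isomorphisms \<open>\<theta> (I, J) : r I J (x I) \<rightarrow> x J\<close>. It is the strict limit of
  the fibrant replacement of \<open>X\<close> whose value at \<open>I\<close> is the category of such families
  indexed by \<open>{J \<in> P. J \<subseteq> I}\<close>. For a cospan \<open>X\<^sub>T \<rightarrow> X\<^sub>e \<leftarrow> X\<^sub>T\<^sub>'\<close> it is the homotopy fibre product:
  objects \<open>x\<close>, \<open>y\<close>, \<open>z\<close> of \<open>X\<^sub>T\<close>, \<open>X\<^sub>T\<^sub>'\<close>, \<open>X\<^sub>e\<close> with isomorphisms from the images of \<open>x\<close> and \<open>y\<close> to \<open>z\<close>.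
\<close>

definition poset_pairs :: "'i set set \<Rightarrow> ('i set \<times> 'i set) set" where
  "poset_pairs P = {(I, J). I \<in> P \<and> J \<in> P \<and> J \<subseteq> I}"

type_synonym ('i, 'o, 'm) holim_obj = "('i set \<Rightarrow> 'o) \<times> ('i set \<times> 'i set \<Rightarrow> 'm)"

definition holim_objects ::
  "'i set set \<Rightarrow> ('i set \<Rightarrow> ('o, 'm) cat) \<Rightarrow> ('i set \<Rightarrow> 'i set \<Rightarrow> ('o, 'm, 'o, 'm) ftor) \<Rightarrow>
   ('i, 'o, 'm) holim_obj set" where
  "holim_objects P X r = {(x, \<theta>).
     x \<in> (\<Pi>\<^sub>E I\<in>P. Obj (X I)) \<and> \<theta> \<in> extensional (poset_pairs P) \<and>
     (\<forall>(I, J) \<in> poset_pairs P.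
        \<theta> (I, J) \<in> hom (X J) (fobj (r I J) (x I)) (x J) \<and> is_iso (X J) (\<theta> (I, J))) \<and>
     (\<forall>I \<in> P. \<theta> (I, I) = Idt (X I) (x I)) \<and>
     (\<forall>I \<in> P. \<forall>J \<in> P. \<forall>K \<in> P. K \<subseteq> J \<and> J \<subseteq> I \<longrightarrow>
        \<theta> (I, K) = \<theta> (J, K) \<cdot>\<^bsub>X K\<^esub> farr (r J K) (\<theta> (I, J)))}"

definition holim ::
  "'i set set \<Rightarrow> ('i set \<Rightarrow> ('o, 'm) cat) \<Rightarrow> ('i set \<Rightarrow> 'i set \<Rightarrow> ('o, 'm, 'o, 'm) ftor) \<Rightarrow>
   (('i, 'o, 'm) holim_obj, (('i, 'o, 'm) holim_obj, 'i set \<Rightarrow> 'm) nat_trans) cat" where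
  "holim P X r =
     \<lparr>Obj = holim_objects P X r,
      Arr = {t. nsrc t \<in> holim_objects P X r \<and> ntgt t \<in> holim_objects P X r \<and>
                ncomp t \<in> extensional P \<and>
                (\<forall>I \<in> P. ncomp t I \<in> hom (X I) (fst (nsrc t) I) (fst (ntgt t) I)) \<and>
                (\<forall>(I, J) \<in> poset_pairs P.
                   ncomp t J \<cdot>\<^bsub>X J\<^esub> snd (nsrc t) (I, J) =
                   snd (ntgt t) (I, J) \<cdot>\<^bsub>X J\<^esub> farr (r I J) (ncomp t I))},
      Dom = nsrc,
      Cod = ntgt,
      Idt = (\<lambda>x. \<lparr>nsrc = x, ntgt = x, ncomp = (\<lambda>I\<in>P. Idt (X I) (fst x I))\<rparr>),
      Comp = (\<lambda>t s. \<lparr>nsrc = nsrc s, ntgt = ntgt t,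
                      ncomp = (\<lambda>I\<in>P. ncomp t I \<cdot>\<^bsub>X I\<^esub> ncomp s I)\<rparr>)\<rparr>"


section \<open>Triangulations of polygons and 2-Segal maps\<close>

definition polygon_vertex :: "nat \<Rightarrow> nat \<Rightarrow> complex" where
  "polygon_vertex n k = cis (2 * pi * real k / real (n + 1))"

definition polygon_hull :: "nat \<Rightarrow> nat set \<Rightarrow> complex set" where
  "polygon_hull n I = convex hull (polygon_vertex n ` I)"

text \<open>A triangulation is given by the vertex sets of its triangles.
  It can only exist if \<open>n \<ge> 2\<close>, as otherwise there are no triangles to cover \<open>P\<^sub>n\<close>.\<close>

definition polygon_triangulation :: "nat \<Rightarrow> nat set set \<Rightarrow> bool" where
  "polygon_triangulation n \<T> \<longleftrightarrow>
     (\<forall>I \<in> \<T>. I \<subseteq> {0..n} \<and> card I = 3) \<and>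
     triangulation (polygon_hull n ` \<T>) \<and>
     \<Union> (polygon_hull n ` \<T>) = polygon_hull n {0..n}"

definition polygon_edges :: "nat \<Rightarrow> nat set set" where
  "polygon_edges n = {{k, (k + 1) mod (n + 1)} | k. k \<le> n}"

definition diagonals :: "nat \<Rightarrow> nat set set \<Rightarrow> nat set set" where
  "diagonals n \<T> = {e. card e = 2 \<and> (\<exists>I \<in> \<T>. e \<subseteq> I) \<and> e \<notin> polygon_edges n}"

definition triangulation_poset :: "nat \<Rightarrow> nat set set \<Rightarrow> nat set set" where
  "triangulation_poset n \<T> = \<T> \<union> diagonals n \<T>"

definition segal_holim ::
  "nat \<Rightarrow> nat set set \<Rightarrow> (nat set \<Rightarrow> ('o, 'm) cat) \<Rightarrow>
   (nat set \<Rightarrow> nat set \<Rightarrow> ('o, 'm, 'o, 'm) ftor) \<Rightarrow>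
   ((nat, 'o, 'm) holim_obj, ((nat, 'o, 'm) holim_obj, nat set \<Rightarrow> 'm) nat_trans) cat" where
  "segal_holim n \<T> X r = holim (triangulation_poset n \<T>) X r"

text \<open>The map to the homotopy limit induced by the restrictions \<open>X\<^sub>n \<rightarrow> X\<^sub>I\<close>: these are strictly compatible,
  so the coherence isomorphisms are identities.\<close>

definition segal_map_obj ::
  "nat \<Rightarrow> nat set set \<Rightarrow> (nat set \<Rightarrow> ('o, 'm) cat) \<Rightarrow>
   (nat set \<Rightarrow> nat set \<Rightarrow> ('o, 'm, 'o, 'm) ftor) \<Rightarrow> 'o \<Rightarrow> (nat, 'o, 'm) holim_obj" where
  "segal_map_obj n \<T> X r x =
     ((\<lambda>I\<in>triangulation_poset n \<T>. fobj (r {0..n} I) x),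
      (\<lambda>(I, J)\<in>poset_pairs (triangulation_poset n \<T>). Idt (X J) (fobj (r {0..n} J) x)))"

definition segal_map ::
  "nat \<Rightarrow> nat set set \<Rightarrow> (nat set \<Rightarrow> ('o, 'm) cat) \<Rightarrow>
   (nat set \<Rightarrow> nat set \<Rightarrow> ('o, 'm, 'o, 'm) ftor) \<Rightarrow>
   ('o, 'm, (nat, 'o, 'm) holim_obj, ((nat, 'o, 'm) holim_obj, nat set \<Rightarrow> 'm) nat_trans) ftor" where
  "segal_map n \<T> X r =
     \<lparr>fobj = segal_map_obj n \<T> X r,
      farr = (\<lambda>f. \<lparr>nsrc = segal_map_obj n \<T> X r (Dom (X {0..n}) f),
                   ntgt = segal_map_obj n \<T> X r (Cod (X {0..n}) f),
                   ncomp = (\<lambda>I\<in>triangulation_poset n \<T>. farr (r {0..n} I) f)\<rparr>)\<rparr>"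

end

(*
An object A of S_n is determined up to isomorphism by the filtration A(0,1) -> ... -> A(0,n) with
chosen quotients: the maps A(0,j) -> A(i,j) are cokernels, hence epimorphisms, so a natural
transformation in S_I is the same as a map of filtrations, and by the gluing axiom it is a weak
equivalence as soon as it is one on the filtration. If all triangles contain 0, the triangulation is
the fan with triangles {0,j,j+1} and diagonals {0,j}, so that the homotopy limit describes
filtrations one step at a time, glued along isomorphisms. An object of the homotopy limit is thus
rectified by taking as j-th filtration step its value at the smallest member of the poset that
contains j.
*)
theory Submission
  imports Defs
begin

section \<open>Categories and equivalences\<close>

text \<open>Strictness shapes the constructions. An object of the S-construction has the chosen zero
  object on the diagonal as an equality, while the data of the homotopy limit agree on overlaps only
  up to isomorphism. Hence the rectified filtration is transported along the coherence isomorphisms,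
  and its quotients are chosen so that the required equalities hold. The transporting maps stay
  inside \<open>wS_cat\<close> because isomorphisms are weak equivalences. The vertex 0 lies in
  every member of the poset, so a smallest member containing it need not exist; there the value is
  the zero object and all maps are forced. The categories without weak equivalences are the case in
  which all maps are weak equivalences. That the triangulation is the fan is plane geometry: the
  midpoint of a polygon edge is covered only by a triangle containing that edge, and a triangle
  outside the fan would have a side crossing a side of a triangle of the fan.\<close>

context category
begin

lemma hom_arr: "f \<in> hom C a b \<Longrightarrow> f \<in> Arr C"
  by (simp add: hom_def)

lemma hom_dom: "f \<in> hom C a b \<Longrightarrow> Dom C f = a"
  by (simp add: hom_def)

lemma hom_cod: "f \<in> hom C a b \<Longrightarrow> Cod C f = b"
  by (simp add: hom_def)

lemma arr_hom: "f \<in> Arr C \<Longrightarrow> f \<in> hom C (Dom C f) (Cod C f)"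
  by (simp add: hom_def)

lemma hom_obj: "f \<in> hom C a b \<Longrightarrow> a \<in> Obj C" "f \<in> hom C a b \<Longrightarrow> b \<in> Obj C"
  using dom_obj cod_obj by (auto simp: hom_def)

lemma id_left: "f \<in> hom C a b \<Longrightarrow> Idt C b \<cdot> f = f"
  using comp_idt_left by (auto simp: hom_def)

lemma id_right: "f \<in> hom C a b \<Longrightarrow> f \<cdot> Idt C a = f"
  using comp_idt_right by (auto simp: hom_def)

lemma is_isoI:
  "\<lbrakk>f \<in> hom C a b; g \<in> hom C b a; g \<cdot> f = Idt C a; f \<cdot> g = Idt C b\<rbrakk> \<Longrightarrow> is_iso C f"
  by (auto simp: is_iso_def hom_def)

lemma is_isoE:
  assumes "is_iso C f" "f \<in> hom C a b"
  obtains g where "g \<in> hom C b a" "g \<cdot> f = Idt C a" "f \<cdot> g = Idt C b" "is_iso C g"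
  using assms that by (auto simp: is_iso_def hom_def)

lemma is_iso_idt: "a \<in> Obj C \<Longrightarrow> is_iso C (Idt C a)"
  by (rule is_isoI[OF idt_hom idt_hom]) (auto intro: id_left[OF idt_hom])

end

lemma functor_hom:
  "\<lbrakk>is_functor C D F; f \<in> hom C a b\<rbrakk> \<Longrightarrow> farr F f \<in> hom D (fobj F a) (fobj F b)"
  by (auto simp: is_functor_def hom_def)

lemma functor_obj: "\<lbrakk>is_functor C D F; a \<in> Obj C\<rbrakk> \<Longrightarrow> fobj F a \<in> Obj D"
  by (auto simp: is_functor_def)

lemma functor_idt: "\<lbrakk>is_functor C D F; a \<in> Obj C\<rbrakk> \<Longrightarrow> farr F (Idt C a) = Idt D (fobj F a)"
  by (auto simp: is_functor_def)

lemma functor_comp: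
  "\<lbrakk>is_functor C D F; f \<in> hom C a b; g \<in> hom C b c\<rbrakk>
    \<Longrightarrow> farr F (g \<cdot>\<^bsub>C\<^esub> f) = farr F g \<cdot>\<^bsub>D\<^esub> farr F f"
  by (auto simp: is_functor_def hom_def)

text \<open>The quasi-inverse sends d to a chosen object whose image is isomorphic to d, and an
  arrow to the unique preimage of its conjugate by the chosen isomorphisms. Equations in
  \<open>C\<close> are tested after applying \<open>F\<close>, which faithfulness permits. Fullness
  and faithfulness form one unique-existence hypothesis, so that preimages can be taken by
  \<open>THE\<close>.\<close>

theorem equivalenceI:
  assumes "category C" "category D" and F: "is_functor C D F"
    and ff: "\<And>a b g. \<lbrakk>a \<in> Obj C; b \<in> Obj C; g \<in> hom D (fobj F a) (fobj F b)\<rbrakk>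
      \<Longrightarrow> \<exists>!f. f \<in> hom C a b \<and> farr F f = g"
    and ess: "\<And>d. d \<in> Obj D \<Longrightarrow> \<exists>c \<in> Obj C. \<exists>e \<in> hom D (fobj F c) d. is_iso D e"
  shows "is_equivalence C D F"
proof -
  interpret C: category C by fact
  interpret D: category D by fact
  have "\<forall>d\<in>Obj D. \<exists>c e e'. c \<in> Obj C \<and> e \<in> hom D (fobj F c) d \<and> e' \<in> hom D d (fobj F c)
      \<and> e' \<cdot>\<^bsub>D\<^esub> e = Idt D (fobj F c) \<and> e \<cdot>\<^bsub>D\<^esub> e' = Idt D d"
    using ess D.is_isoE by metis
  then obtain G0 e e' where G0: "\<And>d. d \<in> Obj D \<Longrightarrow> G0 d \<in> Obj C"
    and e: "\<And>d. d \<in> Obj D \<Longrightarrow> e d \<in> hom D (fobj F (G0 d)) d"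
    and e': "\<And>d. d \<in> Obj D \<Longrightarrow> e' d \<in> hom D d (fobj F (G0 d))"
    and e'e: "\<And>d. d \<in> Obj D \<Longrightarrow> e' d \<cdot>\<^bsub>D\<^esub> e d = Idt D (fobj F (G0 d))"
    and ee': "\<And>d. d \<in> Obj D \<Longrightarrow> e d \<cdot>\<^bsub>D\<^esub> e' d = Idt D d"
    by metis
  define lift where "lift a b g = (THE f. f \<in> hom C a b \<and> farr F f = g)" for a b g
  have lift: "lift a b g \<in> hom C a b" "farr F (lift a b g) = g"
    if "a \<in> Obj C" "b \<in> Obj C" "g \<in> hom D (fobj F a) (fobj F b)" for a b g
    using theI'[OF ff[OF that]] unfolding lift_def by auto
  have faith: "f = g" if "f \<in> hom C a b" "g \<in> hom C a b" "farr F f = farr F g" for a b f g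
    using ff[OF C.hom_obj[OF that(1)] functor_hom[OF F that(1)]] that by metis
  define G where "G = \<lparr>fobj = G0, farr = (\<lambda>f. lift (G0 (Dom D f)) (G0 (Cod D f))
      (e' (Cod D f) \<cdot>\<^bsub>D\<^esub> (f \<cdot>\<^bsub>D\<^esub> e (Dom D f))))\<rparr>"
  have Gobj: "fobj G d = G0 d" for d by (simp add: G_def)
  have mid: "e' d' \<cdot>\<^bsub>D\<^esub> (f \<cdot>\<^bsub>D\<^esub> e d) \<in> hom D (fobj F (G0 d)) (fobj F (G0 d'))"
    if "f \<in> hom D d d'" for f d d'
    using that e e' D.comp_hom D.hom_obj by metis
  have Garr: "farr G f \<in> hom C (G0 d) (G0 d')"
      "farr F (farr G f) = e' d' \<cdot>\<^bsub>D\<^esub> (f \<cdot>\<^bsub>D\<^esub> e d)" if "f \<in> hom D d d'" for f d d'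
  proof -
    have "farr G f = lift (G0 d) (G0 d') (e' d' \<cdot>\<^bsub>D\<^esub> (f \<cdot>\<^bsub>D\<^esub> e d))"
      using that by (simp add: G_def hom_def)
    then show "farr G f \<in> hom C (G0 d) (G0 d')"
      "farr F (farr G f) = e' d' \<cdot>\<^bsub>D\<^esub> (f \<cdot>\<^bsub>D\<^esub> e d)"
      using lift[OF _ _ mid[OF that]] G0 D.hom_obj[OF that] by auto
  qed
  \<comment> \<open>Naturality of \<open>e\<close>. It serves twice: for the functoriality of
    \<open>G\<close> and as the naturality square of the counit.\<close>
  have eG: "e d' \<cdot>\<^bsub>D\<^esub> farr F (farr G f) = f \<cdot>\<^bsub>D\<^esub> e d" if f: "f \<in> hom D d d'" for f d d'
  proof -
    note d = D.hom_obj[OF f]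
    have "e d' \<cdot>\<^bsub>D\<^esub> farr F (farr G f) = (e d' \<cdot>\<^bsub>D\<^esub> e' d') \<cdot>\<^bsub>D\<^esub> (f \<cdot>\<^bsub>D\<^esub> e d)"
      unfolding Garr(2)[OF f] using D.comp_assoc[OF D.comp_hom[OF e f] e' e] d by simp
    then show ?thesis
      using D.id_left[OF D.comp_hom[OF e f]] ee' d by simp
  qed
  have G: "is_functor D C G"
    unfolding is_functor_def
  proof (intro conjI ballI impI)
    fix d assume d: "d \<in> Obj D"
    then show "fobj G d \<in> Obj C" by (simp add: Gobj G0)
    have "farr F (farr G (Idt D d)) = Idt D (fobj F (G0 d))"
      using Garr(2)[OF D.idt_hom[OF d]] D.id_left[OF e[OF d]] e'e[OF d] by simp
    then show "farr G (Idt D d) = Idt C (fobj G d)"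
      using faith[OF Garr(1)[OF D.idt_hom[OF d]] C.idt_hom[OF G0[OF d]]] functor_idt[OF F G0[OF d]]
      by (simp add: Gobj)
  next
    fix f assume "f \<in> Arr D"
    then show "farr G f \<in> hom C (fobj G (Dom D f)) (fobj G (Cod D f))"
      using Garr(1) D.arr_hom by (simp add: Gobj)
  next
    fix f g assume fg: "f \<in> Arr D" "g \<in> Arr D" "Dom D g = Cod D f"
    then obtain a b c where f: "f \<in> hom D a b" and g: "g \<in> hom D b c"
      using D.arr_hom by metis
    note gf = D.comp_hom[OF f g]
    note o = D.hom_obj[OF f] D.hom_obj[OF g]
    have "farr F (farr G (g \<cdot>\<^bsub>D\<^esub> f)) = farr F (farr G g) \<cdot>\<^bsub>D\<^esub> farr F (farr G f)"
    proof -
      have "farr F (farr G g) \<cdot>\<^bsub>D\<^esub> farr F (farr G f)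
          = (e' c \<cdot>\<^bsub>D\<^esub> (g \<cdot>\<^bsub>D\<^esub> e b)) \<cdot>\<^bsub>D\<^esub> farr F (farr G f)"
        using Garr(2)[OF g] by simp
      also have "\<dots> = e' c \<cdot>\<^bsub>D\<^esub> (g \<cdot>\<^bsub>D\<^esub> (e b \<cdot>\<^bsub>D\<^esub> farr F (farr G f)))"
        using D.comp_assoc[OF functor_hom[OF F Garr(1)[OF f]] e g] 
          D.comp_assoc[OF functor_hom[OF F Garr(1)[OF f]] D.comp_hom[OF e g] e'] o by simp
      also have "\<dots> = e' c \<cdot>\<^bsub>D\<^esub> (g \<cdot>\<^bsub>D\<^esub> f \<cdot>\<^bsub>D\<^esub> e a)"
        using eG[OF f] D.comp_assoc[OF e f g] o by simp
      finally show ?thesis using Garr(2)[OF gf] by simp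
    qed
    then show "farr G (g \<cdot>\<^bsub>D\<^esub> f) = farr G g \<cdot>\<^bsub>C\<^esub> farr G f"
      using faith[OF Garr(1)[OF gf] C.comp_hom[OF Garr(1)[OF f] Garr(1)[OF g]]]
        functor_comp[OF F Garr(1)[OF f] Garr(1)[OF g]] by simp
  qed
  \<comment> \<open>The unit at a is the preimage of \<open>e'\<close> at the image of a; its
    inverse below is the preimage \<open>\<mu>\<close> of \<open>e\<close>. The identities between
    them reduce to those between \<open>e\<close> and \<open>e'\<close>.\<close>
  define \<eta> where "\<eta> a = lift a (G0 (fobj F a)) (e' (fobj F a))" for a
  have \<eta>: "\<eta> a \<in> hom C a (G0 (fobj F a))" "farr F (\<eta> a) = e' (fobj F a)"
    if a: "a \<in> Obj C" for a
    unfolding \<eta>_def using lift[OF a G0 e'] functor_obj[OF F a] by auto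
  have "is_nat_iso C C id_ftor (comp_ftor G F) \<eta>"
    unfolding is_nat_iso_def is_nat_trans_def
  proof (intro conjI ballI)
    fix a assume a: "a \<in> Obj C"
    note Fa = functor_obj[OF F a]
    show "\<eta> a \<in> hom C (fobj id_ftor a) (fobj (comp_ftor G F) a)"
      using \<eta>[OF a] by (simp add: id_ftor_def comp_ftor_def Gobj)
    define \<mu> where "\<mu> = lift (G0 (fobj F a)) a (e (fobj F a))"
    have \<mu>: "\<mu> \<in> hom C (G0 (fobj F a)) a" "farr F \<mu> = e (fobj F a)"
      unfolding \<mu>_def using lift[OF G0 a e] Fa by auto
    show "is_iso C (\<eta> a)"
    proof (rule C.is_isoI)
      show "\<eta> a \<in> hom C a (G0 (fobj F a))" "\<mu> \<in> hom C (G0 (fobj F a)) a"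
        using \<eta> a \<mu> by auto
      show "\<mu> \<cdot>\<^bsub>C\<^esub> \<eta> a = Idt C a"
        using faith[OF C.comp_hom[OF \<eta>(1)[OF a] \<mu>(1)] C.idt_hom[OF a]]
          functor_comp[OF F \<eta>(1)[OF a] \<mu>(1)] functor_idt[OF F a] \<eta>(2)[OF a] \<mu>(2) ee'[OF Fa]
        by simp
      show "\<eta> a \<cdot>\<^bsub>C\<^esub> \<mu> = Idt C (G0 (fobj F a))"
        using faith[OF C.comp_hom[OF \<mu>(1) \<eta>(1)[OF a]] C.idt_hom[OF G0[OF Fa]]]
          functor_comp[OF F \<mu>(1) \<eta>(1)[OF a]] functor_idt[OF F G0[OF Fa]] \<eta>(2)[OF a] \<mu>(2)
          e'e[OF Fa] by simp
    qed
  next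
    fix f assume "f \<in> Arr C"
    then obtain a b where f: "f \<in> hom C a b" using C.arr_hom by blast
    note o = C.hom_obj[OF f]
    note Fo = o[THEN functor_obj[OF F]]
    note Ff = functor_hom[OF F f]
    have "farr F (\<eta> b \<cdot>\<^bsub>C\<^esub> f) = e' (fobj F b) \<cdot>\<^bsub>D\<^esub> farr F f"
      using functor_comp[OF F f \<eta>(1)[OF o(2)]] \<eta>(2)[OF o(2)] by simp
    also have "\<dots> = farr F (farr G (farr F f)) \<cdot>\<^bsub>D\<^esub> e' (fobj F a)"
      using Garr(2)[OF Ff] D.comp_assoc[OF e'[OF Fo(1)] D.comp_hom[OF e[OF Fo(1)] Ff] e'[OF Fo(2)]]
        D.comp_assoc[OF e'[OF Fo(1)] e[OF Fo(1)] Ff] D.id_right[OF Ff] ee'[OF Fo(1)] by simp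
    also have "\<dots> = farr F (farr G (farr F f) \<cdot>\<^bsub>C\<^esub> \<eta> a)"
      using functor_comp[OF F \<eta>(1)[OF o(1)] Garr(1)[OF Ff]] \<eta>(2)[OF o(1)] by simp
    finally have "\<eta> b \<cdot>\<^bsub>C\<^esub> f = farr G (farr F f) \<cdot>\<^bsub>C\<^esub> \<eta> a"
      using faith C.comp_hom[OF f \<eta>(1)[OF o(2)]] C.comp_hom[OF \<eta>(1)[OF o(1)] Garr(1)[OF Ff]]
      by metis
    then show "\<eta> (Cod C f) \<cdot>\<^bsub>C\<^esub> farr id_ftor f = farr (comp_ftor G F) f \<cdot>\<^bsub>C\<^esub> \<eta> (Dom C f)"
      using C.hom_dom[OF f] C.hom_cod[OF f] by (simp add: id_ftor_def comp_ftor_def)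
  qed
  moreover have "is_nat_iso D D (comp_ftor F G) id_ftor e"
    unfolding is_nat_iso_def is_nat_trans_def
  proof (intro conjI ballI)
    fix d assume d: "d \<in> Obj D"
    show "e d \<in> hom D (fobj (comp_ftor F G) d) (fobj id_ftor d)"
      using e[OF d] by (simp add: id_ftor_def comp_ftor_def Gobj)
    show "is_iso D (e d)"
      using D.is_isoI e e' ee' e'e d by metis
  next
    fix f assume "f \<in> Arr D"
    then show "e (Cod D f) \<cdot>\<^bsub>D\<^esub> farr (comp_ftor F G) f = farr id_ftor f \<cdot>\<^bsub>D\<^esub> e (Dom D f)"
      using eG D.arr_hom by (simp add: id_ftor_def comp_ftor_def)
  qed
  ultimately show ?thesis
    unfolding is_equivalence_def using assms(1-3) G by blast
qed


section \<open>Pushouts and cokernels\<close>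

context category
begin

lemma is_pushoutI:
  assumes "f \<in> hom C a b" "g \<in> hom C a c" "p \<in> hom C b d" "q \<in> hom C c d" "p \<cdot> f = q \<cdot> g"
    and "\<And>x u v. \<lbrakk>u \<in> hom C b x; v \<in> hom C c x; u \<cdot> f = v \<cdot> g\<rbrakk>
      \<Longrightarrow> \<exists>!h. h \<in> hom C d x \<and> h \<cdot> p = u \<and> h \<cdot> q = v"
  shows "is_pushout C f g p q"
proof -
  have "f \<in> Arr C" "g \<in> Arr C" "p \<in> Arr C" "q \<in> Arr C" "Dom C f = a" "Dom C g = a"
    "Cod C f = b" "Cod C g = c" "Dom C p = b" "Dom C q = c" "Cod C p = d" "Cod C q = d"
    using assms(1-4) by (auto simp: hom_def)
  then show ?thesis
    unfolding is_pushout_def using assms(5,6) by simp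
qed

lemma is_pushout_homs:
  assumes "is_pushout C f g p q"
  shows "f \<in> hom C (Dom C f) (Cod C f)" "g \<in> hom C (Dom C f) (Cod C g)"
    "p \<in> hom C (Cod C f) (Cod C p)" "q \<in> hom C (Cod C g) (Cod C p)" "p \<cdot> f = q \<cdot> g"
  using assms unfolding is_pushout_def by (auto simp: hom_def)

lemma is_pushout_factor:
  assumes "is_pushout C f g p q" "u \<in> hom C (Cod C f) x" "v \<in> hom C (Cod C g) x" "u \<cdot> f = v \<cdot> g"
  shows "\<exists>!h. h \<in> hom C (Cod C p) x \<and> h \<cdot> p = u \<and> h \<cdot> q = v"
  using assms hom_obj(2)[OF assms(2)] unfolding is_pushout_def by blast

lemma is_pushout_sym:
  assumes "is_pushout C f g p q"
  shows "is_pushout C g f q p"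
  using assms unfolding is_pushout_def by (auto simp: conj_commute) metis+

text \<open>The cancellation half of the pasting law: the first square and the outer rectangle are
  pushouts, hence so is the second square. With the zero object at corners it computes quotients of
  quotients.\<close>

lemma is_pushout_cancel:
  assumes P: "is_pushout C f g p q" and P': "is_pushout C f (g' \<cdot> g) (p' \<cdot> p) q'"
    and g': "g' \<in> hom C (Cod C g) c'" and p': "p' \<in> hom C (Cod C p) d'"
    and q': "q' \<in> hom C c' d'" and comm: "p' \<cdot> q = q' \<cdot> g'"
  shows "is_pushout C q g' p' q'"
proof (rule is_pushoutI)
  note h = is_pushout_homs[OF P]
  show "q \<in> hom C (Cod C g) (Cod C p)" "g' \<in> hom C (Cod C g) c'"
    "p' \<in> hom C (Cod C p) d'" "q' \<in> hom C c' d'" "p' \<cdot> q = q' \<cdot> g'"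
    using h assms by auto
  fix x u v assume u: "u \<in> hom C (Cod C p) x" and v: "v \<in> hom C c' x" and uv: "u \<cdot> q = v \<cdot> g'"
  have cods: "Cod C (g' \<cdot> g) = c'" "Cod C (p' \<cdot> p) = d'"
    using hom_cod[OF comp_hom[OF h(2) g']] hom_cod[OF comp_hom[OF h(3) p']] by auto
  have "(u \<cdot> p) \<cdot> f = v \<cdot> (g' \<cdot> g)"
    using comp_assoc[OF h(1,3) u] comp_assoc[OF h(2,4) u] comp_assoc[OF h(2) g' v] h(5) uv by simp
  then have ex: "\<exists>!k. k \<in> hom C d' x \<and> k \<cdot> (p' \<cdot> p) = u \<cdot> p \<and> k \<cdot> q' = v"
    using is_pushout_factor[OF P' comp_hom[OF h(3) u]] v cods by simp
  \<comment> \<open>A map out of the first pushout is determined by its composites with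
    \<open>p\<close> and \<open>q\<close>, so the factorisation through the rectangle already
    restricts to \<open>u\<close>.\<close>
  have "k \<cdot> p' = u" if k: "k \<in> hom C d' x" "k \<cdot> (p' \<cdot> p) = u \<cdot> p" "k \<cdot> q' = v" for k
  proof -
    have "(k \<cdot> p') \<cdot> p = u \<cdot> p"
      using comp_assoc[OF h(3) p' k(1)] k(2) by simp
    moreover have "(k \<cdot> p') \<cdot> q = u \<cdot> q"
      using comp_assoc[OF h(4) p' k(1)] comp_assoc[OF g' q' k(1)] k(3) comm uv by simp
    moreover have "(u \<cdot> p) \<cdot> f = (u \<cdot> q) \<cdot> g"
      using comp_assoc[OF h(1,3) u] comp_assoc[OF h(2,4) u] h(5) by simp
    ultimately show ?thesis
      using is_pushout_factor[OF P comp_hom[OF h(3) u] comp_hom[OF h(4) u]]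
        comp_hom[OF p' k(1)] u by blast
  qed
  moreover have "k \<cdot> (p' \<cdot> p) = u \<cdot> p" if "k \<in> hom C d' x" "k \<cdot> p' = u" for k
    using comp_assoc[OF h(3) p' that(1)] that(2) by simp
  ultimately show "\<exists>!k. k \<in> hom C d' x \<and> k \<cdot> p' = u \<and> k \<cdot> q' = v"
    using ex by blast
qed

end

section \<open>Zero maps and cokernels\<close>

context category_with_cofibrations
begin

definition to_zero :: "'o \<Rightarrow> 'm" where
  "to_zero a = (THE f. f \<in> hom C a (zero C))"

definition from_zero :: "'o \<Rightarrow> 'm" where
  "from_zero a = (THE f. f \<in> hom C (zero C) a)"

lemma zero_obj: "zero C \<in> Obj C"
  using zero by (simp add: is_zero_object_def)

lemma to_zero: "a \<in> Obj C \<Longrightarrow> to_zero a \<in> hom C a (zero C)"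
  unfolding to_zero_def by (rule theI') (use zero in \<open>auto simp: is_zero_object_def\<close>)

lemma from_zero: "a \<in> Obj C \<Longrightarrow> from_zero a \<in> hom C (zero C) a"
  unfolding from_zero_def by (rule theI') (use zero in \<open>auto simp: is_zero_object_def\<close>)

lemma to_zero_unique: "\<lbrakk>f \<in> hom C a (zero C); g \<in> hom C a (zero C)\<rbrakk> \<Longrightarrow> f = g"
  using zero hom_obj(1)[of f a] unfolding is_zero_object_def by metis

lemma from_zero_unique: "\<lbrakk>f \<in> hom C (zero C) a; g \<in> hom C (zero C) a\<rbrakk> \<Longrightarrow> f = g"
  using zero hom_obj(2)[of f _ a] unfolding is_zero_object_def by metis

text \<open>Fixing the two legs through zero leaves a relation between two maps alone, without the
  existential of \<open>cofibration_sequence\<close>, which is still a pushout to which pasting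
  applies.\<close>

definition is_cokernel :: "'m \<Rightarrow> 'm \<Rightarrow> bool" where
  "is_cokernel f g \<longleftrightarrow> is_pushout C f (to_zero (Dom C f)) g (from_zero (Cod C g))"

lemma is_cokernel_homs:
  assumes "is_cokernel f g"
  shows "f \<in> hom C (Dom C f) (Cod C f)" "g \<in> hom C (Cod C f) (Cod C g)"
  using assms is_pushout_homs unfolding is_cokernel_def by metis+

text \<open>Maps to and from zero are unique, so any witnesses of the sequence are the canonical
  legs.\<close>

lemma cofibration_sequence_iff:
  "cofibration_sequence C f g \<longleftrightarrow> f \<in> cof C \<and> is_cokernel f g"
proof
  assume "cofibration_sequence C f g"
  then obtain s t where st: "f \<in> cof C" "s \<in> hom C (Dom C f) (zero C)" "t \<in> hom C (zero C) (Cod C g)"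
    "is_pushout C f s g t" unfolding cofibration_sequence_def by blast
  then have "s = to_zero (Dom C f)" "t = from_zero (Cod C g)"
    using to_zero_unique[OF st(2) to_zero] from_zero_unique[OF st(3) from_zero] hom_obj by auto
  then show "f \<in> cof C \<and> is_cokernel f g" using st by (simp add: is_cokernel_def)
next
  assume *: "f \<in> cof C \<and> is_cokernel f g"
  then have "Dom C f \<in> Obj C" "Cod C g \<in> Obj C"
    using is_cokernel_homs hom_obj by blast+
  with * show "cofibration_sequence C f g"
    unfolding cofibration_sequence_def is_cokernel_def using to_zero from_zero by blast
qed

text \<open>A map vanishes if it factors through the zero object; the factorisation is left arbitrary.\<close>

lemma is_cokernel_factor:
  assumes fg: "is_cokernel f g" and f: "f \<in> hom C a b" and g: "g \<in> hom C b d"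
    and u: "u \<in> hom C b x" and "s \<in> hom C a (zero C)" "t \<in> hom C (zero C) x" "u \<cdot> f = t \<cdot> s"
  shows "\<exists>!h. h \<in> hom C d x \<and> h \<cdot> g = u"
proof -
  note ao = hom_obj(1)[OF f] and d = hom_obj(2)[OF g] and x = hom_obj(2)[OF u]
  have "u \<cdot> f = from_zero x \<cdot> to_zero a"
    using assms to_zero_unique[OF to_zero[OF ao] assms(5)] 
      from_zero_unique[OF from_zero[OF x] assms(6)] by simp
  moreover have "Dom C f = a" "Cod C f = b" "Cod C g = d" "Cod C (to_zero a) = zero C"
    using f g to_zero[OF ao] by (auto simp: hom_def)
  ultimately have "\<exists>!h. h \<in> hom C d x \<and> h \<cdot> g = u \<and> h \<cdot> from_zero d = from_zero x"
    using is_pushout_factor[OF fg[unfolded is_cokernel_def]] u from_zero[OF x] by simp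
  moreover have "h \<cdot> from_zero d = from_zero x" if "h \<in> hom C d x" for h
    using from_zero_unique comp_hom from_zero d x that by metis
  ultimately show ?thesis by blast
qed

text \<open>Both maps factor the same map through the cokernel. That map vanishes on
  \<open>f\<close>, as \<open>f\<close> followed by \<open>g\<close> passes through zero, so the
  uniqueness clause of the universal property applies.\<close>

lemma is_cokernel_epi:
  assumes fg: "is_cokernel f g" and g: "g \<in> hom C b d"
    and h: "h \<in> hom C d x" "h' \<in> hom C d x" "h \<cdot> g = h' \<cdot> g"
  shows "h = h'"
proof -
  have f: "f \<in> hom C (Dom C f) b" using is_cokernel_homs[OF fg] g by (auto simp: hom_def)
  note ao = hom_obj(1)[OF f] and d = hom_obj(2)[OF g]
  have "(h \<cdot> g) \<cdot> f = (h \<cdot> from_zero d) \<cdot> to_zero (Dom C f)"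
    using is_pushout_homs(5)[OF fg[unfolded is_cokernel_def]] comp_assoc[OF f g h(1)]
      comp_assoc[OF to_zero[OF ao] from_zero[OF d] h(1)] hom_cod[OF g] by simp
  from is_cokernel_factor[OF fg f g comp_hom[OF g h(1)] to_zero[OF ao]
      comp_hom[OF from_zero[OF d] h(1)] this]
  show ?thesis using h by metis
qed

text \<open>The degenerate sequence 0 -> b = b. With its counterpart a = a -> 0 it extends the
  cofibration sequences of an object to weak inequalities between the indices, and it makes an
  identity available as quotient map by the zeroth filtration step.\<close>

lemma is_cokernel_from_zero:
  assumes f: "f \<in> hom C (zero C) b"
  shows "is_cokernel f (Idt C b)"
proof -
  note b = hom_obj(2)[OF f]
  have "is_pushout C f (Idt C (zero C)) (Idt C b) f"
  proof (rule is_pushoutI[OF f idt_hom idt_hom f])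
    show "Idt C b \<cdot> f = f \<cdot> Idt C (zero C)" using id_left[OF f] id_right[OF f] by simp
    fix x u v assume u: "u \<in> hom C b x" and v: "v \<in> hom C (zero C) x" "u \<cdot> f = v \<cdot> Idt C (zero C)"
    then have "u \<cdot> f = v" using id_right by auto
    then show "\<exists>!h. h \<in> hom C b x \<and> h \<cdot> Idt C b = u \<and> h \<cdot> f = v"
      using u id_right by metis
  qed (use b zero_obj in auto)
  moreover have "to_zero (Dom C f) = Idt C (zero C)" "from_zero (Cod C (Idt C b)) = f"
    using to_zero_unique[OF to_zero idt_hom] from_zero_unique[OF from_zero f] zero_obj
      hom_dom[OF f] hom_cod[OF idt_hom[OF b]] b by auto
  ultimately show ?thesis by (simp add: is_cokernel_def)
qed

lemma is_cokernel_to_zero: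
  assumes g: "g \<in> hom C a (zero C)"
  shows "is_cokernel (Idt C a) g"
proof -
  note a = hom_obj(1)[OF g]
  have "is_pushout C (Idt C a) g g (Idt C (zero C))"
  proof (rule is_pushoutI[OF idt_hom g g idt_hom])
    show "g \<cdot> Idt C a = Idt C (zero C) \<cdot> g" using id_left[OF g] id_right[OF g] by simp
    fix x u v assume u: "u \<in> hom C a x" and v: "v \<in> hom C (zero C) x" "u \<cdot> Idt C a = v \<cdot> g"
    then have "v \<cdot> g = u" using id_right by auto
    then show "\<exists>!h. h \<in> hom C (zero C) x \<and> h \<cdot> g = u \<and> h \<cdot> Idt C (zero C) = v"
      using v(1) id_right by metis
  qed (use a zero_obj in auto)
  moreover have "to_zero (Dom C (Idt C a)) = g" "from_zero (Cod C g) = Idt C (zero C)"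
    using to_zero_unique[OF to_zero g] from_zero_unique[OF from_zero idt_hom] zero_obj
      hom_cod[OF g] hom_dom[OF idt_hom[OF a]] a by auto
  ultimately show ?thesis by (simp add: is_cokernel_def)
qed

lemma cokernel_exists:
  assumes "f \<in> cof C"
  shows "\<exists>g. is_cokernel f g"
proof -
  have f: "f \<in> hom C (Dom C f) (Cod C f)" using assms cof_arr arr_hom by blast
  note s = to_zero[OF hom_obj(1)[OF f]]
  obtain g t where "is_pushout C f (to_zero (Dom C f)) g t"
    using cof_pushout_exists[OF assms hom_arr[OF s]] hom_dom[OF s] by blast
  moreover from this have "t = from_zero (Cod C g)"
    using is_pushout_homs[of f "to_zero (Dom C f)" g t] hom_cod[OF s] from_zero_unique from_zero
      hom_obj by metis
  ultimately show ?thesis by (auto simp: is_cokernel_def)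
qed

text \<open>The third isomorphism theorem for a filtration \<open>a \<rightarrow> b \<rightarrow> e\<close> with quotients \<open>p : b \<rightarrow> b/a\<close>,
  \<open>q : e \<rightarrow> e/a\<close> and \<open>r : e \<rightarrow> e/b\<close>.\<close>

lemma is_cokernel_quotients:
  assumes f: "f \<in> hom C a b" and g: "g \<in> hom C b e" and gc: "g \<in> cof C"
    and p: "is_cokernel f p" "p \<in> hom C b b'" and q: "is_cokernel (g \<cdot> f) q" "q \<in> hom C e e'"
    and r: "is_cokernel g r" "r \<in> hom C e d"
    and h: "h \<in> hom C b' e'" "h \<cdot> p = q \<cdot> g" and k: "k \<in> hom C e' d" "k \<cdot> q = r"
  shows "cofibration_sequence C h k"
proof -
  note o = hom_obj[OF f] hom_obj[OF g] hom_obj(2)[OF p(2)] hom_obj(2)[OF q(2)] hom_obj(2)[OF k(1)]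
  have "is_pushout C f (to_zero a) p (from_zero b')"
    using p(1) f p(2) by (simp add: is_cokernel_def hom_def)
  note P1 = is_pushout_sym[OF this]
  have "h \<cdot> from_zero b' = from_zero e'"
    using from_zero_unique comp_hom from_zero h(1) o by metis
  then have "is_pushout C (g \<cdot> f) (to_zero a) q (h \<cdot> from_zero b')"
    using q(1) hom_cod[OF q(2)] hom_dom[OF comp_hom[OF f g]] by (simp add: is_cokernel_def)
  note P2 = is_pushout_sym[OF this]
  \<comment> \<open>Cancelling the cokernel square of \<open>f\<close> from that of the composite
    exhibits e/a as the pushout of b/a and e over b; hence \<open>h\<close> is a cofibration, being
    a pushout of \<open>g\<close>.\<close>
  have "is_pushout C p g h q"
    using is_pushout_cancel[OF P1 P2 _ _ q(2) h(2)] f g h(1) hom_cod[OF from_zero[OF o(5)]]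
    by (auto simp: hom_def)
  note P3 = is_pushout_sym[OF this]
  have hc: "h \<in> cof C" using cof_pushout[OF gc P3] .
  have "to_zero b' \<cdot> p = to_zero b"
    using to_zero_unique comp_hom to_zero p(2) o by metis
  then have P4: "is_pushout C g (to_zero b' \<cdot> p) (k \<cdot> q) (from_zero d)"
    using r hom_cod[OF r(2)] hom_dom[OF g] k(2) by (simp add: is_cokernel_def)
  \<comment> \<open>The composite b/a -> e/a -> e/b is zero: it suffices to see this after the
    epimorphism \<open>p\<close>, where it becomes \<open>g\<close> followed by
    \<open>r\<close>.\<close>
  have P5: "k \<cdot> h = from_zero d \<cdot> to_zero b'"
  proof (rule is_cokernel_epi[OF p(1,2)])
    show "k \<cdot> h \<in> hom C b' d" "from_zero d \<cdot> to_zero b' \<in> hom C b' d"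
      using comp_hom h k to_zero from_zero o by blast+
    have "k \<cdot> h \<cdot> p = r \<cdot> g"
      using comp_assoc[OF p(2) h(1) k(1)] comp_assoc[OF g q(2) k(1)] h k by simp
    also have "\<dots> = from_zero d \<cdot> to_zero b"
      using is_pushout_homs(5)[OF r(1)[unfolded is_cokernel_def]] hom_cod[OF r(2)] hom_dom[OF g]
      by simp
    also have "\<dots> = from_zero d \<cdot> to_zero b' \<cdot> p"
      using comp_assoc[OF p(2) to_zero from_zero] o \<open>to_zero b' \<cdot> p = to_zero b\<close> by simp
    finally show "k \<cdot> h \<cdot> p = from_zero d \<cdot> to_zero b' \<cdot> p" .
  qed
  \<comment> \<open>The second cancellation: the pushout square over \<open>g\<close> and
    \<open>p\<close>, followed by the square to be shown, is the cokernel square of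
    \<open>g\<close>.\<close>
  have "is_pushout C h (to_zero b') k (from_zero d)"
    by (rule is_pushout_cancel[OF P3 P4 _ _ from_zero P5])
       (use to_zero o k hom_cod[OF p(2)] hom_cod[OF q(2)] in auto)
  then show ?thesis
    using hc h(1) k(1) by (simp add: cofibration_sequence_iff is_cokernel_def hom_def)
qed

end


section \<open>Maps of filtered objects\<close>

declare split_paired_All [simp del]

lemma ar_set_iff [simp]: "(i, j) \<in> ar_set I \<longleftrightarrow> i \<in> I \<and> j \<in> I \<and> i \<le> j"
  by (simp add: ar_set_def)

lemma ar_arr_iff [simp]:
  "((i, j), (k, l)) \<in> Arr (ar_cat I) \<longleftrightarrow>
    i \<in> I \<and> j \<in> I \<and> k \<in> I \<and> l \<in> I \<and> i \<le> j \<and> k \<le> l \<and> i \<le> k \<and> j \<le> l"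
  by (auto simp: ar_cat_def)

lemma ar_cat_simps [simp]:
  "Obj (ar_cat I) = ar_set I" "Dom (ar_cat I) = fst" "Cod (ar_cat I) = snd"
  "Idt (ar_cat I) a = (a, a)" "g \<cdot>\<^bsub>ar_cat I\<^esub> f = (fst f, snd g)"
  by (simp_all add: ar_cat_def)

lemma ar_arr_refl: "a \<in> ar_set I \<Longrightarrow> (a, a) \<in> Arr (ar_cat I)"
  by (simp add: ar_cat_def)

lemma ar_arr_trans:
  "\<lbrakk>(a, b) \<in> Arr (ar_cat I); (b, c) \<in> Arr (ar_cat I)\<rbrakk> \<Longrightarrow> (a, c) \<in> Arr (ar_cat I)"
  by (auto simp: ar_cat_def)

lemma ar_arr_obj:
  "(a, b) \<in> Arr (ar_cat I) \<Longrightarrow> a \<in> ar_set I" "(a, b) \<in> Arr (ar_cat I) \<Longrightarrow> b \<in> ar_set I"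
  by (auto simp: ar_cat_def)

lemma ar_set_mono: "J \<subseteq> I \<Longrightarrow> a \<in> ar_set J \<Longrightarrow> a \<in> ar_set I"
  by (auto simp: ar_set_def)

lemma ar_arr_mono: "J \<subseteq> I \<Longrightarrow> f \<in> Arr (ar_cat J) \<Longrightarrow> f \<in> Arr (ar_cat I)"
  by (auto simp: ar_cat_def ar_set_def)

text \<open>An arrow of Ar(I) is the pair of its ends, so the functor laws can be stated for ends a,
  b, c. These stay unsplit elements of \<open>ar_set I\<close>, lest general facts about arrows turn
  into statements about four indices.\<close>

lemma S_objects_iff:
  "A \<in> S_objects C I \<longleftrightarrow>
     fobj A \<in> extensional (ar_set I) \<and> farr A \<in> extensional (Arr (ar_cat I)) \<and>
     (\<forall>a\<in>ar_set I. fobj A a \<in> Obj C) \<and>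
     (\<forall>a b. (a, b) \<in> Arr (ar_cat I) \<longrightarrow> farr A (a, b) \<in> hom C (fobj A a) (fobj A b)) \<and>
     (\<forall>a\<in>ar_set I. farr A (a, a) = Idt C (fobj A a)) \<and>
     (\<forall>a b c. (a, b) \<in> Arr (ar_cat I) \<longrightarrow> (b, c) \<in> Arr (ar_cat I) \<longrightarrow>
        farr A (a, c) = farr A (b, c) \<cdot>\<^bsub>C\<^esub> farr A (a, b)) \<and>
     (\<forall>j\<in>I. fobj A (j, j) = zero C) \<and>
     (\<forall>i\<in>I. \<forall>j\<in>I. \<forall>k\<in>I. i < j \<and> j < k \<longrightarrow>
        cofibration_sequence C (farr A ((i, j), (i, k))) (farr A ((i, k), (j, k))))"
proof -
  have "is_functor (ar_cat I) C A \<longleftrightarrow>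
     (\<forall>a\<in>ar_set I. fobj A a \<in> Obj C) \<and>
     (\<forall>a b. (a, b) \<in> Arr (ar_cat I) \<longrightarrow> farr A (a, b) \<in> hom C (fobj A a) (fobj A b)) \<and>
     (\<forall>a\<in>ar_set I. farr A (a, a) = Idt C (fobj A a)) \<and>
     (\<forall>a b c. (a, b) \<in> Arr (ar_cat I) \<longrightarrow> (b, c) \<in> Arr (ar_cat I) \<longrightarrow>
        farr A (a, c) = farr A (b, c) \<cdot>\<^bsub>C\<^esub> farr A (a, b))" (is "_ \<longleftrightarrow> ?R")
  proof
    assume F: "is_functor (ar_cat I) C A"
    show ?R
    proof (intro conjI ballI allI impI)
      fix a b c assume ab: "(a, b) \<in> Arr (ar_cat I)"
      then show "farr A (a, b) \<in> hom C (fobj A a) (fobj A b)"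
        using functor_hom[OF F, of "(a, b)" a b] by (simp add: hom_def)
      assume "(b, c) \<in> Arr (ar_cat I)"
      then show "farr A (a, c) = farr A (b, c) \<cdot>\<^bsub>C\<^esub> farr A (a, b)"
        using functor_comp[OF F, of "(a, b)" a b "(b, c)" c] ab by (simp add: hom_def)
    next
      fix a assume "a \<in> ar_set I"
      then show "fobj A a \<in> Obj C" "farr A (a, a) = Idt C (fobj A a)"
        using functor_obj[OF F, of a] functor_idt[OF F, of a] by simp_all
    qed
  next
    assume R: ?R
    show "is_functor (ar_cat I) C A"
      unfolding is_functor_def
    proof (intro conjI ballI impI)
      fix a assume "a \<in> Obj (ar_cat I)"
      then show "fobj A a \<in> Obj C" "farr A (Idt (ar_cat I) a) = Idt C (fobj A a)"
        using R by auto
    next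
      fix f assume "f \<in> Arr (ar_cat I)"
      then show "farr A f \<in> hom C (fobj A (Dom (ar_cat I) f)) (fobj A (Cod (ar_cat I) f))"
        using R by (metis ar_cat_simps(2,3) prod.collapse)
    next
      fix f g assume "f \<in> Arr (ar_cat I)" "g \<in> Arr (ar_cat I)" "Dom (ar_cat I) g = Cod (ar_cat I) f"
      moreover from this have "f = (fst f, snd f)" "g = (snd f, snd g)"
        by (simp_all add: prod_eq_iff)
      ultimately have "(fst f, snd f) \<in> Arr (ar_cat I)" "(snd f, snd g) \<in> Arr (ar_cat I)"
        "f = (fst f, snd f)" "g = (snd f, snd g)"
        by metis+
      then show "farr A (g \<cdot>\<^bsub>ar_cat I\<^esub> f) = farr A g \<cdot>\<^bsub>C\<^esub> farr A f"
        using R by (metis ar_cat_simps(5))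
    qed
  qed
  then show ?thesis
    unfolding S_objects_def functor_cat_def Let_def by auto
qed

lemma wS_cat_simps [simp]:
  "Obj (wS_cat C I) = S_objects C I" "Dom (wS_cat C I) = nsrc" "Cod (wS_cat C I) = ntgt"
  "Idt (wS_cat C I) A = \<lparr>nsrc = A, ntgt = A, ncomp = (\<lambda>a\<in>ar_set I. Idt C (fobj A a))\<rparr>"
  "t \<cdot>\<^bsub>wS_cat C I\<^esub> s = \<lparr>nsrc = nsrc s, ntgt = ntgt t,
      ncomp = (\<lambda>a\<in>ar_set I. ncomp t a \<cdot>\<^bsub>C\<^esub> ncomp s a)\<rparr>"
  by (simp_all add: wS_cat_def S_cat_def full_subcat_def functor_cat_def Let_def)

lemma wS_hom_iff:
  "t \<in> hom (wS_cat C I) A B \<longleftrightarrow>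
     A \<in> S_objects C I \<and> B \<in> S_objects C I \<and> nsrc t = A \<and> ntgt t = B \<and>
     ncomp t \<in> extensional (ar_set I) \<and>
     (\<forall>a\<in>ar_set I. ncomp t a \<in> hom C (fobj A a) (fobj B a) \<and> ncomp t a \<in> weq C) \<and>
     (\<forall>a b. (a, b) \<in> Arr (ar_cat I) \<longrightarrow>
        ncomp t b \<cdot>\<^bsub>C\<^esub> farr A (a, b) = farr B (a, b) \<cdot>\<^bsub>C\<^esub> ncomp t a)"
proof -
  have "(\<forall>f\<in>Arr (ar_cat I). ncomp t (snd f) \<cdot>\<^bsub>C\<^esub> farr A f = farr B f \<cdot>\<^bsub>C\<^esub> ncomp t (fst f)) \<longleftrightarrow>
     (\<forall>a b. (a, b) \<in> Arr (ar_cat I) \<longrightarrow>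
        ncomp t b \<cdot>\<^bsub>C\<^esub> farr A (a, b) = farr B (a, b) \<cdot>\<^bsub>C\<^esub> ncomp t a)"
    by (metis prod.collapse fst_conv snd_conv)
  then show ?thesis
    by (auto simp: hom_def wS_cat_def S_cat_def full_subcat_def functor_cat_def Let_def
        is_nat_trans_def S_objects_def simp del: ar_arr_iff)
qed

lemma wS_homD:
  assumes "t \<in> hom (wS_cat C I) A B"
  shows "A \<in> S_objects C I" "B \<in> S_objects C I" "nsrc t = A" "ntgt t = B"
    "ncomp t \<in> extensional (ar_set I)"
    "a \<in> ar_set I \<Longrightarrow> ncomp t a \<in> hom C (fobj A a) (fobj B a)"
    "a \<in> ar_set I \<Longrightarrow> ncomp t a \<in> weq C"
    "(a, b) \<in> Arr (ar_cat I) \<Longrightarrow> ncomp t b \<cdot>\<^bsub>C\<^esub> farr A (a, b) = farr B (a, b) \<cdot>\<^bsub>C\<^esub> ncomp t a"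
  using assms unfolding wS_hom_iff by (blast)+

lemma wS_hom_eqI:
  assumes "s \<in> hom (wS_cat C I) A B" "t \<in> hom (wS_cat C I) A B"
    and "\<And>a. a \<in> ar_set I \<Longrightarrow> ncomp s a = ncomp t a"
  shows "s = t"
proof -
  have "ncomp s = ncomp t"
    using assms by (intro extensionalityI[where A = "ar_set I"]) (auto simp: wS_hom_iff)
  then show ?thesis
    using assms by (intro nat_trans.equality) (auto simp: wS_hom_iff)
qed

section \<open>Objects of the S-construction\<close>

context category_with_cofibrations
begin

context
  fixes A :: "('i::linorder, 'o, 'm) S_obj" and I
  assumes A: "A \<in> S_objects C I"
begin

lemma S_obj: "a \<in> ar_set I \<Longrightarrow> fobj A a \<in> Obj C"
  using A by (simp add: S_objects_iff)

lemma S_hom: "(a, b) \<in> Arr (ar_cat I) \<Longrightarrow> farr A (a, b) \<in> hom C (fobj A a) (fobj A b)"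
  using A by (simp add: S_objects_iff)

lemma S_idt: "a \<in> ar_set I \<Longrightarrow> farr A (a, a) = Idt C (fobj A a)"
  using A by (simp add: S_objects_iff)

lemma S_comp:
  "\<lbrakk>(a, b) \<in> Arr (ar_cat I); (b, c) \<in> Arr (ar_cat I)\<rbrakk>
    \<Longrightarrow> farr A (b, c) \<cdot> farr A (a, b) = farr A (a, c)"
  using A by (simp add: S_objects_iff)

lemma S_zero: "j \<in> I \<Longrightarrow> fobj A (j, j) = zero C"
  using A by (simp add: S_objects_iff)

text \<open>Allowing z = i and i = j matters: the row at a least index z then controls every pair
  (i, j) without case distinctions. The degenerate cases are the sequences 0 -> B = B and B = B ->
  0.\<close>

lemma S_cofibration_sequence:
  assumes "z \<in> I" "i \<in> I" "j \<in> I" "z \<le> i" "i \<le> j"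
  shows "cofibration_sequence C (farr A ((z, i), (z, j))) (farr A ((z, j), (i, j)))"
proof -
  consider "z < i" "i < j" | "z = i" | "i = j" using assms by fastforce
  then show ?thesis
  proof cases
    case 1
    then show ?thesis using A assms by (simp add: S_objects_iff)
  next
    case 2
    then have "farr A ((z, i), (z, j)) \<in> hom C (zero C) (fobj A (z, j))"
      using S_hom[of "(z, i)" "(z, j)"] S_zero assms by simp
    moreover have "farr A ((z, j), (i, j)) = Idt C (fobj A (z, j))"
      using 2 S_idt assms by simp
    ultimately show ?thesis
      using is_cokernel_from_zero cof_zero hom_obj(2) by (auto simp: cofibration_sequence_iff)
  next
    case 3
    then have "farr A ((z, j), (i, j)) \<in> hom C (fobj A (z, j)) (zero C)"
      using S_hom[of "(z, j)" "(i, j)"] S_zero assms by simp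
    moreover have "farr A ((z, i), (z, j)) = Idt C (fobj A (z, j))"
      using 3 S_idt assms by simp
    ultimately show ?thesis
      using is_cokernel_to_zero cof_iso is_iso_idt hom_obj(1)
      by (auto simp: cofibration_sequence_iff)
  qed
qed

end

end

section \<open>The categories wS_I and maps of filtrations\<close>

context waldhausen_category
begin

lemma category_wS: "category (wS_cat C I)"
proof
  let ?W = "wS_cat C I"
  show "Dom ?W f \<in> Obj ?W" "Cod ?W f \<in> Obj ?W" if "f \<in> Arr ?W" for f
    using that wS_hom_iff[of f C I "nsrc f" "ntgt f"] by (auto simp: hom_def)
  show idt: "Idt ?W a \<in> hom ?W a a" if "a \<in> Obj ?W" for a
  proof -
    have a: "a \<in> S_objects C I" using that by simp
    show ?thesis
      using a S_obj[OF a] idt_hom weq_iso is_iso_idt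
      by (auto simp: wS_hom_iff ar_arr_obj id_left[OF S_hom[OF a]] id_right[OF S_hom[OF a]])
  qed
  show cmp: "g \<cdot>\<^bsub>?W\<^esub> f \<in> hom ?W a c" if f: "f \<in> hom ?W a b" and g: "g \<in> hom ?W b c" for f g a b c
  proof -
    have *: "ncomp g y \<cdot> ncomp f y \<cdot> farr a (x, y) = farr c (x, y) \<cdot> (ncomp g x \<cdot> ncomp f x)"
      if xy: "(x, y) \<in> Arr (ar_cat I)" for x y
    proof -
      have o: "a \<in> S_objects C I" "b \<in> S_objects C I" "c \<in> S_objects C I"
        using f g by (auto simp: wS_hom_iff)
      have h: "ncomp f x \<in> hom C (fobj a x) (fobj b x)" "ncomp f y \<in> hom C (fobj a y) (fobj b y)"
        "ncomp g x \<in> hom C (fobj b x) (fobj c x)" "ncomp g y \<in> hom C (fobj b y) (fobj c y)"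
        "ncomp f y \<cdot> farr a (x, y) = farr b (x, y) \<cdot> ncomp f x"
        "ncomp g y \<cdot> farr b (x, y) = farr c (x, y) \<cdot> ncomp g x"
        using f g xy ar_arr_obj[OF xy] by (auto simp: wS_hom_iff)
      note s = o[THEN S_hom, OF xy]
      have "ncomp g y \<cdot> ncomp f y \<cdot> farr a (x, y) = ncomp g y \<cdot> (farr b (x, y) \<cdot> ncomp f x)"
        using comp_assoc[OF s(1) h(2,4)] h(5) by simp
      also have "\<dots> = farr c (x, y) \<cdot> (ncomp g x \<cdot> ncomp f x)"
        using comp_assoc[OF h(1) s(2) h(4)] comp_assoc[OF h(1,3) s(3)] h(6) by simp
      finally show ?thesis .
    qed
    have "ncomp g x \<cdot> ncomp f x \<in> weq C" "ncomp g x \<cdot> ncomp f x \<in> hom C (fobj a x) (fobj c x)"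
      if "x \<in> ar_set I" for x
    proof -
      have h: "ncomp f x \<in> hom C (fobj a x) (fobj b x)" "ncomp g x \<in> hom C (fobj b x) (fobj c x)"
         "ncomp f x \<in> weq C" "ncomp g x \<in> weq C"
        using f g that by (auto simp: wS_hom_iff)
      show "ncomp g x \<cdot> ncomp f x \<in> weq C"
        using weq_comp h hom_dom hom_cod by metis
      show "ncomp g x \<cdot> ncomp f x \<in> hom C (fobj a x) (fobj c x)"
        using comp_hom[OF h(1,2)] .
    qed
    with * show ?thesis using f g by (auto simp: wS_hom_iff ar_arr_obj)
  qed
  {
    fix f assume "f \<in> Arr ?W"
    then have f: "f \<in> hom ?W (nsrc f) (ntgt f)" by (simp add: hom_def)
    then have o: "nsrc f \<in> Obj ?W" "ntgt f \<in> Obj ?W" by (simp_all add: wS_hom_iff)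
    have x: "ncomp f x \<in> hom C (fobj (nsrc f) x) (fobj (ntgt f) x)" if "x \<in> ar_set I" for x
      using f that by (simp add: wS_hom_iff)
    have "Idt ?W (ntgt f) \<cdot>\<^bsub>?W\<^esub> f = f"
      by (rule wS_hom_eqI[OF cmp[OF f idt[OF o(2)]] f]) (simp add: id_left[OF x])
    then show "Idt ?W (Cod ?W f) \<cdot>\<^bsub>?W\<^esub> f = f" by (simp del: wS_cat_simps(4,5))
    have "f \<cdot>\<^bsub>?W\<^esub> Idt ?W (nsrc f) = f"
      by (rule wS_hom_eqI[OF cmp[OF idt[OF o(1)] f] f]) (simp add: id_right[OF x])
    then show "f \<cdot>\<^bsub>?W\<^esub> Idt ?W (Dom ?W f) = f" by (simp del: wS_cat_simps(4,5))
  }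
  fix f g h a b c d assume f: "f \<in> hom ?W a b" and g: "g \<in> hom ?W b c" and h: "h \<in> hom ?W c d"
  show "h \<cdot>\<^bsub>?W\<^esub> (g \<cdot>\<^bsub>?W\<^esub> f) = h \<cdot>\<^bsub>?W\<^esub> g \<cdot>\<^bsub>?W\<^esub> f"
  proof (rule wS_hom_eqI[OF cmp[OF cmp[OF f g] h] cmp[OF f cmp[OF g h]]])
    fix x assume x: "x \<in> ar_set I"
    then have "ncomp f x \<in> hom C (fobj a x) (fobj b x)" "ncomp g x \<in> hom C (fobj b x) (fobj c x)"
      "ncomp h x \<in> hom C (fobj c x) (fobj d x)"
      using f g h by (auto simp: wS_hom_iff)
    from comp_assoc[OF this] x
    show "ncomp (h \<cdot>\<^bsub>?W\<^esub> (g \<cdot>\<^bsub>?W\<^esub> f)) x = ncomp (h \<cdot>\<^bsub>?W\<^esub> g \<cdot>\<^bsub>?W\<^esub> f) x" by simp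
  qed
qed

context
  fixes A B :: "('i::linorder, 'o, 'm) S_obj" and I z
  assumes A: "A \<in> S_objects C I" and B: "B \<in> S_objects C I"
    and z: "z \<in> I" "\<And>i. i \<in> I \<Longrightarrow> z \<le> i"
begin

text \<open>The row at the least index z consists of the filtration steps, and its map to (i, j) is
  the cokernel of the map from step i to step j. Equalities between maps out of (i, j) are tested
  through it.\<close>

lemma S_quotient_epi:
  assumes "(i, j) \<in> ar_set I" "h \<in> hom C (fobj A (i, j)) x" "h' \<in> hom C (fobj A (i, j)) x"
    and "h \<cdot> farr A ((z, j), (i, j)) = h' \<cdot> farr A ((z, j), (i, j))"
  shows "h = h'"
proof (rule is_cokernel_epi[OF _ _ assms(2-4)])
  show "is_cokernel (farr A ((z, i), (z, j))) (farr A ((z, j), (i, j)))"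
    using S_cofibration_sequence[OF A, of z i j] assms(1) z by (simp add: cofibration_sequence_iff)
  show "farr A ((z, j), (i, j)) \<in> hom C (fobj A (z, j)) (fobj A (i, j))"
    using S_hom[OF A] assms(1) z by simp
qed

lemma wS_hom_unique:
  assumes s: "s \<in> hom (wS_cat C I) A B" and t: "t \<in> hom (wS_cat C I) A B"
    and eq: "\<And>j. j \<in> I \<Longrightarrow> ncomp s (z, j) = ncomp t (z, j)"
  shows "s = t"
proof (rule wS_hom_eqI[OF s t])
  fix a assume "a \<in> ar_set I"
  then obtain i j where ij: "a = (i, j)" "(i, j) \<in> ar_set I" by (cases a) auto
  then have f: "((z, j), (i, j)) \<in> Arr (ar_cat I)" using z by auto
  have "ncomp s (i, j) = ncomp t (i, j)"
    using S_quotient_epi[OF ij(2) wS_homD(6)[OF s ij(2)] wS_homD(6)[OF t ij(2)]]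
      wS_homD(8)[OF s f] wS_homD(8)[OF t f] eq[of j] ij by simp
  then show "ncomp s a = ncomp t a" using ij by simp
qed

text \<open>A map of filtrations induces maps of the quotients. The gluing axiom makes these weak
  equivalences, and naturality is inherited from the row because the quotient maps are
  epimorphisms.\<close>

lemma wS_hom_extend:
  assumes \<phi>: "\<And>j. j \<in> I \<Longrightarrow> \<phi> j \<in> hom C (fobj A (z, j)) (fobj B (z, j))"
    and w: "\<And>j. j \<in> I \<Longrightarrow> \<phi> j \<in> weq C"
    and nat: "\<And>j k. \<lbrakk>j \<in> I; k \<in> I; j \<le> k\<rbrakk>
      \<Longrightarrow> \<phi> k \<cdot> farr A ((z, j), (z, k)) = farr B ((z, j), (z, k)) \<cdot> \<phi> j"
  obtains t where "t \<in> hom (wS_cat C I) A B" "\<And>j. j \<in> I \<Longrightarrow> ncomp t (z, j) = \<phi> j"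
proof -
  have "\<exists>h. h \<in> hom C (fobj A (i, j)) (fobj B (i, j)) \<and>
        h \<cdot> farr A ((z, j), (i, j)) = farr B ((z, j), (i, j)) \<cdot> \<phi> j \<and> h \<in> weq C"
    if ij: "(i, j) \<in> ar_set I" for i j
  proof -
    have arrs: "((z, i), (z, j)) \<in> Arr (ar_cat I)" "((z, j), (i, j)) \<in> Arr (ar_cat I)"
      "((z, i), (i, i)) \<in> Arr (ar_cat I)" "((i, i), (i, j)) \<in> Arr (ar_cat I)"
      "((z, i), (i, j)) \<in> Arr (ar_cat I)"
      using ij z by auto
    note a = arrs[THEN S_hom[OF A]] and b = arrs[THEN S_hom[OF B]]
    have i: "i \<in> I" "j \<in> I" "i \<le> j" using ij by auto
    note cA = S_cofibration_sequence[OF A z(1) i(1,2) z(2)[OF i(1)] i(3)]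
    note cB = S_cofibration_sequence[OF B z(1) i(1,2) z(2)[OF i(1)] i(3)]
    \<comment> \<open>By the functoriality of \<open>B\<close> the composite passes through B(i, i),
      which is zero. It therefore factors through the quotient A(i, j) of step j by step i.\<close>
    have "farr B ((z, j), (i, j)) \<cdot> \<phi> j \<cdot> farr A ((z, i), (z, j))
        = farr B ((z, i), (i, j)) \<cdot> \<phi> i"
      using comp_assoc[OF a(1) \<phi>[OF i(2)] b(2)] comp_assoc[OF \<phi>[OF i(1)] b(1,2)]
        nat[OF i] S_comp[OF B arrs(1,2)] by simp
    also have "\<dots> = farr B ((i, i), (i, j)) \<cdot> (farr B ((z, i), (i, i)) \<cdot> \<phi> i)"
      using comp_assoc[OF \<phi>[OF i(1)] b(3,4)] S_comp[OF B arrs(3,4)] by simp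
    finally have e: "farr B ((z, j), (i, j)) \<cdot> \<phi> j \<cdot> farr A ((z, i), (z, j)) =
        farr B ((i, i), (i, j)) \<cdot> (farr B ((z, i), (i, i)) \<cdot> \<phi> i)" .
    obtain h where h: "h \<in> hom C (fobj A (i, j)) (fobj B (i, j))"
        "h \<cdot> farr A ((z, j), (i, j)) = farr B ((z, j), (i, j)) \<cdot> \<phi> j"
      using is_cokernel_factor[OF _ a(1,2) comp_hom[OF \<phi>[OF i(2)] b(2)] _ _ e]
        comp_hom[OF \<phi>[OF i(1)] b(3)] b(4) S_zero[OF B i(1)] cA
      by (auto simp: cofibration_sequence_iff)
    note oA = hom_obj[OF a(1)] hom_obj(2)[OF a(2)] and oB = hom_obj[OF b(1)] hom_obj(2)[OF b(2)]
    note P = cA[unfolded cofibration_sequence_iff is_cokernel_def hom_dom[OF a(1)] hom_cod[OF a(2)]]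
    note Q = cB[unfolded cofibration_sequence_iff is_cokernel_def hom_dom[OF b(1)] hom_cod[OF b(2)]]
    \<comment> \<open>The two spans are step j <- step i -> 0, for \<open>A\<close> and for
      \<open>B\<close>. The vertical maps are \<open>\<phi> j\<close>, \<open>\<phi> i\<close> and
      the identity of the zero object, and \<open>h\<close> is the induced map of the
      pushouts.\<close>
    have "h \<in> weq C"
    proof (rule weq_gluing)
      show "is_pushout C (farr A ((z, i), (z, j))) (to_zero (fobj A (z, i)))
          (farr A ((z, j), (i, j))) (from_zero (fobj A (i, j)))"
        and "farr A ((z, i), (z, j)) \<in> cof C" using P by auto
      show "is_pushout C (farr B ((z, i), (z, j))) (to_zero (fobj B (z, i)))
          (farr B ((z, j), (i, j))) (from_zero (fobj B (i, j)))"
        and "farr B ((z, i), (z, j)) \<in> cof C" using Q by auto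
      show "\<phi> i \<in> weq C" "\<phi> j \<in> weq C" using w i by auto
      show "Idt C (zero C) \<in> weq C" using weq_iso is_iso_idt zero_obj by blast
      show "\<phi> i \<in> hom C (Dom C (farr A ((z, i), z, j))) (Dom C (farr B ((z, i), z, j)))"
        "\<phi> j \<in> hom C (Cod C (farr A ((z, i), z, j))) (Cod C (farr B ((z, i), z, j)))"
        using \<phi> i a(1) b(1) by (auto simp: hom_def)
      show "Idt C (zero C) \<in> hom C (Cod C (to_zero (fobj A (z, i)))) (Cod C (to_zero (fobj B (z, i))))"
        using hom_cod[OF to_zero[OF oA(1)]] hom_cod[OF to_zero[OF oB(1)]] idt_hom[OF zero_obj]
        by simp
      show "\<phi> j \<cdot> farr A ((z, i), z, j) = farr B ((z, i), z, j) \<cdot> \<phi> i"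
        using nat i by simp
      show "Idt C (zero C) \<cdot> to_zero (fobj A (z, i)) = to_zero (fobj B (z, i)) \<cdot> \<phi> i"
        by (rule to_zero_unique)
          (use comp_hom idt_hom to_zero zero_obj oA oB \<phi>[OF i(1)] in blast)+
      show "h \<in> hom C (Cod C (farr A ((z, j), i, j))) (Cod C (farr B ((z, j), i, j)))"
        using h(1) hom_cod[OF a(2)] hom_cod[OF b(2)] by simp
      show "h \<cdot> farr A ((z, j), i, j) = farr B ((z, j), i, j) \<cdot> \<phi> j" by fact
      show "h \<cdot> from_zero (fobj A (i, j)) = from_zero (fobj B (i, j)) \<cdot> Idt C (zero C)"
        by (rule from_zero_unique) (use comp_hom idt_hom from_zero zero_obj oA oB h in blast)+
    qed
    with h show ?thesis by blast
  qed
  then obtain \<psi> where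
    \<psi>: "\<And>i j. (i, j) \<in> ar_set I \<Longrightarrow> \<psi> i j \<in> hom C (fobj A (i, j)) (fobj B (i, j))"
    and \<psi>w: "\<And>i j. (i, j) \<in> ar_set I \<Longrightarrow> \<psi> i j \<in> weq C"
    and \<psi>c: "\<And>i j. (i, j) \<in> ar_set I \<Longrightarrow>
       \<psi> i j \<cdot> farr A ((z, j), (i, j)) = farr B ((z, j), (i, j)) \<cdot> \<phi> j"
    by metis
  \<comment> \<open>Both sides are compared after the epimorphism A(z, j) -> A(i, j), which turns
    the square into one in the row followed by a quotient map.\<close>
  have \<psi>n: "\<psi> k l \<cdot> farr A ((i, j), (k, l)) = farr B ((i, j), (k, l)) \<cdot> \<psi> i j"
    if f: "((i, j), (k, l)) \<in> Arr (ar_cat I)" for i j k l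
  proof -
    have ij: "(i, j) \<in> ar_set I" and kl: "(k, l) \<in> ar_set I" using ar_arr_obj[OF f] by auto
    have arrs: "((z, j), (i, j)) \<in> Arr (ar_cat I)" "((z, j), (z, l)) \<in> Arr (ar_cat I)"
      "((z, l), (k, l)) \<in> Arr (ar_cat I)"
      using f z by auto
    note a = arrs[THEN S_hom[OF A]] S_hom[OF A f] and b = arrs[THEN S_hom[OF B]] S_hom[OF B f]
    have j: "j \<in> I" "l \<in> I" "j \<le> l" using f by auto
    have "\<psi> k l \<cdot> farr A ((i, j), (k, l)) \<cdot> farr A ((z, j), (i, j))
        = \<psi> k l \<cdot> (farr A ((z, l), (k, l)) \<cdot> farr A ((z, j), (z, l)))"
      using comp_assoc[OF a(1,4) \<psi>[OF kl]] S_comp[OF A arrs(1) f] S_comp[OF A arrs(2,3)] by simp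
    also have "\<dots> = farr B ((z, l), (k, l)) \<cdot> (\<phi> l \<cdot> farr A ((z, j), (z, l)))"
      using comp_assoc[OF a(2,3) \<psi>[OF kl]] comp_assoc[OF a(2) \<phi>[OF j(2)] b(3)] \<psi>c[OF kl] by simp
    also have "\<dots> = (farr B ((z, l), (k, l)) \<cdot> farr B ((z, j), (z, l))) \<cdot> \<phi> j"
      using comp_assoc[OF \<phi>[OF j(1)] b(2,3)] nat[OF j] by simp
    also have "\<dots> = farr B ((i, j), (k, l)) \<cdot> farr B ((z, j), (i, j)) \<cdot> \<phi> j"
      using S_comp[OF B arrs(1) f] S_comp[OF B arrs(2,3)] by simp
    also have "\<dots> = farr B ((i, j), (k, l)) \<cdot> \<psi> i j \<cdot> farr A ((z, j), (i, j))"
      using comp_assoc[OF \<phi>[OF j(1)] b(1,4)] comp_assoc[OF a(1) \<psi>[OF ij] b(4)] \<psi>c[OF ij] by simp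
    finally show ?thesis
      using S_quotient_epi[OF ij comp_hom[OF a(4) \<psi>[OF kl]] comp_hom[OF \<psi>[OF ij] b(4)]] by simp
  qed
  define t where "t = \<lparr>nsrc = A, ntgt = B, ncomp = (\<lambda>a\<in>ar_set I. \<psi> (fst a) (snd a))\<rparr>"
  have "t \<in> hom (wS_cat C I) A B"
    using A B \<psi> \<psi>w \<psi>n by (auto simp: wS_hom_iff t_def ar_arr_obj split: prod.splits)
  \<comment> \<open>At i = z the quotient map is an identity, so the induced map there is the given
    one.\<close>
  moreover have "ncomp t (z, j) = \<phi> j" if j: "j \<in> I" for j
  proof -
    have zj: "(z, j) \<in> ar_set I" using j z by simp
    then show ?thesis
      using \<psi>c[OF zj] S_idt[OF A zj] S_idt[OF B zj] id_right[OF \<psi>[OF zj]] id_left[OF \<phi>[OF j]]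
      by (simp add: t_def)
  qed
  ultimately show thesis using that by blast
qed

end

end


section \<open>Restrictions and homotopy limits\<close>

lemma S_restr_simps:
  "fobj (S_restr I J) A =
    \<lparr>fobj = restrict (fobj A) (ar_set J), farr = restrict (farr A) (Arr (ar_cat J))\<rparr>"
  "farr (S_restr I J) t = \<lparr>nsrc = fobj (S_restr I J) (nsrc t), ntgt = fobj (S_restr I J) (ntgt t),
    ncomp = restrict (ncomp t) (ar_set J)\<rparr>"
  by (simp_all add: S_restr_def S_map_def S_map_obj_def map_prod_def restrict_def fun_eq_iff)

lemma S_restr_obj_apply [simp]:
  "a \<in> ar_set J \<Longrightarrow> fobj (fobj (S_restr I J) A) a = fobj A a"
  "f \<in> Arr (ar_cat J) \<Longrightarrow> farr (fobj (S_restr I J) A) f = farr A f"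
  by (simp_all add: S_restr_simps)

lemma S_restr_arr_apply [simp]:
  "a \<in> ar_set J \<Longrightarrow> ncomp (farr (S_restr I J) t) a = ncomp t a"
  by (simp add: S_restr_simps)

text \<open>Functors and components are stored as restricted functions, so restricting in two stages
  is strict. This allows the coherence isomorphisms of the 2-Segal map to be identities.\<close>

lemma S_restr_trans:
  assumes "K \<subseteq> J"
  shows "fobj (S_restr J K) (fobj (S_restr I J) A) = fobj (S_restr I K) A"
    and "farr (S_restr J K) (farr (S_restr I J) t) = farr (S_restr I K) t"
proof -
  have "ar_set K \<subseteq> ar_set J" "Arr (ar_cat K) \<subseteq> Arr (ar_cat J)"
    using assms ar_set_mono ar_arr_mono by blast+
  then show "fobj (S_restr J K) (fobj (S_restr I J) A) = fobj (S_restr I K) A"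
    and "farr (S_restr J K) (farr (S_restr I J) t) = farr (S_restr I K) t"
    by (simp_all add: S_restr_simps Int_absorb1)
qed

context waldhausen_category
begin

lemma S_restr_objects:
  assumes "J \<subseteq> I" "A \<in> S_objects C I"
  shows "fobj (S_restr K J) A \<in> S_objects C J"
proof -
  note A = assms(2)
  note m = ar_set_mono[OF assms(1)] ar_arr_mono[OF assms(1)]
  show ?thesis
    unfolding S_objects_iff
  proof (intro conjI ballI allI impI)
    show "fobj (fobj (S_restr K J) A) \<in> extensional (ar_set J)"
      "farr (fobj (S_restr K J) A) \<in> extensional (Arr (ar_cat J))"
      by (simp_all add: S_restr_simps)
    fix a assume a: "a \<in> ar_set J"
    then show "fobj (fobj (S_restr K J) A) a \<in> Obj C"
      "farr (fobj (S_restr K J) A) (a, a) = Idt C (fobj (fobj (S_restr K J) A) a)"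
      using S_obj[OF A m(1)[OF a]] S_idt[OF A m(1)[OF a]] ar_arr_refl[OF a] by simp_all
  next
    fix a b c assume ab: "(a, b) \<in> Arr (ar_cat J)"
    then show "farr (fobj (S_restr K J) A) (a, b)
        \<in> hom C (fobj (fobj (S_restr K J) A) a) (fobj (fobj (S_restr K J) A) b)"
      using S_hom[OF A m(2)[OF ab]] ar_arr_obj[OF ab] by simp
    assume bc: "(b, c) \<in> Arr (ar_cat J)"
    show "farr (fobj (S_restr K J) A) (a, c)
        = farr (fobj (S_restr K J) A) (b, c) \<cdot> farr (fobj (S_restr K J) A) (a, b)"
      using S_comp[OF A m(2)[OF ab] m(2)[OF bc]] ab bc ar_arr_trans[OF ab bc] by simp
  next
    fix j assume "j \<in> J" then show "fobj (fobj (S_restr K J) A) (j, j) = zero C"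
      using S_zero[OF A] assms(1) by auto
  next
    fix i j k assume ijk: "i \<in> J" "j \<in> J" "k \<in> J" "i < j \<and> j < k"
    then have "i \<le> j" "j \<le> k" "i \<le> k" by auto
    with ijk show "cofibration_sequence C (farr (fobj (S_restr K J) A) ((i, j), i, k))
        (farr (fobj (S_restr K J) A) ((i, k), j, k))"
      using A[unfolded S_objects_iff] assms(1) by (simp add: subset_iff)
  qed
qed

lemma S_restr_hom:
  assumes "J \<subseteq> I" "t \<in> hom (wS_cat C I) A B"
  shows "farr (S_restr K J) t \<in> hom (wS_cat C J) (fobj (S_restr K J) A) (fobj (S_restr K J) B)"
proof -
  note t = wS_homD[OF assms(2)]
  note m = ar_set_mono[OF assms(1)] ar_arr_mono[OF assms(1)]
  show ?thesis
    unfolding wS_hom_iff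
  proof (intro conjI ballI allI impI)
    show "fobj (S_restr K J) A \<in> S_objects C J" "fobj (S_restr K J) B \<in> S_objects C J"
      using S_restr_objects[OF assms(1)] t(1,2) by auto
    show "nsrc (farr (S_restr K J) t) = fobj (S_restr K J) A"
      "ntgt (farr (S_restr K J) t) = fobj (S_restr K J) B"
      "ncomp (farr (S_restr K J) t) \<in> extensional (ar_set J)"
      using t(3,4) by (simp_all add: S_restr_simps)
    fix a assume a: "a \<in> ar_set J"
    show "ncomp (farr (S_restr K J) t) a
        \<in> hom C (fobj (fobj (S_restr K J) A) a) (fobj (fobj (S_restr K J) B) a)"
      "ncomp (farr (S_restr K J) t) a \<in> weq C"
      using t(6,7)[OF m(1)[OF a]] a by simp_all
  next
    fix a b assume ab: "(a, b) \<in> Arr (ar_cat J)"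
    show "ncomp (farr (S_restr K J) t) b \<cdot> farr (fobj (S_restr K J) A) (a, b)
        = farr (fobj (S_restr K J) B) (a, b) \<cdot> ncomp (farr (S_restr K J) t) a"
      using t(8)[OF m(2)[OF ab]] ab ar_arr_obj[OF ab] by simp
  qed
qed

lemma functor_S_restr:
  assumes "J \<subseteq> I"
  shows "is_functor (wS_cat C I) (wS_cat C J) (S_restr K J)"
  unfolding is_functor_def
proof (intro conjI ballI impI)
  interpret I: category "wS_cat C I" by (rule category_wS)
  interpret J: category "wS_cat C J" by (rule category_wS)
  note m = ar_set_mono[OF assms]
  fix A assume "A \<in> Obj (wS_cat C I)"
  then have A: "A \<in> Obj (wS_cat C I)" "fobj (S_restr K J) A \<in> Obj (wS_cat C J)"
    using S_restr_objects[OF assms] by simp_all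
  then show "fobj (S_restr K J) A \<in> Obj (wS_cat C J)" by simp
  show "farr (S_restr K J) (Idt (wS_cat C I) A) = Idt (wS_cat C J) (fobj (S_restr K J) A)"
    by (rule wS_hom_eqI[OF S_restr_hom[OF assms I.idt_hom[OF A(1)]] J.idt_hom[OF A(2)]])
       (simp add: m)
next
  fix f assume "f \<in> Arr (wS_cat C I)"
  then have "f \<in> hom (wS_cat C I) (nsrc f) (ntgt f)" by (simp add: hom_def)
  from S_restr_hom[OF assms this]
  show "farr (S_restr K J) f \<in> hom (wS_cat C J) (fobj (S_restr K J) (Dom (wS_cat C I) f))
        (fobj (S_restr K J) (Cod (wS_cat C I) f))" by simp
next
  interpret I: category "wS_cat C I" by (rule category_wS)
  interpret J: category "wS_cat C J" by (rule category_wS)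
  fix f g assume "f \<in> Arr (wS_cat C I)" "g \<in> Arr (wS_cat C I)"
    "Dom (wS_cat C I) g = Cod (wS_cat C I) f"
  then have f: "f \<in> hom (wS_cat C I) (nsrc f) (ntgt f)"
    and g: "g \<in> hom (wS_cat C I) (ntgt f) (ntgt g)" by (simp_all add: hom_def)
  note r = S_restr_hom[OF assms]
  show "farr (S_restr K J) (g \<cdot>\<^bsub>wS_cat C I\<^esub> f)
      = farr (S_restr K J) g \<cdot>\<^bsub>wS_cat C J\<^esub> farr (S_restr K J) f"
    by (rule wS_hom_eqI[OF r[OF I.comp_hom[OF f g]] J.comp_hom[OF r[OF f] r[OF g]]])
       (simp add: ar_set_mono[OF assms])
qed

lemma wS_iso_component:
  assumes "is_iso (wS_cat C I) t" "t \<in> hom (wS_cat C I) A B" "a \<in> ar_set I"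
  shows "is_iso C (ncomp t a)"
proof -
  interpret W: category "wS_cat C I" by (rule category_wS)
  obtain s where s: "s \<in> hom (wS_cat C I) B A" "s \<cdot>\<^bsub>wS_cat C I\<^esub> t = Idt (wS_cat C I) A"
    "t \<cdot>\<^bsub>wS_cat C I\<^esub> s = Idt (wS_cat C I) B"
    using W.is_isoE[OF assms(1,2)] by blast
  show ?thesis
  proof (rule is_isoI[OF wS_homD(6)[OF assms(2,3)] wS_homD(6)[OF s(1) assms(3)]])
    show "ncomp s a \<cdot> ncomp t a = Idt C (fobj A a)"
      using s(2) assms(3) by (auto dest: fun_cong[of _ _ a])
    show "ncomp t a \<cdot> ncomp s a = Idt C (fobj B a)"
      using s(3) assms(3) by (auto dest: fun_cong[of _ _ a])
  qed
qed

text \<open>The inverses on the row commute with the filtration maps and, being isomorphisms, are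
  weak equivalences; so they extend to a map in \<open>wS_cat C I\<close>. That it is inverse to
  \<open>t\<close> is again seen on the row.\<close>

lemma wS_isoI:
  assumes t: "t \<in> hom (wS_cat C I) A B"
    and z: "z \<in> I" "\<And>i. i \<in> I \<Longrightarrow> z \<le> i"
    and iso: "\<And>j. j \<in> I \<Longrightarrow> is_iso C (ncomp t (z, j))"
  shows "is_iso (wS_cat C I) t"
proof -
  interpret W: category "wS_cat C I" by (rule category_wS)
  have A: "A \<in> S_objects C I" and B: "B \<in> S_objects C I" using t by (auto simp: wS_hom_iff)
  have zj: "(z, j) \<in> ar_set I" if "j \<in> I" for j using that z by simp
  note th = wS_homD(6)[OF t zj]
  have "\<exists>g. g \<in> hom C (fobj B (z, j)) (fobj A (z, j)) \<and> g \<cdot> ncomp t (z, j) = Idt C (fobj A (z, j))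
      \<and> ncomp t (z, j) \<cdot> g = Idt C (fobj B (z, j)) \<and> is_iso C g" if "j \<in> I" for j
    using is_isoE[OF iso[OF that] th[OF that]] by metis
  then obtain \<psi> where \<psi>: "\<And>j. j \<in> I \<Longrightarrow> \<psi> j \<in> hom C (fobj B (z, j)) (fobj A (z, j))"
    and \<psi>t: "\<And>j. j \<in> I \<Longrightarrow> \<psi> j \<cdot> ncomp t (z, j) = Idt C (fobj A (z, j))"
    and t\<psi>: "\<And>j. j \<in> I \<Longrightarrow> ncomp t (z, j) \<cdot> \<psi> j = Idt C (fobj B (z, j))"
    and \<psi>i: "\<And>j. j \<in> I \<Longrightarrow> is_iso C (\<psi> j)"
    by metis
  have nat: "\<psi> k \<cdot> farr B ((z, j), (z, k)) = farr A ((z, j), (z, k)) \<cdot> \<psi> j"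
    if "j \<in> I" "k \<in> I" "j \<le> k" for j k
  proof -
    have f: "((z, j), (z, k)) \<in> Arr (ar_cat I)" using that z by simp
    note a = S_hom[OF A f] and b = S_hom[OF B f]
    note tj = th[OF that(1)] and tk = th[OF that(2)]
      and pj = \<psi>[OF that(1)] and pk = \<psi>[OF that(2)]
    have "\<psi> k \<cdot> farr B ((z, j), (z, k))
        = \<psi> k \<cdot> (farr B ((z, j), (z, k)) \<cdot> (ncomp t (z, j) \<cdot> \<psi> j))"
      using id_right[OF b] t\<psi>[OF that(1)] by simp
    also have "\<dots> = \<psi> k \<cdot> ((farr B ((z, j), (z, k)) \<cdot> ncomp t (z, j)) \<cdot> \<psi> j)"
      using comp_assoc[OF pj tj b] by simp
    also have "\<dots> = \<psi> k \<cdot> (ncomp t (z, k) \<cdot> (farr A ((z, j), (z, k)) \<cdot> \<psi> j))"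
      using comp_assoc[OF pj a tk] wS_homD(8)[OF t f] by simp
    also have "\<dots> = farr A ((z, j), (z, k)) \<cdot> \<psi> j"
      using comp_assoc[OF comp_hom[OF pj a] tk pk] \<psi>t[OF that(2)] id_left[OF comp_hom[OF pj a]]
      by simp
    finally show ?thesis .
  qed
  obtain s where s: "s \<in> hom (wS_cat C I) B A" "\<And>j. j \<in> I \<Longrightarrow> ncomp s (z, j) = \<psi> j"
    using wS_hom_extend[OF B A z \<psi> weq_iso[OF \<psi>i] nat] by blast
  show ?thesis
  proof (rule W.is_isoI[OF t s(1)])
    show "s \<cdot>\<^bsub>wS_cat C I\<^esub> t = Idt (wS_cat C I) A"
      by (rule wS_hom_unique[OF A A z W.comp_hom[OF t s(1)] W.idt_hom])
         (use A s(2) \<psi>t z in auto)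
    show "t \<cdot>\<^bsub>wS_cat C I\<^esub> s = Idt (wS_cat C I) B"
      by (rule wS_hom_unique[OF B B z W.comp_hom[OF s(1) t] W.idt_hom])
         (use B s(2) t\<psi> z in auto)
  qed
qed

end

section \<open>Pseudo-limits of categories\<close>

lemma holim_cat_simps [simp]:
  "Obj (holim P X r) = holim_objects P X r" "Dom (holim P X r) = nsrc" "Cod (holim P X r) = ntgt"
  "Idt (holim P X r) x = \<lparr>nsrc = x, ntgt = x, ncomp = (\<lambda>I\<in>P. Idt (X I) (fst x I))\<rparr>"
  "t \<cdot>\<^bsub>holim P X r\<^esub> s = \<lparr>nsrc = nsrc s, ntgt = ntgt t,
      ncomp = (\<lambda>I\<in>P. ncomp t I \<cdot>\<^bsub>X I\<^esub> ncomp s I)\<rparr>"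
  by (simp_all add: holim_def)

lemma poset_pairs_iff [simp]: "(I, J) \<in> poset_pairs P \<longleftrightarrow> I \<in> P \<and> J \<in> P \<and> J \<subseteq> I"
  by (simp add: poset_pairs_def)

lemma holim_objectsD:
  assumes "x \<in> holim_objects P X r"
  shows "I \<in> P \<Longrightarrow> fst x I \<in> Obj (X I)"
    and "\<lbrakk>I \<in> P; J \<in> P; J \<subseteq> I\<rbrakk> \<Longrightarrow> snd x (I, J) \<in> hom (X J) (fobj (r I J) (fst x I)) (fst x J)"
    and "\<lbrakk>I \<in> P; J \<in> P; J \<subseteq> I\<rbrakk> \<Longrightarrow> is_iso (X J) (snd x (I, J))"
    and "I \<in> P \<Longrightarrow> snd x (I, I) = Idt (X I) (fst x I)"
    and "\<lbrakk>I \<in> P; J \<in> P; K \<in> P; K \<subseteq> J; J \<subseteq> I\<rbrakk>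
      \<Longrightarrow> snd x (I, K) = snd x (J, K) \<cdot>\<^bsub>X K\<^esub> farr (r J K) (snd x (I, J))"
proof -
  obtain f \<theta> where x: "x = (f, \<theta>)" by (cases x)
  note a = assms[unfolded holim_objects_def x mem_Collect_eq prod.case]
  note * = a[THEN conjunct1] a[THEN conjunct2, THEN conjunct2, THEN conjunct1]
    a[THEN conjunct2, THEN conjunct2, THEN conjunct2, THEN conjunct1]
    a[THEN conjunct2, THEN conjunct2, THEN conjunct2, THEN conjunct2]
  show "I \<in> P \<Longrightarrow> fst x I \<in> Obj (X I)"
    "\<lbrakk>I \<in> P; J \<in> P; J \<subseteq> I\<rbrakk> \<Longrightarrow> snd x (I, J) \<in> hom (X J) (fobj (r I J) (fst x I)) (fst x J)"
    "\<lbrakk>I \<in> P; J \<in> P; J \<subseteq> I\<rbrakk> \<Longrightarrow> is_iso (X J) (snd x (I, J))"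
    using *(1,2) by (auto simp: x)
  show "I \<in> P \<Longrightarrow> snd x (I, I) = Idt (X I) (fst x I)" using *(3) by (simp add: x)
  show "\<lbrakk>I \<in> P; J \<in> P; K \<in> P; K \<subseteq> J; J \<subseteq> I\<rbrakk>
      \<Longrightarrow> snd x (I, K) = snd x (J, K) \<cdot>\<^bsub>X K\<^esub> farr (r J K) (snd x (I, J))"
    using *(4) unfolding x by (metis snd_conv)
qed

lemma holim_hom_iff:
  "t \<in> hom (holim P X r) x y \<longleftrightarrow>
     x \<in> holim_objects P X r \<and> y \<in> holim_objects P X r \<and> nsrc t = x \<and> ntgt t = y \<and>
     ncomp t \<in> extensional P \<and> (\<forall>I\<in>P. ncomp t I \<in> hom (X I) (fst x I) (fst y I)) \<and>
     (\<forall>I\<in>P. \<forall>J\<in>P. J \<subseteq> I \<longrightarrow>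
        ncomp t J \<cdot>\<^bsub>X J\<^esub> snd x (I, J) = snd y (I, J) \<cdot>\<^bsub>X J\<^esub> farr (r I J) (ncomp t I))"
  (is "_ \<longleftrightarrow> ?thesis_rhs")
proof -
  have "t \<in> hom (holim P X r) x y \<longleftrightarrow> t \<in> Arr (holim P X r) \<and> nsrc t = x \<and> ntgt t = y"
    by (simp add: hom_def)
  also have "\<dots> \<longleftrightarrow> ?thesis_rhs"
    by (auto simp: holim_def poset_pairs_def)
  finally show ?thesis .
qed

lemma holim_homD:
  assumes "t \<in> hom (holim P X r) x y"
  shows "x \<in> holim_objects P X r" "y \<in> holim_objects P X r"
    and "I \<in> P \<Longrightarrow> ncomp t I \<in> hom (X I) (fst x I) (fst y I)"
    and "\<lbrakk>I \<in> P; J \<in> P; J \<subseteq> I\<rbrakk> \<Longrightarrow>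
        ncomp t J \<cdot>\<^bsub>X J\<^esub> snd x (I, J) = snd y (I, J) \<cdot>\<^bsub>X J\<^esub> farr (r I J) (ncomp t I)"
  using assms unfolding holim_hom_iff by blast+

lemma holim_hom_eqI:
  assumes "s \<in> hom (holim P X r) x y" "t \<in> hom (holim P X r) x y"
    and "\<And>I. I \<in> P \<Longrightarrow> ncomp s I = ncomp t I"
  shows "s = t"
proof -
  have "ncomp s = ncomp t"
    using assms by (intro extensionalityI[where A = P]) (auto simp: holim_hom_iff)
  then show ?thesis
    using assms by (intro nat_trans.equality) (auto simp: holim_hom_iff)
qed

context
  fixes P :: "'i set set" and X :: "'i set \<Rightarrow> ('o, 'm) cat"
    and r :: "'i set \<Rightarrow> 'i set \<Rightarrow> ('o, 'm, 'o, 'm) ftor"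
  assumes X: "\<And>I. I \<in> P \<Longrightarrow> category (X I)"
    and r: "\<And>I J. \<lbrakk>I \<in> P; J \<in> P; J \<subseteq> I\<rbrakk> \<Longrightarrow> is_functor (X I) (X J) (r I J)"
begin

lemma category_holim: "category (holim P X r)"
proof
  let ?H = "holim P X r"
  show "Dom ?H f \<in> Obj ?H" "Cod ?H f \<in> Obj ?H" if "f \<in> Arr ?H" for f
    using that holim_hom_iff[of f P X r "nsrc f" "ntgt f"] by (auto simp: hom_def)
  show idt: "Idt ?H x \<in> hom ?H x x" if "x \<in> Obj ?H" for x
    unfolding holim_hom_iff
  proof (intro conjI ballI impI)
    show x: "x \<in> holim_objects P X r" "x \<in> holim_objects P X r" using that by simp_all
    show "nsrc (Idt ?H x) = x" "ntgt (Idt ?H x) = x" "ncomp (Idt ?H x) \<in> extensional P"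
      by simp_all
    show "ncomp (Idt ?H x) I \<in> hom (X I) (fst x I) (fst x I)" if "I \<in> P" for I
      using that category.idt_hom[OF X] holim_objectsD(1)[OF x(1)] by simp
    show "ncomp (Idt ?H x) J \<cdot>\<^bsub>X J\<^esub> snd x (I, J)
        = snd x (I, J) \<cdot>\<^bsub>X J\<^esub> farr (r I J) (ncomp (Idt ?H x) I)"
      if IJ: "I \<in> P" "J \<in> P" "J \<subseteq> I" for I J
      using that functor_idt[OF r[OF IJ] holim_objectsD(1)[OF x(1)]]
        category.id_left[OF X holim_objectsD(2)[OF x(1) IJ]]
        category.id_right[OF X holim_objectsD(2)[OF x(1) IJ]] by simp
  qed
  show cmp: "g \<cdot>\<^bsub>?H\<^esub> f \<in> hom ?H x z" if f: "f \<in> hom ?H x y" and g: "g \<in> hom ?H y z" for f g x y z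
    unfolding holim_hom_iff
  proof (intro conjI ballI impI)
    show o: "x \<in> holim_objects P X r" "z \<in> holim_objects P X r"
      using f g by (simp_all add: holim_hom_iff)
    show "nsrc (g \<cdot>\<^bsub>?H\<^esub> f) = x" "ntgt (g \<cdot>\<^bsub>?H\<^esub> f) = z" "ncomp (g \<cdot>\<^bsub>?H\<^esub> f) \<in> extensional P"
      using f g by (simp_all add: holim_hom_iff)
    show "ncomp (g \<cdot>\<^bsub>?H\<^esub> f) I \<in> hom (X I) (fst x I) (fst z I)" if I: "I \<in> P" for I
      using category.comp_hom[OF X[OF I] holim_homD(3)[OF f I] holim_homD(3)[OF g I]] I by simp
    fix I J assume IJ: "I \<in> P" "J \<in> P" "J \<subseteq> I"
    interpret J: category "X J" using X IJ by blast
    note h = holim_homD(3)[OF f IJ(1)] holim_homD(3)[OF g IJ(1)]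
    note k = holim_homD(3)[OF f IJ(2)] holim_homD(3)[OF g IJ(2)]
    note rh = functor_hom[OF r[OF IJ] h(1)] functor_hom[OF r[OF IJ] h(2)]
    note \<theta> = holim_objectsD(2)[OF holim_homD(1)[OF f] IJ] holim_objectsD(2)[OF holim_homD(2)[OF f] IJ]
      holim_objectsD(2)[OF holim_homD(2)[OF g] IJ]
    have "ncomp g J \<cdot>\<^bsub>X J\<^esub> ncomp f J \<cdot>\<^bsub>X J\<^esub> snd x (I, J)
        = snd z (I, J) \<cdot>\<^bsub>X J\<^esub> (farr (r I J) (ncomp g I) \<cdot>\<^bsub>X J\<^esub> farr (r I J) (ncomp f I))"
      using J.comp_assoc[OF \<theta>(1) k] J.comp_assoc[OF rh(1) \<theta>(2) k(2)] J.comp_assoc[OF rh \<theta>(3)]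
        holim_homD(4)[OF f IJ] holim_homD(4)[OF g IJ] by simp
    then show "ncomp (g \<cdot>\<^bsub>?H\<^esub> f) J \<cdot>\<^bsub>X J\<^esub> snd x (I, J)
        = snd z (I, J) \<cdot>\<^bsub>X J\<^esub> farr (r I J) (ncomp (g \<cdot>\<^bsub>?H\<^esub> f) I)"
      using functor_comp[OF r[OF IJ] h] IJ by simp
  qed
  {
    fix f assume "f \<in> Arr ?H"
    then have f: "f \<in> hom ?H (nsrc f) (ntgt f)" by (simp add: hom_def)
    then have o: "nsrc f \<in> Obj ?H" "ntgt f \<in> Obj ?H" by (simp_all add: holim_hom_iff)
    have "Idt ?H (ntgt f) \<cdot>\<^bsub>?H\<^esub> f = f"
      by (rule holim_hom_eqI[OF cmp[OF f idt[OF o(2)]] f])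
         (simp add: category.id_left[OF X holim_homD(3)[OF f]])
    then show "Idt ?H (Cod ?H f) \<cdot>\<^bsub>?H\<^esub> f = f" by (simp del: holim_cat_simps(4,5))
    have "f \<cdot>\<^bsub>?H\<^esub> Idt ?H (nsrc f) = f"
      by (rule holim_hom_eqI[OF cmp[OF idt[OF o(1)] f] f])
         (simp add: category.id_right[OF X holim_homD(3)[OF f]])
    then show "f \<cdot>\<^bsub>?H\<^esub> Idt ?H (Dom ?H f) = f" by (simp del: holim_cat_simps(4,5))
  }
  fix f g h a b c d assume f: "f \<in> hom ?H a b" and g: "g \<in> hom ?H b c" and h: "h \<in> hom ?H c d"
  show "h \<cdot>\<^bsub>?H\<^esub> (g \<cdot>\<^bsub>?H\<^esub> f) = h \<cdot>\<^bsub>?H\<^esub> g \<cdot>\<^bsub>?H\<^esub> f"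
  proof (rule holim_hom_eqI[OF cmp[OF cmp[OF f g] h] cmp[OF f cmp[OF g h]]])
    fix I assume I: "I \<in> P"
    from category.comp_assoc[OF X[OF I] holim_homD(3)[OF f I] holim_homD(3)[OF g I]
        holim_homD(3)[OF h I]] I
    show "ncomp (h \<cdot>\<^bsub>?H\<^esub> (g \<cdot>\<^bsub>?H\<^esub> f)) I = ncomp (h \<cdot>\<^bsub>?H\<^esub> g \<cdot>\<^bsub>?H\<^esub> f) I" by simp
  qed
qed

text \<open>Coherence squares can be inverted: inserting the image of an identity under
  \<open>r I J\<close> and cancelling turns the square of \<open>t\<close> into that of the
  pointwise inverses, so these form an arrow of the homotopy limit.\<close>

lemma holim_isoI:
  assumes t: "t \<in> hom (holim P X r) x y" and iso: "\<And>I. I \<in> P \<Longrightarrow> is_iso (X I) (ncomp t I)"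
  shows "is_iso (holim P X r) t"
proof -
  interpret H: category "holim P X r" by (rule category_holim)
  note tD = holim_homD[OF t]
  have "\<exists>g. g \<in> hom (X I) (fst y I) (fst x I) \<and> g \<cdot>\<^bsub>X I\<^esub> ncomp t I = Idt (X I) (fst x I)
      \<and> ncomp t I \<cdot>\<^bsub>X I\<^esub> g = Idt (X I) (fst y I)" if "I \<in> P" for I
    using category.is_isoE[OF X iso tD(3)] that by metis
  then obtain \<psi> where \<psi>: "\<And>I. I \<in> P \<Longrightarrow> \<psi> I \<in> hom (X I) (fst y I) (fst x I)"
    and \<psi>t: "\<And>I. I \<in> P \<Longrightarrow> \<psi> I \<cdot>\<^bsub>X I\<^esub> ncomp t I = Idt (X I) (fst x I)"
    and t\<psi>: "\<And>I. I \<in> P \<Longrightarrow> ncomp t I \<cdot>\<^bsub>X I\<^esub> \<psi> I = Idt (X I) (fst y I)"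
    by metis
  define s where "s = \<lparr>nsrc = y, ntgt = x, ncomp = restrict \<psi> P\<rparr>"
  have nat: "\<psi> J \<cdot>\<^bsub>X J\<^esub> snd y (I, J) = snd x (I, J) \<cdot>\<^bsub>X J\<^esub> farr (r I J) (\<psi> I)"
    if IJ: "I \<in> P" "J \<in> P" "J \<subseteq> I" for I J
  proof -
    interpret J: category "X J" using X IJ by blast
    note \<theta>x = holim_objectsD(2)[OF tD(1) IJ] and \<theta>y = holim_objectsD(2)[OF tD(2) IJ]
    note rt = functor_hom[OF r[OF IJ] tD(3)[OF IJ(1)]] and rp = functor_hom[OF r[OF IJ] \<psi>[OF IJ(1)]]
    note tJ = tD(3)[OF IJ(2)] and pJ = \<psi>[OF IJ(2)]
    have e: "farr (r I J) (ncomp t I) \<cdot>\<^bsub>X J\<^esub> farr (r I J) (\<psi> I) = Idt (X J) (fobj (r I J) (fst y I))"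
      using functor_comp[OF r[OF IJ] \<psi>[OF IJ(1)] tD(3)[OF IJ(1)]] t\<psi>[OF IJ(1)]
        functor_idt[OF r[OF IJ] holim_objectsD(1)[OF tD(2) IJ(1)]] by simp
    have "\<psi> J \<cdot>\<^bsub>X J\<^esub> snd y (I, J) = \<psi> J \<cdot>\<^bsub>X J\<^esub> (snd y (I, J) \<cdot>\<^bsub>X J\<^esub>
        (farr (r I J) (ncomp t I) \<cdot>\<^bsub>X J\<^esub> farr (r I J) (\<psi> I)))"
      unfolding e using J.id_right[OF \<theta>y] by simp
    also have "\<dots> = \<psi> J \<cdot>\<^bsub>X J\<^esub> (ncomp t J \<cdot>\<^bsub>X J\<^esub> (snd x (I, J) \<cdot>\<^bsub>X J\<^esub> farr (r I J) (\<psi> I)))"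
      using J.comp_assoc[OF rp rt \<theta>y] J.comp_assoc[OF rp \<theta>x tJ] tD(4)[OF IJ] by simp
    also have "\<dots> = snd x (I, J) \<cdot>\<^bsub>X J\<^esub> farr (r I J) (\<psi> I)"
      using J.comp_assoc[OF J.comp_hom[OF rp \<theta>x] tJ pJ] \<psi>t[OF IJ(2)]
        J.id_left[OF J.comp_hom[OF rp \<theta>x]] by simp
    finally show ?thesis .
  qed
  have s: "s \<in> hom (holim P X r) y x"
    using tD(1,2) \<psi> nat by (simp add: holim_hom_iff s_def)
  show ?thesis
  proof (rule H.is_isoI[OF t s])
    show "s \<cdot>\<^bsub>holim P X r\<^esub> t = Idt (holim P X r) x"
      by (rule holim_hom_eqI[OF H.comp_hom[OF t s] H.idt_hom])
        (use tD \<psi>t in \<open>auto simp: s_def\<close>)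
    show "t \<cdot>\<^bsub>holim P X r\<^esub> s = Idt (holim P X r) y"
      by (rule holim_hom_eqI[OF H.comp_hom[OF s t] H.idt_hom])
        (use tD t\<psi> in \<open>auto simp: s_def\<close>)
  qed
qed

end

text \<open>Strict compatibility of the restrictions, \<open>r_obj\<close> and \<open>r_arr\<close>,
  makes identities admissible as coherence isomorphisms and reduces the coherence conditions to laws
  for identities. The hypotheses range over all index sets because the restrictions start at {0..n},
  which need not belong to the poset.\<close>

lemma functor_segal_map:
  fixes X :: "nat set \<Rightarrow> ('o, 'm) cat" and n :: nat and \<T> :: "nat set set"
  defines "P \<equiv> triangulation_poset n \<T>"
  assumes X: "\<And>I. category (X I)"
    and r: "\<And>I J. J \<subseteq> I \<Longrightarrow> is_functor (X I) (X J) (r I J)"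
    and r_obj: "\<And>I J K x. K \<subseteq> J \<Longrightarrow> fobj (r J K) (fobj (r I J) x) = fobj (r I K) x"
    and r_arr: "\<And>I J K f. K \<subseteq> J \<Longrightarrow> farr (r J K) (farr (r I J) f) = farr (r I K) f"
    and P: "\<And>I. I \<in> P \<Longrightarrow> I \<subseteq> {0..n}"
  shows "is_functor (X {0..n}) (segal_holim n \<T> X r) (segal_map n \<T> X r)"
proof -
  note rn = r[OF P]
  interpret H: category "holim P X r" by (rule category_holim[OF X r])
  interpret Xn: category "X {0..n}" by (rule X)
  have obj: "segal_map_obj n \<T> X r x \<in> holim_objects P X r" if x: "x \<in> Obj (X {0..n})" for x
    unfolding holim_objects_def segal_map_obj_def P_def[symmetric]
  proof (clarify, intro conjI ballI impI)
    let ?\<theta> = "(\<lambda>(I, J)\<in>poset_pairs P. Idt (X J) (fobj (r {0..n} J) x))"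
    let ?x = "\<lambda>I\<in>P. fobj (r {0..n} I) x"
    have o: "fobj (r {0..n} I) x \<in> Obj (X I)" if "I \<in> P" for I
      using functor_obj[OF rn[OF that] x] .
    then show "?x \<in> (\<Pi>\<^sub>E I\<in>P. Obj (X I))" by auto
    show "?\<theta> \<in> extensional (poset_pairs P)" by simp
    show "?\<theta> (I, I) = Idt (X I) (?x I)" if "I \<in> P" for I using that by simp
    show "case p of (I, J) \<Rightarrow> ?\<theta> (I, J) \<in> hom (X J) (fobj (r I J) (?x I)) (?x J) \<and>
        is_iso (X J) (?\<theta> (I, J))" if "p \<in> poset_pairs P" for p
      using that o r_obj category.idt_hom[OF X] category.is_iso_idt[OF X]
      by (cases p) auto
    fix I J K assume IJK: "I \<in> P" "J \<in> P" "K \<in> P" "K \<subseteq> J \<and> J \<subseteq> I"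
    interpret K: category "X K" by (rule X)
    have "K \<subseteq> J" "K \<subseteq> I" using IJK by auto
    then show "?\<theta> (I, K) = ?\<theta> (J, K) \<cdot>\<^bsub>X K\<^esub> farr (r J K) (?\<theta> (I, J))"
      using IJK functor_idt[OF r o, of K J] r_obj[of K J] K.id_left[OF K.idt_hom[OF o]] by simp
  qed
  have arr: "farr (segal_map n \<T> X r) f
      \<in> hom (holim P X r) (segal_map_obj n \<T> X r x) (segal_map_obj n \<T> X r y)"
    if f: "f \<in> hom (X {0..n}) x y" for f x y
    unfolding holim_hom_iff
  proof (intro conjI ballI impI)
    note o = Xn.hom_obj[OF f]
    show "segal_map_obj n \<T> X r x \<in> holim_objects P X r"
      "segal_map_obj n \<T> X r y \<in> holim_objects P X r" using o obj by auto
    show "nsrc (farr (segal_map n \<T> X r) f) = segal_map_obj n \<T> X r x"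
      "ntgt (farr (segal_map n \<T> X r) f) = segal_map_obj n \<T> X r y"
      "ncomp (farr (segal_map n \<T> X r) f) \<in> extensional P"
      using Xn.hom_dom[OF f] Xn.hom_cod[OF f] by (simp_all add: segal_map_def P_def)
    show "ncomp (farr (segal_map n \<T> X r) f) I
        \<in> hom (X I) (fst (segal_map_obj n \<T> X r x) I) (fst (segal_map_obj n \<T> X r y) I)"
      if "I \<in> P" for I
      using functor_hom[OF rn[OF that] f] that
      by (simp add: segal_map_def segal_map_obj_def P_def)
    fix I J assume IJ: "I \<in> P" "J \<in> P" "J \<subseteq> I"
    interpret J: category "X J" by (rule X)
    note h = functor_hom[OF rn[OF IJ(2)] f]
    show "ncomp (farr (segal_map n \<T> X r) f) J \<cdot>\<^bsub>X J\<^esub> snd (segal_map_obj n \<T> X r x) (I, J) =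
        snd (segal_map_obj n \<T> X r y) (I, J) \<cdot>\<^bsub>X J\<^esub> farr (r I J) (ncomp (farr (segal_map n \<T> X r) f) I)"
      using IJ J.id_left[OF h] J.id_right[OF h] r_arr[OF IJ(3)]
      by (simp add: segal_map_def segal_map_obj_def P_def)
  qed
  have so: "fobj (segal_map n \<T> X r) = segal_map_obj n \<T> X r" by (simp add: segal_map_def)
  show ?thesis
    unfolding is_functor_def segal_holim_def P_def[symmetric] so
  proof (intro conjI ballI impI)
    fix x assume x: "x \<in> Obj (X {0..n})"
    show o: "segal_map_obj n \<T> X r x \<in> Obj (holim P X r)" using obj[OF x] by simp
    show "farr (segal_map n \<T> X r) (Idt (X {0..n}) x) = Idt (holim P X r) (segal_map_obj n \<T> X r x)"
      by (rule holim_hom_eqI[OF arr[OF Xn.idt_hom[OF x]] H.idt_hom[OF o]])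
         (simp add: segal_map_def segal_map_obj_def P_def[symmetric] functor_idt[OF rn x])
  next
    fix f assume "f \<in> Arr (X {0..n})"
    from arr[OF Xn.arr_hom[OF this]]
    show "farr (segal_map n \<T> X r) f \<in> hom (holim P X r)
        (segal_map_obj n \<T> X r (Dom (X {0..n}) f)) (segal_map_obj n \<T> X r (Cod (X {0..n}) f))" .
  next
    fix f g assume fg: "f \<in> Arr (X {0..n})" "g \<in> Arr (X {0..n})"
      "Dom (X {0..n}) g = Cod (X {0..n}) f"
    then obtain x y z where f: "f \<in> hom (X {0..n}) x y" and g: "g \<in> hom (X {0..n}) y z"
      using Xn.arr_hom by metis
    show "farr (segal_map n \<T> X r) (g \<cdot>\<^bsub>X {0..n}\<^esub> f)
        = farr (segal_map n \<T> X r) g \<cdot>\<^bsub>holim P X r\<^esub> farr (segal_map n \<T> X r) f"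
      by (rule holim_hom_eqI[OF arr[OF Xn.comp_hom[OF f g]] H.comp_hom[OF arr[OF f] arr[OF g]]])
         (simp add: segal_map_def P_def[symmetric] functor_comp[OF rn f g])
  qed
qed


section \<open>The 2-Segal map of a fan\<close>

context category_with_cofibrations
begin

text \<open>The objects over \<open>(i, j)\<close> are chosen quotients of the \<open>j\<close>-th by the \<open>i\<close>-th filtration step, with the
  quotient map by \<open>0\<close> an identity and the quotient of a step by itself the chosen zero object.\<close>

lemma filtration_S_object:
  fixes Q :: "nat \<Rightarrow> 'o" and s :: "nat \<Rightarrow> 'm"
  assumes Q: "\<And>j. j \<le> n \<Longrightarrow> Q j \<in> Obj C" and Q0: "Q 0 = zero C"
    and s: "\<And>j. j < n \<Longrightarrow> s j \<in> hom C (Q j) (Q (Suc j))" and s_cof: "\<And>j. j < n \<Longrightarrow> s j \<in> cof C"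
  obtains A where "A \<in> S_objects C {0..n}" "\<And>j. j \<le> n \<Longrightarrow> fobj A (0, j) = Q j"
    "\<And>j. j < n \<Longrightarrow> farr A ((0, j), (0, Suc j)) = s j"
proof -
  \<comment> \<open>\<open>c j k\<close> is the composite of the steps from j to k, by recursion on
    the difference k - j; stage d of the recursion adds \<open>s (j + d)\<close>.\<close>
  define c where "c j k = rec_nat (Idt C (Q j)) (\<lambda>d f. s (j + d) \<cdot> f) (k - j)" for j k
  have c_idt: "c j j = Idt C (Q j)" for j by (simp add: c_def)
  have c_Suc: "c j (Suc k) = s k \<cdot> c j k" if "j \<le> k" for j k
    using that by (simp add: c_def Suc_diff_le)
  have c: "c j k \<in> hom C (Q j) (Q k) \<and> c j k \<in> cof C" if "j \<le> k" "k \<le> n" for j k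
    using that
  proof (induction k rule: dec_induct)
    case base
    then show ?case using Q idt_hom cof_iso is_iso_idt by (simp add: c_idt)
  next
    case (step k)
    then have h: "c j k \<in> hom C (Q j) (Q k)" "s k \<in> hom C (Q k) (Q (Suc k))"
      "c j k \<in> cof C" "s k \<in> cof C"
      using s s_cof by auto
    then show ?case
      using step.hyps comp_hom[OF h(1,2)] cof_comp[OF h(3,4)] hom_dom[OF h(2)] hom_cod[OF h(1)]
      by (simp add: c_Suc)
  qed
  then have c_hom: "c j k \<in> hom C (Q j) (Q k)" and c_cof: "c j k \<in> cof C"
    if "j \<le> k" "k \<le> n" for j k
    using that by blast+
  have c_comp: "c j k \<cdot> c i j = c i k" if "i \<le> j" "j \<le> k" "k \<le> n" for i j k
    using that(2,3)
  proof (induction k rule: dec_induct)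
    case base
    then show ?case using id_left[OF c_hom[OF that(1)]] by (simp add: c_idt)
  next
    case (step k)
    then have "c i j \<in> hom C (Q i) (Q j)" "c j k \<in> hom C (Q j) (Q k)" "s k \<in> hom C (Q k) (Q (Suc k))"
      using c_hom that(1) s by auto
    from comp_assoc[OF this] step show ?case using that(1) by (simp add: c_Suc)
  qed
  \<comment> \<open>The normalisations turn isomorphisms into equalities: with \<open>q 0 j\<close>
    an identity, the row of \<open>A\<close> is \<open>Q\<close> itself, and the quotient of a step
    by itself is literally \<open>zero C\<close>. They agree at i = j = 0 because \<open>Q 0\<close>
    is the zero object.\<close>
  have "\<exists>g. is_cokernel (c i j) g \<and> (i = 0 \<longrightarrow> g = Idt C (Q j)) \<and> (i = j \<longrightarrow> Cod C g = zero C)"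
    if ij: "i \<le> j" "j \<le> n" for i j
  proof -
    consider "i = 0" | "i = j" "i \<noteq> 0" | "i \<noteq> 0" "i \<noteq> j" by blast
    then show ?thesis
    proof cases
      case 1
      then have "is_cokernel (c i j) (Idt C (Q j))"
        using is_cokernel_from_zero c_hom[OF ij] Q0 by simp
      then show ?thesis using 1 Q0 hom_cod[OF idt_hom[OF Q[OF ij(2)]]] by metis
    next
      case 2
      then show ?thesis
        using is_cokernel_to_zero[OF to_zero[OF Q[OF ij(2)]]] hom_cod[OF to_zero[OF Q[OF ij(2)]]]
        by (metis c_idt)
    next
      case 3
      then show ?thesis using cokernel_exists[OF c_cof[OF ij]] by blast
    qed
  qed
  then obtain q where q_coker: "\<And>i j. \<lbrakk>i \<le> j; j \<le> n\<rbrakk> \<Longrightarrow> is_cokernel (c i j) (q i j)"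
    and q0: "\<And>j. j \<le> n \<Longrightarrow> q 0 j = Idt C (Q j)"
    and q_diag: "\<And>j. j \<le> n \<Longrightarrow> Cod C (q j j) = zero C"
    by (metis le0 order_refl)
  define D where "D a = Cod C (q (fst a) (snd a))" for a
  have q: "q i j \<in> hom C (Q j) (D (i, j))" if "i \<le> j" "j \<le> n" for i j
    using is_cokernel_homs(2)[OF q_coker[OF that]] hom_cod[OF c_hom[OF that]] by (simp add: D_def)
  have D0: "D (0, j) = Q j" if "j \<le> n" for j
    using q0[OF that] hom_cod[OF idt_hom[OF Q[OF that]]] by (simp add: D_def)
  have ex: "\<exists>!h. h \<in> hom C (D (i, j)) (D (k, l)) \<and> h \<cdot> q i j = q k l \<cdot> c j l"
    if "i \<le> j" "k \<le> l" "i \<le> k" "j \<le> l" "l \<le> n" for i j k l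
  proof -
    have l: "j \<le> n" "k \<le> n" "i \<le> l" using that by auto
    note ij = c_hom[OF that(1) l(1)] and jl = c_hom[OF that(4,5)] and ik = c_hom[OF that(3) l(2)]
      and kl = c_hom[OF that(2,5)] and qkl = q[OF that(2,5)]
    have zz: "to_zero (Q k) \<cdot> c i k \<in> hom C (Q i) (zero C)" "from_zero (D (k, l)) \<in> hom C (zero C) (D (k, l))"
      using comp_hom ik to_zero from_zero hom_obj(2)[OF ik] hom_obj(2)[OF qkl] by blast+
    \<comment> \<open>The map from Q j to D (k, l) vanishes on Q i: there it can be routed through Q
      k, as i \<le> k, and the quotient map kills Q k.\<close>
    have "q k l \<cdot> c j l \<cdot> c i j = q k l \<cdot> c k l \<cdot> c i k"
      using comp_assoc[OF ij jl qkl] comp_assoc[OF ik kl qkl] c_comp that l by simp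
    also have "q k l \<cdot> c k l = from_zero (D (k, l)) \<cdot> to_zero (Q k)"
      using is_pushout_homs(5)[OF q_coker[OF that(2,5), unfolded is_cokernel_def]]
        hom_dom[OF kl] hom_cod[OF qkl] by simp
    also have "\<dots> \<cdot> c i k = from_zero (D (k, l)) \<cdot> (to_zero (Q k) \<cdot> c i k)"
      using comp_assoc[OF ik to_zero zz(2)] hom_obj(2)[OF ik] by simp
    finally show ?thesis
      using is_cokernel_factor[OF q_coker[OF that(1) l(1)] ij q[OF that(1) l(1)]
          comp_hom[OF jl qkl] zz] by blast
  qed
  define M where "M f = (THE h. h \<in> hom C (D (fst f)) (D (snd f)) \<and> h \<cdot> q (fst (fst f)) (snd (fst f))
      = q (fst (snd f)) (snd (snd f)) \<cdot> c (snd (fst f)) (snd (snd f)))" for f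
  have M: "M ((i, j), (k, l)) \<in> hom C (D (i, j)) (D (k, l))"
    "M ((i, j), (k, l)) \<cdot> q i j = q k l \<cdot> c j l"
    if "i \<le> j" "k \<le> l" "i \<le> k" "j \<le> l" "l \<le> n" for i j k l
    using theI'[OF ex[OF that]] by (simp_all add: M_def)
  \<comment> \<open>Uniqueness of induced maps gives the functor laws below: an arrow of
    \<open>A\<close> is recognised by its composite with a quotient map.\<close>
  have Meq: "M ((i, j), (k, l)) = h"
    if "i \<le> j" "k \<le> l" "i \<le> k" "j \<le> l" "l \<le> n" "h \<in> hom C (D (i, j)) (D (k, l))"
      "h \<cdot> q i j = q k l \<cdot> c j l" for i j k l h
    using ex[OF that(1-5)] M[OF that(1-5)] that(6,7) by blast
  define A :: "(nat, 'o, 'm) S_obj" where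
    "A = \<lparr>fobj = restrict D (ar_set {0..n}), farr = restrict M (Arr (ar_cat {0..n}))\<rparr>"
  have A_simps: "a \<in> ar_set {0..n} \<Longrightarrow> fobj A a = D a"
    "f \<in> Arr (ar_cat {0..n}) \<Longrightarrow> farr A f = M f" for a f
    by (simp_all add: A_def)
  show thesis
  proof (rule that)
    show "A \<in> S_objects C {0..n}"
      unfolding S_objects_iff
    proof (intro conjI ballI allI impI)
      show "fobj A \<in> extensional (ar_set {0..n})" "farr A \<in> extensional (Arr (ar_cat {0..n}))"
        by (simp_all add: A_def)
      fix a :: "nat \<times> nat" assume a: "a \<in> ar_set {0..n}"
      then obtain i j where ij: "a = (i, j)" "i \<le> j" "j \<le> n" by (cases a) auto
      note qij = q[OF ij(2,3)]
      show "fobj A a \<in> Obj C" using a ij hom_obj(2)[OF qij] by (simp add: A_simps)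
      have "M (a, a) = Idt C (D a)"
        unfolding ij(1) using ij id_left[OF qij] id_right[OF qij] hom_obj(2)[OF qij]
        by (intro Meq) (simp_all add: c_idt idt_hom)
      then show "farr A (a, a) = Idt C (fobj A a)" using a ar_arr_refl[OF a] by (simp add: A_simps)
    next
      fix a b c' :: "nat \<times> nat" assume ab: "(a, b) \<in> Arr (ar_cat {0..n})"
      obtain i j k l where ij: "a = (i, j)" "b = (k, l)" by (cases a, cases b)
      then have le: "i \<le> j" "k \<le> l" "i \<le> k" "j \<le> l" "l \<le> n" using ab by auto
      show "farr A (a, b) \<in> hom C (fobj A a) (fobj A b)"
        using M(1)[OF le] ab ar_arr_obj[OF ab] by (simp add: A_simps ij)
      assume bc: "(b, c') \<in> Arr (ar_cat {0..n})"
      obtain u v where uv: "c' = (u, v)" by (cases c')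
      have le': "u \<le> v" "k \<le> u" "l \<le> v" "v \<le> n" using bc by (auto simp: ij uv)
      have le2: "j \<le> n" "i \<le> u" "j \<le> v" using le le' by auto
      note Mab = M[OF le] and Mbc = M[OF le(2) le'(1-4)]
      have "M (a, c') = M (b, c') \<cdot> M (a, b)"
        unfolding ij uv
      proof (rule Meq)
        show "M ((k, l), u, v) \<cdot> M ((i, j), k, l) \<in> hom C (D (i, j)) (D (u, v))"
          using comp_hom[OF Mab(1) Mbc(1)] .
        have "M ((k, l), u, v) \<cdot> M ((i, j), k, l) \<cdot> q i j = M ((k, l), u, v) \<cdot> q k l \<cdot> c j l"
          using comp_assoc[OF q[OF le(1) le2(1)] Mab(1) Mbc(1)]
            comp_assoc[OF c_hom[OF le(4,5)] q[OF le(2,5)] Mbc(1)] Mab(2) by simp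
        also have "\<dots> = q u v \<cdot> c j v"
          using comp_assoc[OF c_hom[OF le(4,5)] c_hom[OF le'(3,4)] q[OF le'(1,4)]] Mbc(2)
            c_comp[OF le(4) le'(3,4)] by simp
        finally show "M ((k, l), u, v) \<cdot> M ((i, j), k, l) \<cdot> q i j = q u v \<cdot> c j v" .
      qed (use le le' le2 in auto)
      then show "farr A (a, c') = farr A (b, c') \<cdot> farr A (a, b)"
        using ab bc ar_arr_trans[OF ab bc] by (simp add: A_simps)
    next
      fix j assume "j \<in> {0..n}"
      then show "fobj A (j, j) = zero C" using q_diag by (simp add: A_simps D_def)
    next
      fix i j k :: nat assume "i \<in> {0..n}" "j \<in> {0..n}" "k \<in> {0..n}" "i < j \<and> j < k"
      then have le: "i \<le> j" "j \<le> k" "i \<le> k" "j \<le> n" "k \<le> n" by auto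
      have "cofibration_sequence C (M ((i, j), (i, k))) (M ((i, k), (j, k)))"
      proof (rule is_cokernel_quotients)
        show "c i j \<in> hom C (Q i) (Q j)" "c j k \<in> hom C (Q j) (Q k)" "c j k \<in> cof C"
          "is_cokernel (c i j) (q i j)" "q i j \<in> hom C (Q j) (D (i, j))"
          "is_cokernel (c j k) (q j k)" "q j k \<in> hom C (Q k) (D (j, k))"
          "q i k \<in> hom C (Q k) (D (i, k))"
          using le c_hom c_cof q_coker q by auto
        show "is_cokernel (c j k \<cdot> c i j) (q i k)" using q_coker c_comp le by simp
        show "M ((i, j), i, k) \<in> hom C (D (i, j)) (D (i, k))"
          "M ((i, j), i, k) \<cdot> q i j = q i k \<cdot> c j k"
          using le M[of i j i k] by auto
        show "M ((i, k), j, k) \<in> hom C (D (i, k)) (D (j, k))" using le M[of i k j k] by auto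
        have "q j k \<in> hom C (Q k) (D (j, k))" using le q by auto
        \<comment> \<open>Both ends have second index k, so the filtration map involved is
          \<open>c k k\<close>, an identity.\<close>
        then show "M ((i, k), j, k) \<cdot> q i k = q j k"
          using le M(2)[of i k j k] id_right by (auto simp: c_idt)
      qed
      then show "cofibration_sequence C (farr A ((i, j), i, k)) (farr A ((i, k), j, k))"
        using le by (simp add: A_simps)
    qed
    show "fobj A (0, j) = Q j" if "j \<le> n" for j using that D0 by (simp add: A_simps)
    show "farr A ((0, j), (0, Suc j)) = s j" if j: "j < n" for j
    proof -
      \<comment> \<open>Between objects of the row the quotient maps are identities, so the induced
        map is the step itself.\<close>
      have "M ((0, j), (0, Suc j)) = s j"
        using j s[OF j] id_left[OF s[OF j]] id_right[OF s[OF j]] q0[of j] q0[of "Suc j"]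
        by (intro Meq) (simp_all add: D0 c_Suc c_idt)
      then show ?thesis using j by (simp add: A_simps)
    qed
  qed
qed

end

section \<open>Reconstruction from the members of a fan\<close>

context waldhausen_category
begin

text \<open>The hypotheses isolate the combinatorics of the fan from its geometry:
  \<open>m j\<close> is the smallest member containing j > 0, and by \<open>P_edge\<close> two
  nonzero vertices share a member only if they are consecutive and the member is their triangle with
  0. The filtration map from j > 0 to j + 1 is therefore seen by exactly one member.\<close>

context
  fixes n :: nat and \<T> :: "nat set set" and P and m :: "nat \<Rightarrow> nat set"
  assumes P_def: "P = triangulation_poset n \<T>"
    and P_sub: "\<And>I. I \<in> P \<Longrightarrow> I \<subseteq> {0..n}"
    and P_zero: "\<And>I. I \<in> P \<Longrightarrow> 0 \<in> I"
    and m_in: "\<And>j. \<lbrakk>0 < j; j \<le> n\<rbrakk> \<Longrightarrow> m j \<in> P" "\<And>j. \<lbrakk>0 < j; j \<le> n\<rbrakk> \<Longrightarrow> j \<in> m j"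
    and m_least: "\<And>I j. \<lbrakk>I \<in> P; 0 < j; j \<in> I\<rbrakk> \<Longrightarrow> m j \<subseteq> I"
    and P_triangle: "\<And>j. \<lbrakk>0 < j; j < n\<rbrakk> \<Longrightarrow> {0, j, Suc j} \<in> P"
    and P_edge: "\<And>I j k. \<lbrakk>I \<in> P; j \<in> I; k \<in> I; 0 < j; j < k\<rbrakk> \<Longrightarrow> k = Suc j \<and> I = {0, j, Suc j}"
begin

lemma segal_map_obj_simps:
  "I \<in> P \<Longrightarrow> fst (segal_map_obj n \<T> (wS_cat C) S_restr A) I = fobj (S_restr {0..n} I) A"
  "\<lbrakk>I \<in> P; J \<in> P; J \<subseteq> I\<rbrakk> \<Longrightarrow> snd (segal_map_obj n \<T> (wS_cat C) S_restr A) (I, J)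
      = Idt (wS_cat C J) (fobj (S_restr {0..n} J) A)"
  by (simp_all add: segal_map_obj_def P_def)

lemma segal_map_simps:
  "fobj (segal_map n \<T> (wS_cat C) S_restr) = segal_map_obj n \<T> (wS_cat C) S_restr"
  "I \<in> P \<Longrightarrow> ncomp (farr (segal_map n \<T> (wS_cat C) S_restr) f) I = farr (S_restr {0..n} I) f"
  by (simp_all add: segal_map_def P_def)

lemma functor_wS_segal:
  "is_functor (wS_cat C {0..n}) (holim P (wS_cat C) S_restr) (segal_map n \<T> (wS_cat C) S_restr)"
  unfolding P_def segal_holim_def[symmetric]
  by (rule functor_segal_map)
     (fact category_wS functor_S_restr S_restr_trans P_sub[unfolded P_def]
       | rule category_wS functor_S_restr S_restr_trans, assumption)+

text \<open>Between images of the 2-Segal map the coherence isomorphisms are identities, so the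
  components of \<open>g\<close> restrict to one another strictly and give one value for each
  filtration step. Triangles supply the squares for consecutive steps, and these compose. Uniqueness
  holds because every vertex lies in some member.\<close>

lemma segal_fully_faithful:
  assumes A: "A \<in> S_objects C {0..n}" and B: "B \<in> S_objects C {0..n}"
    and g: "g \<in> hom (holim P (wS_cat C) S_restr)
      (segal_map_obj n \<T> (wS_cat C) S_restr A) (segal_map_obj n \<T> (wS_cat C) S_restr B)"
  shows "\<exists>!f. f \<in> hom (wS_cat C {0..n}) A B \<and> farr (segal_map n \<T> (wS_cat C) S_restr) f = g"
proof -
  let ?R = "\<lambda>I. fobj (S_restr {0..n} I)"
  have gI: "ncomp g I \<in> hom (wS_cat C I) (?R I A) (?R I B)" if "I \<in> P" for I
    using holim_homD(3)[OF g that] that by (simp add: segal_map_obj_simps)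
  have restr: "ncomp g J = farr (S_restr I J) (ncomp g I)" if IJ: "I \<in> P" "J \<in> P" "J \<subseteq> I" for I J
  proof -
    interpret J: category "wS_cat C J" by (rule category_wS)
    have r: "farr (S_restr I J) (ncomp g I) \<in> hom (wS_cat C J) (?R J A) (?R J B)"
      using S_restr_hom[OF IJ(3) gI[OF IJ(1)], of I] S_restr_trans(1)[OF IJ(3)] by metis
    show ?thesis
      using holim_homD(4)[OF g IJ] J.id_right[OF gI[OF IJ(2)]] J.id_left[OF r]
      unfolding segal_map_obj_simps(2)[OF IJ] by (simp del: wS_cat_simps)
  qed
  have comp: "ncomp (ncomp g I) a \<in> hom C (fobj A a) (fobj B a)" "ncomp (ncomp g I) a \<in> weq C"
    if "I \<in> P" "a \<in> ar_set I" for I a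
    using wS_homD(6,7)[OF gI[OF that(1)] that(2)] that(2) by simp_all
  \<comment> \<open>\<open>m\<close> is specified for positive j only; at 0 the map is forced, both
    ends being the zero object.\<close>
  define \<phi> where "\<phi> j = (if j = 0 then Idt C (zero C) else ncomp (ncomp g (m j)) (0, j))" for j
  have zA: "fobj A (0, 0) = zero C" and zB: "fobj B (0, 0) = zero C"
    using S_zero[OF A] S_zero[OF B] by auto
  have \<phi>: "\<phi> j \<in> hom C (fobj A (0, j)) (fobj B (0, j))" "\<phi> j \<in> weq C" if "j \<le> n" for j
    using that comp[of "m j" "(0, j)"] m_in[of j] P_zero[OF m_in(1)[of j]] zA zB
      idt_hom[OF zero_obj] weq_iso[OF is_iso_idt[OF zero_obj]]
    by (cases "j = 0"; simp add: \<phi>_def)+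
  have g\<phi>: "ncomp (ncomp g I) (0, j) = \<phi> j" if I: "I \<in> P" "j \<in> I" for I j
  proof (cases "j = 0")
    case True
    then show ?thesis
      using comp(1)[of I "(0, 0)"] I idt_hom[OF zero_obj] zA zB
      by (auto simp: \<phi>_def intro: from_zero_unique)
  next
    case False
    then have j: "0 < j" "j \<le> n" using P_sub[OF I(1)] I(2) by auto
    have "(0, j) \<in> ar_set (m j)" using m_in[OF j] P_zero by simp
    then show ?thesis
      using restr[OF I(1) m_in(1)[OF j] m_least[OF I(1) j(1) I(2)]] False by (simp add: \<phi>_def)
  qed
  \<comment> \<open>For positive j the square lives in the member {0, j, j + 1}; for j = 0 it
    commutes because it starts at the zero object.\<close>
  have nat1: "\<phi> (Suc j) \<cdot> farr A ((0, j), (0, Suc j)) = farr B ((0, j), (0, Suc j)) \<cdot> \<phi> j"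
    if j: "j < n" for j
  proof -
    have f: "((0, j), (0, Suc j)) \<in> Arr (ar_cat {0..n})" using j by simp
    show ?thesis
    proof (cases "j = 0")
      case True
      show ?thesis
        by (rule from_zero_unique)
           (use True comp_hom[OF S_hom[OF A f]] comp_hom[OF _ S_hom[OF B f]] \<phi>(1)[of j]
             \<phi>(1)[of "Suc j"] j zA in auto)
    next
      case False
      then have I: "{0, j, Suc j} \<in> P" using P_triangle j by simp
      have f': "((0, j), (0, Suc j)) \<in> Arr (ar_cat {0, j, Suc j})" by simp
      show ?thesis
        using wS_homD(8)[OF gI[OF I] f'] f' g\<phi>[OF I] by simp
    qed
  qed
  have nat: "\<phi> k \<cdot> farr A ((0, j), (0, k)) = farr B ((0, j), (0, k)) \<cdot> \<phi> j"
    if "j \<in> {0..n}" "k \<in> {0..n}" "j \<le> k" for j k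
    using that(3,2)
  proof (induction k rule: dec_induct)
    case base
    have "(0, j) \<in> ar_set {0..n}" using that by simp
    then show ?case
      using S_idt[OF A] S_idt[OF B] id_left[OF \<phi>(1)] id_right[OF \<phi>(1)] that by simp
  next
    case (step k)
    then have f: "((0, j), (0, k)) \<in> Arr (ar_cat {0..n})" "((0, k), (0, Suc k)) \<in> Arr (ar_cat {0..n})"
      and k: "k < n"
      using that by auto
    note a = f[THEN S_hom[OF A]] and b = f[THEN S_hom[OF B]]
    have h: "\<phi> (Suc k) \<in> hom C (fobj A (0, Suc k)) (fobj B (0, Suc k))"
      "\<phi> k \<in> hom C (fobj A (0, k)) (fobj B (0, k))" "\<phi> j \<in> hom C (fobj A (0, j)) (fobj B (0, j))"
      using \<phi> k that by auto
    show ?case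
      using step k comp_assoc[OF a h(1)] comp_assoc[OF a(1) h(2) b(2)] comp_assoc[OF h(3) b]
        nat1[OF k] S_comp[OF A f] S_comp[OF B f] by simp
  qed
  obtain f where f: "f \<in> hom (wS_cat C {0..n}) A B" "\<And>j. j \<in> {0..n} \<Longrightarrow> ncomp f (0, j) = \<phi> j"
  proof (rule wS_hom_extend[OF A B _ _ _ _ nat])
  qed (use \<phi> in auto)
  show ?thesis
  proof (rule ex1I[of _ f], intro conjI)
    show "farr (segal_map n \<T> (wS_cat C) S_restr) f = g"
    proof (rule holim_hom_eqI[OF _ g])
      show "farr (segal_map n \<T> (wS_cat C) S_restr) f \<in> hom (holim P (wS_cat C) S_restr)
          (segal_map_obj n \<T> (wS_cat C) S_restr A) (segal_map_obj n \<T> (wS_cat C) S_restr B)"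
        using functor_hom[OF functor_wS_segal f(1)] by (simp add: segal_map_simps)
      fix I assume I: "I \<in> P"
      note r = S_restr_hom[OF P_sub[OF I] f(1), of "{0..n}"]
      have "farr (S_restr {0..n} I) f = ncomp g I"
      proof (rule wS_hom_unique[OF _ _ P_zero[OF I] _ r gI[OF I]])
        show "?R I A \<in> S_objects C I" "?R I B \<in> S_objects C I"
          using wS_homD(1,2)[OF r] by auto
        show "ncomp (farr (S_restr {0..n} I) f) (0, j) = ncomp (ncomp g I) (0, j)" if "j \<in> I" for j
          using that P_zero[OF I] P_sub[OF I] f(2) g\<phi>[OF I that] by auto
      qed simp
      then show "ncomp (farr (segal_map n \<T> (wS_cat C) S_restr) f) I = ncomp g I"
        using I by (simp add: segal_map_simps)
    qed
    fix f' assume "f' \<in> hom (wS_cat C {0..n}) A B \<and> farr (segal_map n \<T> (wS_cat C) S_restr) f' = g"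
    then have f': "f' \<in> hom (wS_cat C {0..n}) A B" and eq: "farr (segal_map n \<T> (wS_cat C) S_restr) f' = g"
      by auto
    show "f' = f"
    proof (rule wS_hom_unique[OF A B _ _ f' f(1)])
      fix j assume j: "j \<in> {0..n}"
      have "ncomp f' (0, j) = \<phi> j"
      proof (cases "j = 0")
        case True
        then show ?thesis
          using wS_homD(6)[OF f', of "(0, 0)"] idt_hom[OF zero_obj] zA zB
          by (auto simp: \<phi>_def intro: from_zero_unique)
      next
        case False
        then have j': "0 < j" "j \<le> n" using j by auto
        note mj = m_in[OF j']
        have "(0, j) \<in> ar_set (m j)" using mj P_zero by simp
        then show ?thesis
          using g\<phi>[OF mj] segal_map_simps(2)[OF mj(1), of f'] eq by simp
      qed
      then show "ncomp f' (0, j) = ncomp f (0, j)" using f(2)[OF j] by simp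
    qed auto
  qed (rule f(1))
qed

text \<open>The values of the members containing j are compared with the one at \<open>m j\<close>
  by coherence isomorphisms, and the cocycle condition makes the comparison consistent. The
  filtration maps are those of the triangles, conjugated by these comparisons.\<close>

lemma segal_essentially_surjective:
  assumes x: "x \<in> holim_objects P (wS_cat C) S_restr"
  shows "\<exists>A \<in> S_objects C {0..n}. \<exists>e \<in> hom (holim P (wS_cat C) S_restr)
      (segal_map_obj n \<T> (wS_cat C) S_restr A) x. is_iso (holim P (wS_cat C) S_restr) e"
proof -
  interpret H: category "holim P (wS_cat C) S_restr"
    by (rule category_holim[OF category_wS functor_S_restr])
  define X where "X = fst x"
  define \<theta> where "\<theta> I J a = ncomp (snd x (I, J)) a" for I J a
  have X: "X I \<in> S_objects C I" if "I \<in> P" for I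
    using holim_objectsD(1)[OF x that] by (simp add: X_def)
  have th: "snd x (I, J) \<in> hom (wS_cat C J) (fobj (S_restr I J) (X I)) (X J)"
    if "I \<in> P" "J \<in> P" "J \<subseteq> I" for I J
    using holim_objectsD(2)[OF x that] by (simp add: X_def)
  have \<theta>: "\<theta> I J a \<in> hom C (fobj (X I) a) (fobj (X J) a)" "is_iso C (\<theta> I J a)"
    if "I \<in> P" "J \<in> P" "J \<subseteq> I" "a \<in> ar_set J" for I J a
    using wS_homD(6)[OF th[OF that(1-3)] that(4)] that(4)
      wS_iso_component[OF holim_objectsD(3)[OF x that(1-3)] th[OF that(1-3)] that(4)]
    by (simp_all add: \<theta>_def)
  have \<theta>_comp: "\<theta> I K a = \<theta> J K a \<cdot> \<theta> I J a"
    if "I \<in> P" "J \<in> P" "K \<in> P" "K \<subseteq> J" "J \<subseteq> I" "a \<in> ar_set K" for I J K a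
    using holim_objectsD(5)[OF x that(1-5)] that(6) by (simp add: \<theta>_def)
  define Q where "Q j = (if j = 0 then zero C else fobj (X (m j)) (0, j))" for j
  \<comment> \<open>A member I containing j contains \<open>m j\<close>, so a coherence isomorphism
    from I to \<open>m j\<close> is available; its component at (0, j) identifies the value in I
    with the chosen one.\<close>
  define \<gamma> where "\<gamma> I j = (if j = 0 then Idt C (zero C) else \<theta> I (m j) (0, j))" for I j
  have X0: "fobj (X I) (0, 0) = zero C" if "I \<in> P" for I
    using S_zero[OF X[OF that] P_zero[OF that]] .
  have ar: "(0, j) \<in> ar_set I" if "I \<in> P" "j \<in> I" for I j using P_zero that by simp
  have Q: "Q j \<in> Obj C" if "j \<le> n" for j
    using S_obj[OF X[OF m_in(1)] ar[OF m_in(1) m_in(2)]] that zero_obj by (simp add: Q_def)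
  have \<gamma>: "\<gamma> I j \<in> hom C (fobj (X I) (0, j)) (Q j)" "is_iso C (\<gamma> I j)"
    if I: "I \<in> P" "j \<in> I" for I j
  proof -
    have "\<gamma> I j \<in> hom C (fobj (X I) (0, j)) (Q j) \<and> is_iso C (\<gamma> I j)"
    proof (cases "j = 0")
      case True
      then show ?thesis using idt_hom[OF zero_obj] is_iso_idt[OF zero_obj] X0[OF I(1)]
        by (simp add: \<gamma>_def Q_def)
    next
      case False
      then have j: "0 < j" "j \<le> n" using P_sub[OF I(1)] I(2) by auto
      note mj = m_in[OF j]
      show ?thesis
        using \<theta>[OF I(1) mj(1) m_least[OF I(1) j(1) I(2)] ar[OF mj]] False
        by (simp add: \<gamma>_def Q_def)
    qed
    then show "\<gamma> I j \<in> hom C (fobj (X I) (0, j)) (Q j)" "is_iso C (\<gamma> I j)" by auto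
  qed
  \<comment> \<open>The cocycle condition for I, J and \<open>m j\<close>: comparing with the chosen
    value directly or by way of J gives the same map.\<close>
  have \<gamma>\<theta>: "\<gamma> J j \<cdot> \<theta> I J (0, j) = \<gamma> I j" if IJ: "I \<in> P" "J \<in> P" "J \<subseteq> I" "j \<in> J" for I J j
  proof (cases "j = 0")
    case True
    show ?thesis
      by (rule from_zero_unique[of _ "Q j"])
         (use True comp_hom[OF \<theta>(1)[OF IJ(1-3) ar[OF IJ(2,4)]] \<gamma>(1)[OF IJ(2,4)]]
           \<gamma>(1)[OF IJ(1), of j] IJ X0[OF IJ(1)] in auto)
  next
    case False
    then have j: "0 < j" "j \<le> n" using P_sub[OF IJ(2)] IJ(4) by auto
    note mj = m_in[OF j]
    show ?thesis
      using \<theta>_comp[OF IJ(1,2) mj(1) m_least[OF IJ(2) j(1) IJ(4)] IJ(3) ar[OF mj]] False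
      by (simp add: \<gamma>_def)
  qed
  \<comment> \<open>The steps are chosen so that the comparison maps commute with them. For j = 0
    there is no triangle to consult; the step is the unique map out of zero, a cofibration by
    axiom.\<close>
  have "\<exists>s. s \<in> hom C (Q j) (Q (Suc j)) \<and> s \<in> cof C \<and>
      (0 < j \<longrightarrow> s \<cdot> \<gamma> {0, j, Suc j} j =
        \<gamma> {0, j, Suc j} (Suc j) \<cdot> farr (X {0, j, Suc j}) ((0, j), (0, Suc j)))" if j: "j < n" for j
  proof (cases "j = 0")
    case True
    then show ?thesis
      using from_zero[OF Q[of "Suc j"]] cof_zero[OF Q[of "Suc j"]] j by (auto simp: Q_def)
  next
    case False
    let ?I = "{0, j, Suc j}"
    have I: "?I \<in> P" using P_triangle j False by simp
    have f: "((0, j), (0, Suc j)) \<in> Arr (ar_cat ?I)" by simp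
    note a = S_hom[OF X[OF I] f]
    have ac: "farr (X ?I) ((0, j), (0, Suc j)) \<in> cof C"
      using S_cofibration_sequence[OF X[OF I], of 0 j "Suc j"] by (simp add: cofibration_sequence_iff)
    have jI: "j \<in> ?I" "Suc j \<in> ?I" by auto
    note gj = \<gamma>[OF I jI(1)] and gs = \<gamma>[OF I jI(2)]
    obtain g' where g': "g' \<in> hom C (Q j) (fobj (X ?I) (0, j))"
      "g' \<cdot> \<gamma> ?I j = Idt C (fobj (X ?I) (0, j))" "is_iso C g'"
      using is_isoE[OF gj(2,1)] by metis
    let ?s = "\<gamma> ?I (Suc j) \<cdot> farr (X ?I) ((0, j), (0, Suc j)) \<cdot> g'"
    note as = comp_hom[OF a gs(1)]
    have "?s \<in> hom C (Q j) (Q (Suc j))" using comp_hom[OF g'(1) as] .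
    moreover have "?s \<in> cof C"
      using cof_comp[OF ac cof_iso[OF gs(2)]] cof_comp[OF cof_iso[OF g'(3)]]
        hom_dom[OF gs(1)] hom_cod[OF a] hom_cod[OF g'(1)] hom_dom[OF as] by simp
    moreover have "?s \<cdot> \<gamma> ?I j = \<gamma> ?I (Suc j) \<cdot> farr (X ?I) ((0, j), (0, Suc j))"
      using comp_assoc[OF gj(1) g'(1) as] g'(2) id_right[OF as] by simp
    ultimately show ?thesis by blast
  qed
  then obtain s where s: "\<And>j. j < n \<Longrightarrow> s j \<in> hom C (Q j) (Q (Suc j))"
      "\<And>j. j < n \<Longrightarrow> s j \<in> cof C"
    and s\<gamma>: "\<And>j. \<lbrakk>j < n; 0 < j\<rbrakk> \<Longrightarrow> s j \<cdot> \<gamma> {0, j, Suc j} j =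
        \<gamma> {0, j, Suc j} (Suc j) \<cdot> farr (X {0, j, Suc j}) ((0, j), (0, Suc j))"
    by metis
  obtain A where A: "A \<in> S_objects C {0..n}" and A0: "\<And>j. j \<le> n \<Longrightarrow> fobj A (0, j) = Q j"
    and As: "\<And>j. j < n \<Longrightarrow> farr A ((0, j), (0, Suc j)) = s j"
    using filtration_S_object[of n Q s] Q s by (auto simp: Q_def)
  let ?R = "\<lambda>I. fobj (S_restr {0..n} I)"
  let ?A = "segal_map_obj n \<T> (wS_cat C) S_restr A"
  have RA: "?R I A \<in> S_objects C I" if "I \<in> P" for I
    using S_restr_objects[OF P_sub[OF that] A] .
  have "\<exists>t. t \<in> hom (wS_cat C I) (X I) (?R I A) \<and> (\<forall>j\<in>I. ncomp t (0, j) = \<gamma> I j)"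
    if I: "I \<in> P" for I
  proof -
    have R0: "fobj (?R I A) (0, j) = Q j" if "j \<in> I" for j
      using ar[OF I that] A0 P_sub[OF I] that by auto
    have nat: "\<gamma> I k \<cdot> farr (X I) ((0, j), (0, k)) = farr (?R I A) ((0, j), (0, k)) \<cdot> \<gamma> I j"
      if jk: "j \<in> I" "k \<in> I" "j \<le> k" for j k
    proof -
      have f: "((0, j), (0, k)) \<in> Arr (ar_cat I)" using jk P_zero[OF I] by simp
      note a = S_hom[OF X[OF I] f] and b = S_hom[OF RA[OF I] f]
      \<comment> \<open>By \<open>P_edge\<close> the last case occurs only for consecutive vertices,
        whose square holds by the choice of the steps.\<close>
      consider "j = 0" | "j = k" | "0 < j" "j < k" using jk by linarith
      then show ?thesis
      proof cases
        case 1
        show ?thesis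
          by (rule from_zero_unique)
             (use 1 comp_hom[OF a \<gamma>(1)[OF I jk(2)]] comp_hom[OF \<gamma>(1)[OF I jk(1)]] b R0 jk
               X0[OF I] in auto)
      next
        case 2
        then show ?thesis
          using S_idt[OF X[OF I] ar[OF I jk(1)]] S_idt[OF RA[OF I] ar[OF I jk(1)]]
            id_left[OF \<gamma>(1)[OF I jk(1)]] id_right[OF \<gamma>(1)[OF I jk(1)]] R0[OF jk(1)] by simp
      next
        case 3
        then have k: "k = Suc j" "I = {0, j, Suc j}" using P_edge[OF I jk(1,2)] by auto
        then have "j < n" using P_sub[OF I] by auto
        then show ?thesis using s\<gamma> As 3 k f by simp
      qed
    qed
    have \<gamma>I: "\<gamma> I j \<in> hom C (fobj (X I) (0, j)) (fobj (?R I A) (0, j))" "\<gamma> I j \<in> weq C" if "j \<in> I" for j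
      using \<gamma>(1)[OF I that] R0[OF that] weq_iso[OF \<gamma>(2)[OF I that]] by simp_all
    obtain t where "t \<in> hom (wS_cat C I) (X I) (?R I A)" "\<And>j. j \<in> I \<Longrightarrow> ncomp t (0, j) = \<gamma> I j"
    proof (rule wS_hom_extend[OF X[OF I] RA[OF I] P_zero[OF I] _ \<gamma>I nat])
    qed auto
    then show ?thesis by blast
  qed
  then obtain t where t: "\<And>I. I \<in> P \<Longrightarrow> t I \<in> hom (wS_cat C I) (X I) (?R I A)"
    and t\<gamma>: "\<And>I j. \<lbrakk>I \<in> P; j \<in> I\<rbrakk> \<Longrightarrow> ncomp (t I) (0, j) = \<gamma> I j"
    by metis
  \<comment> \<open>The comparison maps run from \<open>x\<close> to the image of \<open>A\<close>;
    the isomorphism wanted runs the other way and is obtained at the end as the inverse.\<close>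
  define e where "e = \<lparr>nsrc = x, ntgt = ?A, ncomp = restrict t P\<rparr>"
  have e: "e \<in> hom (holim P (wS_cat C) S_restr) x ?A"
    unfolding holim_hom_iff
  proof (intro conjI ballI impI)
    show "x \<in> holim_objects P (wS_cat C) S_restr" by fact
    show "?A \<in> holim_objects P (wS_cat C) S_restr"
      using functor_obj[OF functor_wS_segal, of A] A by (simp add: segal_map_simps)
    show "nsrc e = x" "ntgt e = ?A" "ncomp e \<in> extensional P" by (simp_all add: e_def)
    show "ncomp e I \<in> hom (wS_cat C I) (fst x I) (fst ?A I)" if "I \<in> P" for I
      using t[OF that] that by (simp add: e_def segal_map_obj_simps X_def)
    fix I J assume IJ: "I \<in> P" "J \<in> P" "J \<subseteq> I"
    interpret J: category "wS_cat C J" by (rule category_wS)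
    have r: "farr (S_restr I J) (t I) \<in> hom (wS_cat C J) (fobj (S_restr I J) (X I)) (?R J A)"
      using S_restr_hom[OF IJ(3) t[OF IJ(1)], of I] S_restr_trans(1)[OF IJ(3)] by metis
    have l: "t J \<cdot>\<^bsub>wS_cat C J\<^esub> snd x (I, J) \<in> hom (wS_cat C J) (fobj (S_restr I J) (X I)) (?R J A)"
      using J.comp_hom[OF th[OF IJ] t[OF IJ(2)]] .
    \<comment> \<open>The coherence isomorphisms of the image are identities, so this is the whole
      coherence condition. On the row it is the compatibility
      \<open>\<gamma>\<theta>\<close>.\<close>
    have "t J \<cdot>\<^bsub>wS_cat C J\<^esub> snd x (I, J) = farr (S_restr I J) (t I)"
    proof (rule wS_hom_unique[OF wS_homD(1)[OF l] wS_homD(2)[OF l] P_zero[OF IJ(2)] _ l r])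
      fix j assume j: "j \<in> J"
      then have "ncomp (t J) (0, j) \<cdot> ncomp (snd x (I, J)) (0, j) = ncomp (t I) (0, j)"
        using \<gamma>\<theta>[OF IJ j] t\<gamma> IJ by (auto simp: \<theta>_def)
      then show "ncomp (t J \<cdot>\<^bsub>wS_cat C J\<^esub> snd x (I, J)) (0, j) = ncomp (farr (S_restr I J) (t I)) (0, j)"
        using ar[OF IJ(2) j] by simp
    qed simp
    then show "ncomp e J \<cdot>\<^bsub>wS_cat C J\<^esub> snd x (I, J)
        = snd ?A (I, J) \<cdot>\<^bsub>wS_cat C J\<^esub> farr (S_restr I J) (ncomp e I)"
      unfolding segal_map_obj_simps(2)[OF IJ] using J.id_left[OF r] IJ
      by (simp add: e_def del: wS_cat_simps)
  qed
  have "is_iso (holim P (wS_cat C) S_restr) e"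
  proof (rule holim_isoI[OF category_wS functor_S_restr e])
    fix I assume I: "I \<in> P"
    have "is_iso (wS_cat C I) (t I)"
      using wS_isoI[OF t[OF I] P_zero[OF I]] t\<gamma>[OF I] \<gamma>(2)[OF I] by simp
    then show "is_iso (wS_cat C I) (ncomp e I)" using I by (simp add: e_def)
  qed
  from H.is_isoE[OF this e] show ?thesis using A by metis
qed

lemma wS_segal_equivalence:
  "is_equivalence (wS_cat C {0..n}) (segal_holim n \<T> (wS_cat C) S_restr)
     (segal_map n \<T> (wS_cat C) S_restr)"
  unfolding segal_holim_def P_def[symmetric]
proof (rule equivalenceI[OF category_wS _ functor_wS_segal])
  show "category (holim P (wS_cat C) S_restr)"
    by (rule category_holim[OF category_wS functor_S_restr])
qed (use segal_fully_faithful segal_essentially_surjective in \<open>simp_all add: segal_map_simps\<close>)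

end

end


section \<open>Fan triangulations\<close>

text \<open>For vertices d apart and t = pi/(n + 1), the product formula gives cos 2t - cos 2td = 2
  sin t(d + 1) sin t(d - 1), and 1 \<le> d \<le> n keeps both angles between 0 and pi. Thus no other
  vertex has a larger inner product with a vertex than its neighbours have.\<close>

lemma vertex_cos_le:
  assumes "j \<le> n" "k \<le> n" "j \<noteq> k"
  shows "cos (2 * pi * (real k - real j) / real (n + 1)) \<le> cos (2 * pi / real (n + 1))"
proof -
  have *: "cos (2 * pi * real d / real (n + 1)) \<le> cos (2 * pi / real (n + 1))"
    if d: "1 \<le> d" "d \<le> n" for d
  proof -
    define t where "t = pi / real (n + 1)"
    have t: "2 * pi / real (n + 1) = 2 * t" "2 * pi * real d / real (n + 1) = 2 * (t * real d)"
      by (simp_all add: t_def)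
    have "0 < t" by (simp add: t_def)
    have "t * (real d + 1) \<le> t * real (n + 1)" "t * (real d - 1) \<le> t * real (n + 1)"
      using d \<open>0 < t\<close> by (intro mult_left_mono; simp)+
    moreover have "t * real (n + 1) = pi" by (simp add: t_def del: of_nat_Suc of_nat_add)
    ultimately have le: "t * (real d + 1) \<le> pi" "t * (real d - 1) \<le> pi" by linarith+
    have "0 \<le> t * (real d + 1)" "0 \<le> t * (real d - 1)" using d \<open>0 < t\<close> by auto
    with le have "0 \<le> sin (t * (real d + 1))" "0 \<le> sin (t * (real d - 1))"
      using sin_ge_zero by blast+
    moreover have "(2 * t + 2 * (t * real d)) / 2 = t * (real d + 1)"
      "(2 * (t * real d) - 2 * t) / 2 = t * (real d - 1)"
      by (simp_all add: field_simps)
    then have "cos (2 * t) - cos (2 * (t * real d)) = 2 * sin (t * (real d + 1)) * sin (t * (real d - 1))"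
      unfolding cos_diff_cos by simp
    ultimately show ?thesis
      unfolding t by (metis diff_ge_0_iff_ge mult_nonneg_nonneg zero_le_numeral)
  qed
  show ?thesis
  proof (cases "j < k")
    case True
    then show ?thesis using *[of "k - j"] assms by (simp add: of_nat_diff)
  next
    case False
    then have "2 * pi * (real k - real j) / real (n + 1) = - (2 * pi * real (j - k) / real (n + 1))"
      using assms by (simp add: of_nat_diff field_simps)
    then show ?thesis using *[of "j - k"] False assms by (simp only: cos_minus)
  qed
qed

lemma vertex_inner: "polygon_vertex n j \<bullet> polygon_vertex n k
    = cos (2 * pi * (real k - real j) / real (n + 1))"
proof -
  have "2 * pi * (real k - real j) / real (n + 1)
      = 2 * pi * real k / real (n + 1) - 2 * pi * real j / real (n + 1)"
    by (simp add: right_diff_distrib diff_divide_distrib)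
  then show ?thesis
    by (simp add: polygon_vertex_def inner_complex_def cos_diff mult.commute)
qed

text \<open>The chord through the neighbours of the vertex \<open>j\<close> cuts off \<open>j\<close> from all other vertices.\<close>

lemma polygon_hull_cap:
  assumes I: "I \<subseteq> {0..n}" and j: "j \<le> n" and z: "z \<in> polygon_hull n I"
    and cap: "polygon_vertex n j \<bullet> z > cos (2 * pi / real (n + 1))"
  shows "j \<in> I"
proof (rule ccontr)
  assume "j \<notin> I"
  let ?H = "{z. polygon_vertex n j \<bullet> z \<le> cos (2 * pi / real (n + 1))}"
  have "polygon_vertex n ` I \<subseteq> ?H"
  proof (rule image_subsetI)
    fix k assume "k \<in> I"
    then have "k \<le> n" "j \<noteq> k" using I \<open>j \<notin> I\<close> by auto
    then show "polygon_vertex n k \<in> ?H" using vertex_cos_le[OF j] by (simp add: vertex_inner)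
  qed
  then have "polygon_hull n I \<subseteq> ?H"
    unfolding polygon_hull_def by (rule hull_minimal) (rule convex_halfspace_le)
  then show False using z cap by auto
qed

lemma cos_polygon_less_1:
  assumes "0 < n"
  shows "cos (2 * pi / real (n + 1)) < 1"
proof -
  have "0 < sin (pi / real (n + 1))"
    using assms by (intro sin_gt_zero) (auto simp: divide_less_eq)
  moreover have "cos (2 * pi / real (n + 1)) = 1 - 2 * (sin (pi / real (n + 1)))\<^sup>2"
    using cos_double_sin[of "pi / real (n + 1)"] by (simp add: mult.commute)
  ultimately show ?thesis by (simp del: of_nat_Suc of_nat_add)
qed

text \<open>A vertex lies in its own cap, its inner product with itself being 1.\<close>

lemma vertex_in_hull:
  assumes "0 < n" "I \<subseteq> {0..n}" "j \<le> n" "polygon_vertex n j \<in> polygon_hull n I"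
  shows "j \<in> I"
  by (rule polygon_hull_cap[OF assms(2-4)]) (use cos_polygon_less_1[OF assms(1)] in \<open>simp add: vertex_inner\<close>)

text \<open>With c the cosine of the central angle of an edge, the midpoint has inner product (1 +
  c)/2 > c with each end, so it lies in the caps of both ends.\<close>

lemma edge_in_hull:
  assumes n: "0 < n" and I: "I \<subseteq> {0..n}" and j: "j < n"
    and mid: "midpoint (polygon_vertex n j) (polygon_vertex n (Suc j)) \<in> polygon_hull n I"
  shows "j \<in> I" "Suc j \<in> I"
proof -
  let ?c = "cos (2 * pi / real (n + 1))"
  have c: "polygon_vertex n j \<bullet> polygon_vertex n (Suc j) = ?c"
    by (simp add: vertex_inner)
  have s: "polygon_vertex n i \<bullet> polygon_vertex n i = 1" for i
    by (simp add: vertex_inner)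
  have e: "polygon_vertex n j \<bullet> midpoint (polygon_vertex n j) (polygon_vertex n (Suc j)) = (1 + ?c) / 2"
    "polygon_vertex n (Suc j) \<bullet> midpoint (polygon_vertex n j) (polygon_vertex n (Suc j)) = (1 + ?c) / 2"
    using c s by (simp_all add: midpoint_def inner_add_right inner_commute)
  show "j \<in> I"
    by (rule polygon_hull_cap[OF I _ mid]) (use j cos_polygon_less_1[OF n] in \<open>simp_all add: e(1)\<close>)
  show "Suc j \<in> I"
    by (rule polygon_hull_cap[OF I _ mid]) (use j cos_polygon_less_1[OF n] in \<open>simp_all add: e(2)\<close>)
qed

text \<open>Twice the signed area of the triangle a, b, c, that is, the determinant of b - a and c -
  a; it is positive for counterclockwise order.\<close>

definition area2 :: "complex \<Rightarrow> complex \<Rightarrow> complex \<Rightarrow> real" where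
  "area2 a b c = (Re b - Re a) * (Im c - Im a) - (Im b - Im a) * (Re c - Re a)"

text \<open>For a triangle inscribed in the unit circle the sines are, up to sign, those of its
  angles. An inscribed angle is half the central angle, hence the doubled arguments.\<close>

lemma area2_cis:
  "area2 (cis (2 * x)) (cis (2 * y)) (cis (2 * z)) = 4 * sin (y - x) * sin (z - y) * sin (z - x)"
proof -
  have p: "cos t * cos t = 1 - sin t * sin t" for t :: real
    using sin_cos_squared_add[of t] by (simp add: power2_eq_square)
  show ?thesis
    using p[of x] p[of y] p[of z]
    by (simp add: area2_def sin_diff cos_double_sin sin_double power2_eq_square) algebra
qed

text \<open>The three angle differences have the form pi (m - l)/(n + 1) with l < m \<le> n, hence
  lie strictly between 0 and pi, where the sine is positive.\<close>

lemma area2_vertices: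
  assumes "i < j" "j < k" "k \<le> n"
  shows "0 < area2 (polygon_vertex n i) (polygon_vertex n j) (polygon_vertex n k)"
proof -
  have v: "polygon_vertex n l = cis (2 * (pi * real l / real (n + 1)))" for l
    by (simp add: polygon_vertex_def mult.assoc)
  have "0 < sin (pi * real m / real (n + 1) - pi * real l / real (n + 1))" if "l < m" "m \<le> n" for l m
  proof (rule sin_gt_zero)
    have e: "pi * real m / real (n + 1) - pi * real l / real (n + 1) = pi * ((real m - real l) / real (n + 1))"
      by (simp add: right_diff_distrib diff_divide_distrib)
    show "0 < pi * real m / real (n + 1) - pi * real l / real (n + 1)"
      unfolding e using that by simp
    have "(real m - real l) / real (n + 1) < 1" using that by (simp add: divide_less_eq)
    from mult_strict_left_mono[OF this pi_gt_zero]
    show "pi * real m / real (n + 1) - pi * real l / real (n + 1) < pi"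
      unfolding e by (simp only: mult_1_right)
  qed
  then show ?thesis using assms unfolding v area2_cis by simp
qed

text \<open>The crossing point is read off from the affine dependency of the four points whose coefficients are
  the areas of the four triangles.\<close>

lemma diagonals_cross:
  assumes "0 < area2 a b c" "0 < area2 a b d" "0 < area2 a c d" "0 < area2 b c d"
  obtains p where "p \<in> open_segment b d" "p \<in> closed_segment a c"
proof -
  \<comment> \<open>S is twice the area of the quadrilateral, cut along ac; cutting along bd gives
    the same value. Each diagonal divides the other in the ratio of the two triangles that it cuts
    off, which yields \<open>u\<close> and \<open>w\<close>.\<close>
  define S where "S = area2 a c d + area2 a b c"
  define u where "u = area2 a b c / S"
  define w where "w = area2 a b d / S"
  have S: "S = area2 b c d + area2 a b d"
    by (simp add: S_def area2_def algebra_simps)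
  have "0 < S" using assms by (simp add: S_def)
  have bd: "b \<noteq> d" using assms by (auto simp: area2_def)
  have u: "0 < u" "u < 1" using assms \<open>0 < S\<close> by (auto simp: u_def S_def field_simps)
  have w: "0 \<le> w" "w \<le> 1" using assms \<open>0 < S\<close> S by (auto simp: w_def field_simps)
  have "S *\<^sub>R ((1 - u) *\<^sub>R b + u *\<^sub>R d) = (S - area2 a b c) *\<^sub>R b + area2 a b c *\<^sub>R d"
    using \<open>0 < S\<close> by (simp add: u_def scaleR_add_right right_diff_distrib)
  also have "\<dots> = (S - area2 a b d) *\<^sub>R a + area2 a b d *\<^sub>R c"
    unfolding S_def by (simp add: complex_eq_iff area2_def algebra_simps)
  also have "\<dots> = S *\<^sub>R ((1 - w) *\<^sub>R a + w *\<^sub>R c)"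
    using \<open>0 < S\<close> by (simp add: w_def scaleR_add_right right_diff_distrib)
  finally have "(1 - u) *\<^sub>R b + u *\<^sub>R d = (1 - w) *\<^sub>R a + w *\<^sub>R c"
    using \<open>0 < S\<close> by simp
  then show thesis using that u w bd by (metis in_segment)
qed

text \<open>Covering the midpoint of the edge from j to j + 1 forces the triangle {0, j, j + 1}. Any
  other triangle {0, i, k} with i < k has k > i + 1, so its side from i to k crosses the side from 0
  to i + 1 of the triangle {0, i, i + 1}. This is impossible, since triangles of a triangulation
  meet in a common face.\<close>

lemma fan_triangulation:
  assumes T: "polygon_triangulation n \<T>" and z: "\<forall>I \<in> \<T>. 0 \<in> I"
  shows "\<T> = {{0, j, Suc j} | j. 0 < j \<and> j < n}" "2 \<le> n"
proof -
  have sub: "I \<subseteq> {0..n}" and card: "card I = 3" if "I \<in> \<T>" for I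
    using T that by (auto simp: polygon_triangulation_def)
  have cover: "\<exists>I\<in>\<T>. p \<in> polygon_hull n I" if "p \<in> polygon_hull n {0..n}" for p
    using T that unfolding polygon_triangulation_def by blast
  have face: "polygon_hull n I \<inter> polygon_hull n J face_of polygon_hull n I"
    if "I \<in> \<T>" "J \<in> \<T>" for I J
    using T that unfolding polygon_triangulation_def triangulation_def by blast
  have vertex: "polygon_vertex n i \<in> polygon_hull n I" if "i \<in> I" for i I
    unfolding polygon_hull_def by (rule hull_inc) (use that in blast)
  have seg: "closed_segment (polygon_vertex n i) (polygon_vertex n j) \<subseteq> polygon_hull n I"
    if "i \<in> I" "j \<in> I" for i j I
    using vertex[OF that(1)] vertex[OF that(2)]
    unfolding polygon_hull_def by (intro closed_segment_subset convex_convex_hull)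
  obtain I where "I \<in> \<T>" using cover[OF vertex[of 0]] by auto
  then show n: "2 \<le> n" using card card_mono[OF _ sub] by fastforce
  have fan: "{0, j, Suc j} \<in> \<T>" if j: "0 < j" "j < n" for j
  proof -
    have "midpoint (polygon_vertex n j) (polygon_vertex n (Suc j)) \<in> polygon_hull n {0..n}"
      using seg[of j "{0..n}" "Suc j"] j by (auto simp: midpoint_in_closed_segment)
    then obtain I where I: "I \<in> \<T>"
      "midpoint (polygon_vertex n j) (polygon_vertex n (Suc j)) \<in> polygon_hull n I"
      using cover by blast
    have "{0, j, Suc j} \<subseteq> I"
      using edge_in_hull[OF _ sub[OF I(1)] j(2) I(2)] z I n by auto
    moreover have "finite I" using card[OF I(1)] by (simp add: card_ge_0_finite)
    moreover have "card {0, j, Suc j} = 3" using j by simp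
    ultimately show ?thesis using card[OF I(1)] card_subset_eq I(1) by metis
  qed
  have "\<exists>j. I = {0, j, Suc j} \<and> 0 < j \<and> j < n" if I: "I \<in> \<T>" for I
  proof -
    have "card (I - {0}) = 2" using card[OF I] z I by simp
    then obtain i k where ik: "I - {0} = {i, k}" "i < k"
      by (metis card_2_iff insert_commute linorder_neqE_nat)
    have "0 \<in> I" using z I by blast
    then have Ie: "I = {0, i, k}" using ik(1) by blast
    have "i \<in> I - {0}" "k \<in> I - {0}" unfolding ik(1) by simp_all
    then have i: "0 < i" "k \<le> n" using sub[OF I] by auto
    show ?thesis
    proof (cases "k = Suc i")
      case True
      then show ?thesis using Ie i by auto
    next
      case False
      then have k: "Suc i < k" using ik by simp
      let ?J = "{0, i, Suc i}"
      have J: "?J \<in> \<T>" using fan[of i] i k by simp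
      obtain p where p: "p \<in> open_segment (polygon_vertex n i) (polygon_vertex n k)"
          "p \<in> closed_segment (polygon_vertex n 0) (polygon_vertex n (Suc i))"
        by (rule diagonals_cross[of "polygon_vertex n 0" "polygon_vertex n i"
              "polygon_vertex n (Suc i)" "polygon_vertex n k"])
           (use i k in \<open>auto intro: area2_vertices\<close>)
      have "p \<in> polygon_hull n I \<inter> polygon_hull n ?J"
        using p seg[of i I k] seg[of 0 ?J "Suc i"] Ie by (auto simp: open_segment_def)
      \<comment> \<open>A face containing an inner point of a segment in the triangle contains both
        ends of it, so k would lie in the hull of {0, i, i + 1}.\<close>
      then have "polygon_vertex n k \<in> polygon_hull n ?J"
        using face_ofD[OF face[OF I J] p(1)] vertex[of i I] vertex[of k I] Ie by auto
      then have "k \<in> ?J" using vertex_in_hull[OF _ sub[OF J]] i n by auto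
      then show ?thesis using k by auto
    qed
  qed
  then show "\<T> = {{0, j, Suc j} | j. 0 < j \<and> j < n}" using fan by blast
qed

text \<open>A pair in {0, j, j + 1} that avoids 0 is a polygon edge; one that contains 0 is a
  polygon edge exactly when its other vertex is 1 or n.\<close>

lemma fan_diagonals:
  assumes "\<T> = {{0, j, Suc j} | j. 0 < j \<and> j < n}"
  shows "diagonals n \<T> = {{0, j} | j. 1 < j \<and> j < n}"
proof (intro equalityI subsetI)
  fix e assume e: "e \<in> diagonals n \<T>"
  then obtain j where j: "0 < j" "j < n" "e \<subseteq> {0, j, Suc j}" and c: "card e = 2"
    and ne: "e \<notin> polygon_edges n"
    unfolding diagonals_def assms by blast
  obtain a b where ab: "e = {a, b}" "a < b"
    using c by (metis card_2_iff insert_commute linorder_neqE_nat)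
  have edge: "{k, (k + 1) mod (n + 1)} \<in> polygon_edges n" if "k \<le> n" for k
    using that unfolding polygon_edges_def by blast
  have "{j, Suc j} \<in> polygon_edges n" "{0, 1} \<in> polygon_edges n" "{n, 0} \<in> polygon_edges n"
    using edge[of j] edge[of 0] edge[of n] j by auto
  then have "e \<noteq> {j, Suc j}" "e \<noteq> {0, 1}" "e \<noteq> {0, n}"
    using ne by (auto simp: insert_commute)
  then have "a = 0" "b \<noteq> 1" "b \<noteq> n" using ab j(3) by auto
  moreover have "b \<le> n" "0 < b" using ab j by auto
  ultimately show "e \<in> {{0, j} | j. 1 < j \<and> j < n}" using ab by auto
next
  fix e assume "e \<in> {{0, j} | j. 1 < j \<and> j < n}"
  then obtain j where j: "e = {0, j}" "1 < j" "j < n" by blast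
  have "e \<noteq> {k, (k + 1) mod (n + 1)}" if "k \<le> n" for k
    using that j by (cases "k = n") (auto simp: doubleton_eq_iff)
  then have "e \<notin> polygon_edges n" unfolding polygon_edges_def by blast
  moreover have "card e = 2" using j by simp
  moreover have "e \<subseteq> {0, j, Suc j}" "{0, j, Suc j} \<in> \<T>" using j assms by auto
  ultimately show "e \<in> diagonals n \<T>" unfolding diagonals_def by blast
qed

lemma (in waldhausen_category) wS_segal_fan:
  assumes T: "polygon_triangulation n \<T>" and z: "\<forall>I \<in> \<T>. 0 \<in> I"
  shows "is_equivalence (wS_cat C {0..n}) (segal_holim n \<T> (wS_cat C) S_restr)
     (segal_map n \<T> (wS_cat C) S_restr)"
proof -
  note n = fan_triangulation(2)[OF T z]
  \<comment> \<open>Each of the vertices 1 and n lies in one triangle and on no diagonal, so that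
    triangle is its smallest member; every other positive vertex has its diagonal to 0. For n = 2
    both clauses give the only triangle.\<close>
  let ?m = "\<lambda>j. if j = 1 then {0, 1, Suc 1} else if j = n then {0, n - 1, n} else {0, j}"
  have P: "I \<in> triangulation_poset n \<T> \<longleftrightarrow>
      (\<exists>j. 0 < j \<and> j < n \<and> I = {0, j, Suc j}) \<or> (\<exists>j. 1 < j \<and> j < n \<and> I = {0, j})" for I
    unfolding triangulation_poset_def fan_diagonals[OF fan_triangulation(1)[OF T z]]
    unfolding fan_triangulation(1)[OF T z] by blast
  show ?thesis
  proof (rule wS_segal_equivalence[where m = ?m, OF refl])
    fix j :: nat assume j: "0 < j" "j \<le> n"
    consider "j = 1" | "j \<noteq> 1" "j = n" | "1 < j" "j < n" using j by linarith
    then show "?m j \<in> triangulation_poset n \<T>"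
    proof cases
      case 1
      then have "?m j = {0, 1, Suc 1}" by simp
      moreover have "(0::nat) < 1" "1 < n" using n by auto
      ultimately show ?thesis unfolding P by blast
    next
      case 2
      then have "?m j = {0, n - 1, Suc (n - 1)}" using n by simp
      moreover have "0 < n - 1" "n - 1 < n" using n by auto
      ultimately show ?thesis unfolding P by blast
    next
      case 3
      then show ?thesis unfolding P by auto
    qed
  next
    fix I and j k :: nat
    assume "I \<in> triangulation_poset n \<T>" "j \<in> I" "k \<in> I" "0 < j" "j < k"
    then show "k = Suc j \<and> I = {0, j, Suc j}" unfolding P by auto
  qed (auto simp: P)
qed

text \<open>The first part is the second one for the Waldhausen category in which all maps are weak equivalences.\<close>

definition maximal_wald :: "('o, 'm) cof_cat \<Rightarrow> ('o, 'm) wald_cat" where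
  "maximal_wald C = \<lparr>Obj = Obj C, Arr = Arr C, Dom = Dom C, Cod = Cod C, Idt = Idt C, Comp = Comp C,
     zero = zero C, cof = cof C, weq = Arr C\<rparr>"

lemma maximal_wald_simps [simp]:
  "Obj (maximal_wald C) = Obj C" "Arr (maximal_wald C) = Arr C" "Dom (maximal_wald C) = Dom C"
  "Cod (maximal_wald C) = Cod C" "Idt (maximal_wald C) = Idt C" "Comp (maximal_wald C) = Comp C"
  "zero (maximal_wald C) = zero C" "cof (maximal_wald C) = cof C" "weq (maximal_wald C) = Arr C"
  by (simp_all add: maximal_wald_def)

lemma hom_maximal_wald [simp]: "hom (maximal_wald C) = hom C"
  by (intro ext) (simp add: hom_def)

lemma is_pushout_maximal_wald [simp]: "is_pushout (maximal_wald C) = is_pushout C"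
  by (intro ext) (simp add: is_pushout_def)

lemma is_iso_maximal_wald [simp]: "is_iso (maximal_wald C) = is_iso C"
  by (intro ext) (simp add: is_iso_def)

text \<open>With all arrows as weak equivalences the gluing axiom says only that the induced map is
  an arrow, and the other axioms for them are closure properties of arrows.\<close>

lemma waldhausen_maximal_wald:
  assumes "category_with_cofibrations C"
  shows "waldhausen_category (maximal_wald C)"
proof -
  interpret category_with_cofibrations C by fact
  show ?thesis
  proof
    show "is_zero_object (maximal_wald C) (zero (maximal_wald C))"
      using zero by (simp add: is_zero_object_def)
    show "weq (maximal_wald C) \<subseteq> Arr (maximal_wald C)" by simp
    show "f \<in> weq (maximal_wald C)" if "is_iso (maximal_wald C) f" for f
      using that by (simp add: is_iso_def)
    show "g \<cdot>\<^bsub>maximal_wald C\<^esub> f \<in> weq (maximal_wald C)"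
      if "f \<in> weq (maximal_wald C)" "g \<in> weq (maximal_wald C)"
        "Dom (maximal_wald C) g = Cod (maximal_wald C) f" for f g
      using that hom_arr[OF comp_hom[OF arr_hom[of f], of g "Cod C g"]] by (simp add: hom_def)
  qed (use dom_obj cod_obj idt_hom comp_hom comp_idt_left comp_idt_right comp_assoc cof_arr cof_zero
      cof_iso cof_comp cof_pushout_exists cof_pushout hom_arr in \<open>simp_all\<close>)
qed

text \<open>Components of natural transformations are arrows, so the condition on them holds
  automatically. The equality is one of families in I because the homotopy limit and the 2-Segal map
  take the whole family as argument.\<close>

lemma wS_maximal_wald: "wS_cat (maximal_wald C) = S_cat C"
proof
  fix I :: "'i::linorder set"
  have "functor_cat (ar_cat I) (maximal_wald C) = functor_cat (ar_cat I) C"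
    by (simp add: functor_cat_def is_functor_def is_nat_trans_def)
  then have S: "S_cat (maximal_wald C) I = S_cat C I"
    by (simp add: S_cat_def S_objects_def cofibration_sequence_def)
  have "{t \<in> Arr (S_cat C I). \<forall>a\<in>ar_set I. ncomp t a \<in> Arr C} = Arr (S_cat C I)"
    by (auto simp: S_cat_def full_subcat_def functor_cat_def Let_def is_nat_trans_def hom_def)
  then show "wS_cat (maximal_wald C) I = S_cat C I"
    by (simp add: wS_cat_def S)
qed

theorem proposition8p3:
  fixes n :: nat and \<T> :: "nat set set"
  assumes "polygon_triangulation n \<T>"
    and "\<forall>I \<in> \<T>. 0 \<in> I"
  shows "(\<forall>C :: ('o, 'm) cof_cat. category_with_cofibrations C \<longrightarrow>
            is_equivalence (S_cat C {0..n}) (segal_holim n \<T> (S_cat C) S_restr)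
              (segal_map n \<T> (S_cat C) S_restr)) \<and>
         (\<forall>C :: ('p, 'q) wald_cat. waldhausen_category C \<longrightarrow>
            is_equivalence (wS_cat C {0..n}) (segal_holim n \<T> (wS_cat C) S_restr)
              (segal_map n \<T> (wS_cat C) S_restr))"
proof (intro conjI allI impI)
  fix C :: "('o, 'm) cof_cat"
  assume "category_with_cofibrations C"
  then show "is_equivalence (S_cat C {0..n}) (segal_holim n \<T> (S_cat C) S_restr)
      (segal_map n \<T> (S_cat C) S_restr)"
    using waldhausen_category.wS_segal_fan[OF waldhausen_maximal_wald assms]
    by (simp add: wS_maximal_wald)
next
  fix C :: "('p, 'q) wald_cat"
  assume "waldhausen_category C"
  then show "is_equivalence (wS_cat C {0..n}) (segal_holim n \<T> (wS_cat C) S_restr)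
      (segal_map n \<T> (wS_cat C) S_restr)"
    by (rule waldhausen_category.wS_segal_fan[OF _ assms])
qed

end
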